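(* Consider the freight marketplace Markov decision process and the fluid problem $(\mathsf{FA})$ described in the context. The optimal value of $(\mathsf{FA})$ is an upper bound for the long-run average profit $\gamma^{\pi}$ of the system under any stationary policy $\pi\in\Pi$.
   Context: Network and dynamics. $\mathcal N=\{1,\dots,n\}$ is a set of nodes and $\mathcal E\subseteq\mathcal N\times\mathcal N$ a set of lanes, containing all self-loops $(i,i)$; $\delta^+(j)=\{k:(j,k)\in\mathcal E\}$, $\delta^-(j)=\{i:(i,j)\in\mathcal E\}$. Time is discrete. At the beginning of period $t$ the state is $(\mathbf S_t,\mathbf D_t)$, where $S_{it}$ is the number of carriers available at node $i$ (the set of them is $\mathcal S_{it}$) and $D_{ijt}$ is the number of loads on lane $(i,j)$. Observing the state, the platform applies a shipper-side mechanism $\mathcal M_r$ and a carrier-side mechanism $\mathcal M_p$. Shippers: $\mathcal M_r$ sets prices $r_{ijt}$, and $D_{ij,t+1}$ is Poisson with mean $d_{ij}(r_{ijt})$, where $d_{ij}(\cdot)$ is strictly decreasing with inverse $r_{ij}(\cdot)$, and $d\mapsto r_{ij}(d)d$ is concave. Carriers: each carrier transports at most one load per period and each trip takes one period. $Y_{ijt}\le D_{ijt}$ is the number of carriers transporting a load on $(i,j)$ in period $t$, $V_{it}$ is the number of carriers leaving the marketplace from node $i$, and $\sum_{j\in\delta^+(i)}Y_{ijt}+V_{it}=S_{it}$. Given $Y_{ijt}$, the number $Z_{ijt}$ of carriers who stay in the marketplace (at node $j$) after transporting on $(i,j)$ is Binomial$(Y_{ijt},q_{ij})$ with $q_{ij}\in(0,1)$.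 Then $S_{j,t+1}=\sum_{i\in\delta^-(j)}Z_{ijt}+\Lambda_{j,t+1}$ with $\Lambda_{j,t+1}$ Poisson of rate $\lambda_j>0$ (exogenous arrivals). Unmatched loads expire, at unit penalty cost $b_{ij}$. $P_{ijt}$ is the total payment to carriers who transported loads on $(i,j)$ in period $t$. Carrier costs: with payment $p^s_{ijt}$, carrier $s$ at node $i$ gets utility $U^s_{ijt}=\beta p^s_{ijt}-\alpha_{ij}+\epsilon^s_{ijt}$ from a load on $(i,j)$ and $U^s_{i0t}=\epsilon^s_{i0t}$ from the outside option, with $\beta>0$, $\alpha_{ij}>0$ and all $\epsilon$'s i.i.d. Gumbel (location 0, scale 1). The true opportunity cost is $C^s_{ijt}=(\alpha_{ij}-\epsilon^s_{ijt}+\epsilon^s_{i0t})/\beta$. Carrier-side mechanisms: in a first stage each carrier $s\in\mathcal S_{it}$ chooses a lane $(i,j)$ according to the multinomial logit model based on prices posted by the platform (the lane maximizing its utility at those prices). In the second stage carriers report bids (opportunity costs). A direct mechanism $\mathcal M_p=(\mathbf A,\mathbf P)$ specifies, for a bid vector $\mathbf c$, the probability $A^s_{ijt}(\mathbf c)\in[0,1]$ that $s$ is allocated a load on $(i,j)$ and the expected payment $P^s_{ijt}(\mathbf c)$ to $s$ for the service provided. Let $a^s_{ijt}(c)$ and $p^s_{ijt}(c)$ be the expectations of $A^s_{ijt}(c,\mathbf C^{-s}_{ijt})$ and $P^s_{ijt}(c,\mathbf C^{-s}_{ijt})$ over the true opportunity costs $\mathbf C^{-s}_{ijt}$ of the other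 carriers who chose lane $(i,j)$. The mechanism is incentive compatible (IC) if $p^s_{ijt}(C^s_{ijt})-a^s_{ijt}(C^s_{ijt})C^s_{ijt}\ge p^s_{ijt}(c)-a^s_{ijt}(c)C^s_{ijt}$ for all bids $c$ and all carriers $s$, and individually rational (IR) if $p^s_{ijt}(C^s_{ijt})-a^s_{ijt}(C^s_{ijt})C^s_{ijt}\ge0$ for all $s$. A stationary policy $\pi\in\Pi$ maps each state to a pair $(\mathcal M_r,\mathcal M_p)$; by the revelation principle, attention is restricted to direct mechanisms that are IC and IR. Profit: $\gamma^\pi=\lim_{T\to\infty}\frac1T\mathrm E\big[\sum_{t=1}^T G^\pi_t(\mathbf S_t,\mathbf D_t)\big]$, where $G^\pi_t(\mathbf S_t,\mathbf D_t)=\mathrm E\big[\sum_{(i,j)\in\mathcal E}r_{ijt}d_{ij}(r_{ijt})-b_{ij}(D_{ijt}-Y_{ijt})-P_{ijt}\,\big|\,\mathbf S_t,\mathbf D_t\big]$. Fluid problem: $$(\mathsf{FA}):\ \max_{\mathbf d,\bar{\mathbf y},\bar{\mathbf v}}\ \sum_{(i,j)\in\mathcal E}r_{ij}(d_{ij})d_{ij}-\frac1\beta\Big[\ln\Big(\frac{\bar y_{ij}}{\bar v_i}\Big)+\alpha_{ij}\Big]\bar y_{ij}-b_{ij}(d_{ij}-\bar y_{ij})$$ subject to $\sum_{i\in\delta^-(j)}q_{ij}\bar y_{ij}+\lambda_j=\sum_{k\in\delta^+(j)}\bar y_{jk}+\bar v_j$ for all $j\in\mathcal N$; $\bar y_{ij}\le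 d_{ij}$ and $\bar y_{ij}\ge0$ for all $(i,j)\in\mathcal E$; $\bar v_i\ge0$ for all $i\in\mathcal N$.
   Formalization: The revenue r_ij(d)d is additionally assumed bounded above on the attainable demand rates; without this the claim fails (r(d)=d^{-1/2}, b>0: serving nobody and setting sqrt(d_t)=bD_t+K earns K every period, for any K, while (FA) is finite). *)

theory Defs
  imports "HOL-Probability.Probability"
begin

type_synonym 'n lane = "'n \<times> 'n"

text \<open>
  A state records the number of available carriers at each node and the number of loads on each
  lane. The carriers at node \<open>i\<close> are the pairs \<open>(i, s)\<close> with \<open>s\<close> below that number.
\<close>

type_synonym 'n state = "('n \<Rightarrow> nat) \<times> ('n lane \<Rightarrow> nat)"

text \<open>
  The taste shocks of one period: \<open>\<omega> (i, s) (Some j)\<close> is the shock of carrier \<open>(i, s)\<close> for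
  lane \<open>(i, j)\<close>, and \<open>\<omega> (i, s) None\<close> is its shock for the outside option.
\<close>

type_synonym 'n shocks = "'n \<times> nat \<Rightarrow> 'n option \<Rightarrow> real"

record 'n market =
  lanes :: "'n lane set"
  price_set :: "'n lane \<Rightarrow> real set"
  demand :: "'n lane \<Rightarrow> real \<Rightarrow> real"
  penalty :: "'n lane \<Rightarrow> real"
  stay_prob :: "'n lane \<Rightarrow> real"
  arrival_rate :: "'n \<Rightarrow> real"
  cost_shift :: "'n lane \<Rightarrow> real"
  price_sens :: real

definition demand_set :: "'n market \<Rightarrow> 'n lane \<Rightarrow> real set" where
  "demand_set M e = demand M e ` price_set M e"

definition inv_demand :: "'n market \<Rightarrow> 'n lane \<Rightarrow> real \<Rightarrow> real" where
  "inv_demand M e = inv_into (price_set M e) (demand M e)"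

text \<open>
  The prices available on a lane form an arbitrary nonempty set; \<open>concave_on\<close> includes that the
  set of attainable demand rates is convex. The revenue rate is required to be bounded above:
  otherwise a policy can pay each period's penalties out of the revenue from an ever larger demand
  whose own penalty falls due only one period later, and its average profit exceeds the fluid value.
\<close>

definition valid_market :: "'n::finite market \<Rightarrow> bool" where
  "valid_market M \<longleftrightarrow>
     (\<forall>i. (i, i) \<in> lanes M) \<and>
     price_sens M > 0 \<and>
     (\<forall>j. arrival_rate M j > 0) \<and>
     (\<forall>e\<in>lanes M.
        cost_shift M e > 0 \<and>
        0 < stay_prob M e \<and> stay_prob M e < 1 \<and>
        penalty M e \<ge> 0 \<and>
        price_set M e \<noteq> {} \<and>
        (\<forall>r\<in>price_set M e. demand M e r \<ge> 0) \<and>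
        strict_antimono_on (price_set M e) (demand M e) \<and>
        concave_on (demand_set M e) (\<lambda>z. inv_demand M e z * z) \<and>
        bdd_above ((\<lambda>z. inv_demand M e z * z) ` demand_set M e))"


subsection \<open>Carriers\<close>

definition gumbel :: "real measure" where
  "gumbel = density lborel (\<lambda>x. ennreal (exp (- (x + exp (- x)))))"

definition shock_law :: "'n::finite state \<Rightarrow> 'n shocks measure" where
  "shock_law x = (\<Pi>\<^sub>M (i, s)\<in>{(i, s). s < fst x i}. \<Pi>\<^sub>M k\<in>UNIV. gumbel)"

text \<open>
  What the platform does in one period. In \<open>award a e N c\<close> and \<open>payment a e N c s\<close>, \<open>N\<close> is the
  set of carriers that chose lane \<open>e\<close> in the first stage and \<open>c\<close>, a function that is
  \<open>undefined\<close> outside \<open>N\<close>, is their bid vector. The award is a lottery over the set of carriers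
  that get a load, because its marginals alone would not determine the law of the number of loads
  transported; the payment is the expectation over this lottery.
\<close>

record 'n action =
  shipper_price :: "'n lane \<Rightarrow> real"
  posted_price :: "'n lane \<Rightarrow> real"
  award :: "'n lane \<Rightarrow> nat set \<Rightarrow> (nat \<Rightarrow> real) \<Rightarrow> nat set pmf"
  payment :: "'n lane \<Rightarrow> nat set \<Rightarrow> (nat \<Rightarrow> real) \<Rightarrow> nat \<Rightarrow> real"

definition award_prob :: "'n action \<Rightarrow> 'n lane \<Rightarrow> nat set \<Rightarrow> (nat \<Rightarrow> real) \<Rightarrow> nat \<Rightarrow> real" where
  "award_prob a e N c s = measure_pmf.prob (award a e N c) {W. s \<in> W}"

text \<open>Ties between lanes have probability zero.\<close>

definition chosen_lane :: "'n market \<Rightarrow> 'n action \<Rightarrow> 'n shocks \<Rightarrow> 'n \<times> nat \<Rightarrow> 'n lane" where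
  "chosen_lane M a \<omega> = (\<lambda>(i, s).
     (i, ARG_MAX (\<lambda>j. price_sens M * posted_price a (i, j) - cost_shift M (i, j)
                       + \<omega> (i, s) (Some j)) j. (i, j) \<in> lanes M))"

definition bidders :: "'n market \<Rightarrow> 'n action \<Rightarrow> 'n state \<Rightarrow> 'n shocks \<Rightarrow> 'n lane \<Rightarrow> nat set" where
  "bidders M a x \<omega> e = {s. s < fst x (fst e) \<and> chosen_lane M a \<omega> (fst e, s) = e}"

definition true_cost :: "'n market \<Rightarrow> 'n shocks \<Rightarrow> 'n lane \<Rightarrow> nat \<Rightarrow> real" where
  "true_cost M \<omega> e s =
     (cost_shift M e - \<omega> (fst e, s) (Some (snd e)) + \<omega> (fst e, s) None) / price_sens M"

definition true_bids :: "'n market \<Rightarrow> 'n shocks \<Rightarrow> 'n lane \<Rightarrow> nat set \<Rightarrow> nat \<Rightarrow> real" where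
  "true_bids M \<omega> e N = restrict (true_cost M \<omega> e) N"

definition shocks_given_bidders ::
    "'n::finite market \<Rightarrow> 'n action \<Rightarrow> 'n state \<Rightarrow> 'n lane \<Rightarrow> nat set \<Rightarrow> 'n shocks measure" where
  "shocks_given_bidders M a x e N =
     uniform_measure (shock_law x) {\<omega> \<in> space (shock_law x). bidders M a x \<omega> e = N}"

definition interim_award ::
    "'n::finite market \<Rightarrow> 'n action \<Rightarrow> 'n state \<Rightarrow> 'n lane \<Rightarrow> nat set \<Rightarrow> nat \<Rightarrow> real \<Rightarrow> real" where
  "interim_award M a x e N s c =
     (\<integral>\<omega>. award_prob a e N ((true_bids M \<omega> e N)(s := c)) s \<partial>shocks_given_bidders M a x e N)"

definition interim_payment ::
    "'n::finite market \<Rightarrow> 'n action \<Rightarrow> 'n state \<Rightarrow> 'n lane \<Rightarrow> nat set \<Rightarrow> nat \<Rightarrow> real \<Rightarrow> real" where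
  "interim_payment M a x e N s c =
     (\<integral>\<omega>. payment a e N ((true_bids M \<omega> e N)(s := c)) s \<partial>shocks_given_bidders M a x e N)"

text \<open>
  In both conditions \<open>c\<close> is the true cost; every real number is a possible true cost.
\<close>

definition incentive_compatible :: "'n::finite market \<Rightarrow> 'n state \<Rightarrow> 'n action \<Rightarrow> bool" where
  "incentive_compatible M x a \<longleftrightarrow>
     (\<forall>e\<in>lanes M. \<forall>N\<subseteq>{..<fst x (fst e)}. \<forall>s\<in>N. \<forall>c c'.
        interim_payment M a x e N s c - interim_award M a x e N s c * c
          \<ge> interim_payment M a x e N s c' - interim_award M a x e N s c' * c)"

definition individually_rational :: "'n::finite market \<Rightarrow> 'n state \<Rightarrow> 'n action \<Rightarrow> bool" where
  "individually_rational M x a \<longleftrightarrow>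
     (\<forall>e\<in>lanes M. \<forall>N\<subseteq>{..<fst x (fst e)}. \<forall>s\<in>N. \<forall>c.
        interim_payment M a x e N s c - interim_award M a x e N s c * c \<ge> 0)"

text \<open>At most one load per carrier and at most as many awards as there are loads.\<close>

definition feasible_award :: "'n market \<Rightarrow> 'n state \<Rightarrow> 'n action \<Rightarrow> bool" where
  "feasible_award M x a \<longleftrightarrow>
     (\<forall>e\<in>lanes M. \<forall>N\<subseteq>{..<fst x (fst e)}. \<forall>c.
        \<forall>W\<in>set_pmf (award a e N c). W \<subseteq> N \<and> card W \<le> snd x e)"

text \<open>All expectations that involve the carrier-side mechanism exist.\<close>

definition regular_mechanism :: "'n::finite market \<Rightarrow> 'n state \<Rightarrow> 'n action \<Rightarrow> bool" where
  "regular_mechanism M x a \<longleftrightarrow>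
     (\<forall>e\<in>lanes M. \<forall>N\<subseteq>{..<fst x (fst e)}.
        (\<forall>W. (\<lambda>c. pmf (award a e N c) W) \<in> borel_measurable (\<Pi>\<^sub>M s\<in>N. borel)) \<and>
        (\<forall>s\<in>N.
           (\<lambda>c. payment a e N c s) \<in> borel_measurable (\<Pi>\<^sub>M s\<in>N. borel) \<and>
           integrable (shocks_given_bidders M a x e N)
             (\<lambda>\<omega>. payment a e N (true_bids M \<omega> e N) s) \<and>
           (\<forall>c. integrable (shocks_given_bidders M a x e N)
             (\<lambda>\<omega>. payment a e N ((true_bids M \<omega> e N)(s := c)) s))))"

definition valid_action :: "'n::finite market \<Rightarrow> 'n state \<Rightarrow> 'n action \<Rightarrow> bool" where
  "valid_action M x a \<longleftrightarrow>
     (\<forall>e\<in>lanes M. shipper_price a e \<in> price_set M e) \<and>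
     feasible_award M x a \<and> regular_mechanism M x a \<and>
     incentive_compatible M x a \<and> individually_rational M x a"

type_synonym 'n policy = "'n state \<Rightarrow> 'n action"

definition policies :: "'n::finite market \<Rightarrow> 'n policy set" where
  "policies M = {\<pi>. \<forall>x. valid_action M x (\<pi> x)}"


subsection \<open>Dynamics\<close>

text \<open>\<open>poisson_pmf\<close> is specified for positive rates only.\<close>

definition poisson_law :: "real \<Rightarrow> nat pmf" where
  "poisson_law m = (if m = 0 then return_pmf 0 else poisson_pmf m)"

definition awarded_set ::
    "'n market \<Rightarrow> 'n action \<Rightarrow> 'n state \<Rightarrow> 'n shocks \<Rightarrow> 'n lane \<Rightarrow> nat set pmf" where
  "awarded_set M a x \<omega> e = award a e (bidders M a x \<omega> e) (true_bids M \<omega> e (bidders M a x \<omega> e))"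

definition staying_law ::
    "'n market \<Rightarrow> 'n action \<Rightarrow> 'n state \<Rightarrow> 'n shocks \<Rightarrow> 'n lane \<Rightarrow> nat pmf" where
  "staying_law M a x \<omega> e =
     bind_pmf (awarded_set M a x \<omega> e) (\<lambda>W. binomial_pmf (card W) (stay_prob M e))"

definition next_state_given ::
    "'n::finite market \<Rightarrow> 'n action \<Rightarrow> 'n state \<Rightarrow> 'n shocks \<Rightarrow> 'n state pmf" where
  "next_state_given M a x \<omega> =
     do {
       Z \<leftarrow> Pi_pmf (lanes M) 0 (staying_law M a x \<omega>);
       \<Lambda> \<leftarrow> Pi_pmf UNIV 0 (\<lambda>j. poisson_law (arrival_rate M j));
       D \<leftarrow> Pi_pmf (lanes M) 0 (\<lambda>e. poisson_law (demand M e (shipper_price a e)));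
       return_pmf (\<lambda>j. (\<Sum>i | (i, j) \<in> lanes M. Z (i, j)) + \<Lambda> j, D)
     }"

definition transition :: "'n::finite market \<Rightarrow> 'n action \<Rightarrow> 'n state \<Rightarrow> 'n state pmf" where
  "transition M a x = embed_pmf (\<lambda>x'. \<integral>\<omega>. pmf (next_state_given M a x \<omega>) x' \<partial>shock_law x)"

text \<open>The law of the states of periods \<open>1, \<dots>, T + 1\<close>, the most recent one first.\<close>

primrec history :: "'n::finite market \<Rightarrow> 'n policy \<Rightarrow> 'n state \<Rightarrow> nat \<Rightarrow> 'n state list pmf" where
  "history M \<pi> x\<^sub>1 0 = return_pmf [x\<^sub>1]"
| "history M \<pi> x\<^sub>1 (Suc T) =
     do {
       h \<leftarrow> history M \<pi> x\<^sub>1 T;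
       x \<leftarrow> transition M (\<pi> (hd h)) (hd h);
       return_pmf (x # h)
     }"


subsection \<open>Profit\<close>

definition period_profit :: "'n::finite market \<Rightarrow> 'n action \<Rightarrow> 'n state \<Rightarrow> real" where
  "period_profit M a x =
     (\<integral>\<omega>. (\<Sum>e\<in>lanes M.
        shipper_price a e * demand M e (shipper_price a e)
        - penalty M e *
            (real (snd x e) - measure_pmf.expectation (awarded_set M a x \<omega> e) (\<lambda>W. real (card W)))
        - (\<Sum>s\<in>bidders M a x \<omega> e.
             payment a e (bidders M a x \<omega> e) (true_bids M \<omega> e (bidders M a x \<omega> e)) s))
      \<partial>shock_law x)"

definition total_profit :: "'n::finite market \<Rightarrow> 'n policy \<Rightarrow> 'n state list \<Rightarrow> real" where
  "total_profit M \<pi> h = (\<Sum>x\<leftarrow>h. period_profit M (\<pi> x) x)"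

definition has_average_profit ::
    "'n::finite market \<Rightarrow> 'n policy \<Rightarrow> 'n state \<Rightarrow> ereal \<Rightarrow> bool" where
  "has_average_profit M \<pi> x\<^sub>1 \<gamma> \<longleftrightarrow>
     (\<forall>T. integrable (history M \<pi> x\<^sub>1 T) (total_profit M \<pi>)) \<and>
     (\<lambda>T. ereal (measure_pmf.expectation (history M \<pi> x\<^sub>1 T) (total_profit M \<pi>) / real (T + 1)))
       \<longlonglongrightarrow> \<gamma>"


subsection \<open>The fluid problem\<close>

text \<open>
  The payment rate \<open>1/\<beta> * (ln (y/v) + \<alpha>) * y\<close>, extended to the boundary by its limits (in HOL,
  \<open>y/0 = 0\<close> and \<open>ln 0 = 0\<close>).
\<close>

definition fluid_payment :: "real \<Rightarrow> real \<Rightarrow> real \<Rightarrow> real \<Rightarrow> ereal" where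
  "fluid_payment \<beta> \<alpha> y v =
     (if y = 0 then 0 else if v = 0 then \<infinity> else ereal (1 / \<beta> * (ln (y / v) + \<alpha>) * y))"

definition fluid_objective ::
    "'n::finite market \<Rightarrow> ('n lane \<Rightarrow> real) \<Rightarrow> ('n lane \<Rightarrow> real) \<Rightarrow> ('n \<Rightarrow> real) \<Rightarrow> ereal" where
  "fluid_objective M d y v =
     (\<Sum>e\<in>lanes M. ereal (inv_demand M e (d e) * d e)
        - fluid_payment (price_sens M) (cost_shift M e) (y e) (v (fst e))
        - ereal (penalty M e * (d e - y e)))"

definition fluid_feasible ::
    "'n::finite market \<Rightarrow> ('n lane \<Rightarrow> real) \<Rightarrow> ('n lane \<Rightarrow> real) \<Rightarrow> ('n \<Rightarrow> real) \<Rightarrow> bool" where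
  "fluid_feasible M d y v \<longleftrightarrow>
     (\<forall>j. (\<Sum>i | (i, j) \<in> lanes M. stay_prob M (i, j) * y (i, j)) + arrival_rate M j
            = (\<Sum>k | (j, k) \<in> lanes M. y (j, k)) + v j) \<and>
     (\<forall>e\<in>lanes M. d e \<in> demand_set M e \<and> 0 \<le> y e \<and> y e \<le> d e) \<and>
     (\<forall>i. 0 \<le> v i)"

definition fluid_value :: "'n::finite market \<Rightarrow> ereal" where
  "fluid_value M = Sup {fluid_objective M d y v | d y v. fluid_feasible M d y v}"

end

theory Submission
  imports Defs "HOL-Real_Asymp.Real_Asymp"
begin

text \<open>
  The profit of \<open>n + 1\<close> periods is at most \<open>n\<close> times the fluid value plus a constant that
  does not depend on \<open>n\<close>. The main point is that mechanisms pay at least what the fluid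
  objective charges.

  One period, one carrier. Measure costs in units of \<open>1 / price_sens M\<close>; the cost of a load
  on lane \<open>(i, j)\<close> is then \<open>\<alpha> + u\<close>, where \<open>u\<close> is the shock of the outside option minus the
  shock of the lane. The largest of several shifted Gumbel variables is again Gumbel and is
  independent of which of them is largest. Hence, on the event that the carrier chooses lane
  \<open>(i, j)\<close>, which has the logit probability \<open>w\<close>, the variable \<open>u\<close> has the logistic-type
  distribution function \<open>1 / (1 / w + exp (- u))\<close> (\<open>logit_choice_law\<close>). The second stage is a
  one-dimensional screening problem with this cost law, whose virtual cost \<open>u + 1 + exp u / w\<close>
  is increasing. Incentive compatibility and individual rationality force the rent of a
  carrier to be at least the integral of its award probability over all higher costs, so the
  payment minus \<open>\<alpha> + t + 1 + exp t / w\<close> times the award, integrated over the event of the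
  choice, is at least \<open>- exp t\<close>, the value of posting the threshold \<open>t\<close> (\<open>screening_bound\<close>).
  Given the set of bidders on a lane, a carrier's own cost is independent of all that the
  others do, so the bound passes from the interim functions to expectations over all shocks
  (\<open>bidding_integral\<close>, \<open>lane_payment_bound\<close>).

  Duality. The fluid payment is built from \<open>y * ln (y / v)\<close>, which is the supremum over \<open>\<kappa>\<close>
  of the linear functions \<open>\<kappa> * y - exp (\<kappa> - 1) * v\<close>. The one-period payment bound is proved in
  this dual form for every \<open>\<kappa>\<close> (\<open>node_payment_bound\<close>): the thresholds \<open>t\<close> of the lanes at a
  node are free, and \<open>logit_thresholds\<close> chooses them so that the lane bounds add up to the
  dual bound. Since it is linear in the expected number of awards and of departures, it
  survives averaging over carriers, states and time, and the best \<open>\<kappa>\<close> is chosen only for the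
  final averages (\<open>fluid_payment_from_dual\<close>).

  Long run. A carrier stays with probability below one, so the expected number of carriers is
  bounded (\<open>carrier_count_bounded\<close>). The loads of a period are generated by the demand rates
  of the period before; pairing each period's revenue with the next period's awards makes the
  constraint \<open>y \<le> d\<close> exact for averages and leaves a boundary term and a defect of order
  \<open>1 / n\<close> in the flow balance (\<open>average_flow\<close>). Mixing in a small multiple of the fluid point
  without transports repairs the balance at a cost of order \<open>1 / n\<close>
  (\<open>fluid_point_from_averages\<close>). Jensen's inequality replaces the revenues by the revenue at
  the average demand rate. On a lane whose expected demand is infinite the penalty must be
  zero and the revenue nondecreasing in demand, and there a large finite rate does as well
  (\<open>average_revenue_attained\<close>).
\<close>

section \<open>The Gumbel law\<close>

lemma nn_integral_FTC_real_line:
  fixes F f :: "real \<Rightarrow> real"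
  assumes "\<And>x. (F has_real_derivative f x) (at x)" "\<And>x. isCont f x" "\<And>x. 0 \<le> f x"
    and "(F \<longlongrightarrow> A) at_bot" "(F \<longlongrightarrow> B) at_top"
  shows "(\<integral>\<^sup>+x. ennreal (f x) \<partial>lborel) = ennreal (B - A)"
proof -
  have A: "((F \<circ> real_of_ereal) \<longlongrightarrow> A) (at_right (-\<infinity>))"
    and B: "((F \<circ> real_of_ereal) \<longlongrightarrow> B) (at_left \<infinity>)"
    using assms(4,5) by (simp_all add: ereal_tendsto_simps)
  have i: "set_integrable lborel (einterval (-\<infinity>) \<infinity>) f"
    and v: "(LBINT x=-\<infinity>..\<infinity>. f x) = B - A"
    using interval_integral_FTC_nonneg[of "-\<infinity>" \<infinity> F f A B, OF _ assms(1,2) _ A B] assms(3)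
    by auto
  have u: "einterval (-\<infinity>) \<infinity> = (UNIV::real set)" by (auto simp: einterval_def)
  have i': "integrable lborel f" using i unfolding u set_integrable_def by simp
  have v': "integral\<^sup>L lborel f = B - A"
    using v unfolding interval_lebesgue_integral_def u set_lebesgue_integral_def by simp
  show ?thesis using nn_integral_eq_integral[OF i'] assms(3) v' by simp
qed

lemma nn_integral_FTC_lessThan:
  fixes F f :: "real \<Rightarrow> real"
  assumes "\<And>x. (F has_real_derivative f x) (at x)" "\<And>x. isCont f x" "\<And>x. x < t \<Longrightarrow> 0 \<le> f x"
    and "(F \<longlongrightarrow> A) at_bot"
  shows "(\<integral>\<^sup>+x. ennreal (f x) * indicator {..<t} x \<partial>lborel) = ennreal (F t - A)"
proof -
  have c: "isCont F t" using assms(1) DERIV_isCont by blast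
  have A: "((F \<circ> real_of_ereal) \<longlongrightarrow> A) (at_right (-\<infinity>))"
    and B: "((F \<circ> real_of_ereal) \<longlongrightarrow> F t) (at_left (ereal t))"
    using assms(4) c by (auto simp add: ereal_tendsto_simps isCont_def filterlim_at_split)
  have i: "set_integrable lborel (einterval (-\<infinity>) t) f"
    and v: "(LBINT x=-\<infinity>..t. f x) = F t - A"
    using interval_integral_FTC_nonneg[of "-\<infinity>" t F f A "F t", OF _ assms(1,2) _ A B] assms(3)
    by auto
  have u: "einterval (-\<infinity>) t = {..<t}" by (auto simp: einterval_def)
  have i': "integrable lborel (\<lambda>x. indicator {..<t} x * f x)" using i unfolding u set_integrable_def by simp
  have v': "(\<integral>x. indicator {..<t} x * f x \<partial>lborel) = F t - A"
    using v unfolding interval_lebesgue_integral_def u set_lebesgue_integral_def by simp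
  have "(\<integral>\<^sup>+x. ennreal (f x) * indicator {..<t} x \<partial>lborel)
      = (\<integral>\<^sup>+x. ennreal (indicator {..<t} x * f x) \<partial>lborel)"
    by (auto intro!: nn_integral_cong split: split_indicator)
  also have "\<dots> = ennreal (F t - A)"
    using nn_integral_eq_integral[OF i'] assms(3) v' by (auto split: split_indicator)
  finally show ?thesis .
qed

lemma emeasure_gumbel_lessThan: "emeasure gumbel {..<x} = ennreal (exp (- exp (- x)))"
proof -
  have "emeasure gumbel {..<x} = (\<integral>\<^sup>+u. ennreal (exp (- (u + exp (- u)))) * indicator {..<x} u \<partial>lborel)"
    unfolding gumbel_def by (subst emeasure_density) auto
  also have "\<dots> = ennreal (exp (- exp (- x)) - 0)"
  proof (rule nn_integral_FTC_lessThan)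
    show "((\<lambda>x::real. exp (- exp (- x))) \<longlongrightarrow> 0) at_bot" by real_asymp
    fix x :: real
    show "((\<lambda>x. exp (- exp (- x))) has_real_derivative exp (- (x + exp (- x)))) (at x)"
      by (auto intro!: derivative_eq_intros simp: exp_add[symmetric] exp_minus_inverse)
  qed auto
  finally show ?thesis by simp
qed

lemma prob_space_gumbel: "prob_space gumbel"
proof
  have "emeasure gumbel UNIV = (\<integral>\<^sup>+u. ennreal (exp (- (u + exp (- u)))) \<partial>lborel)"
    unfolding gumbel_def by (subst emeasure_density) auto
  also have "\<dots> = ennreal (1 - 0)"
  proof (rule nn_integral_FTC_real_line)
    show "((\<lambda>x::real. exp (- exp (- x))) \<longlongrightarrow> 0) at_bot" by real_asymp
    show "((\<lambda>x::real. exp (- exp (- x))) \<longlongrightarrow> 1) at_top" by real_asymp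
    fix x :: real
    show "((\<lambda>x. exp (- exp (- x))) has_real_derivative exp (- (x + exp (- x)))) (at x)"
      by (auto intro!: derivative_eq_intros simp: exp_add[symmetric] exp_minus_inverse)
  qed auto
  finally show "emeasure gumbel (space gumbel) = 1" by (simp add: gumbel_def)
qed

lemma sets_gumbel [measurable_cong, simp]: "sets gumbel = sets borel"
  by (simp add: gumbel_def)

lemma space_gumbel [simp]: "space gumbel = UNIV"
  by (simp add: gumbel_def)

text \<open>
  \<open>lane_cdf w\<close> is a logistic distribution function, shifted by \<open>ln w\<close> and scaled to total mass \<open>w\<close>.
  It is the law of the outside shock minus the shock of a lane, restricted to the event, of
  probability \<open>w\<close>, that this lane is chosen.
\<close>

definition lane_density :: "real \<Rightarrow> real \<Rightarrow> real" where
  "lane_density w u = exp (- u) / (1 / w + exp (- u))\<^sup>2"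

definition lane_cdf :: "real \<Rightarrow> real \<Rightarrow> real" where
  "lane_cdf w u = 1 / (1 / w + exp (- u))"

lemma lane_density_nonneg: "0 \<le> lane_density w u"
  by (simp add: lane_density_def)

lemma lane_cdf_nonneg: "0 < w \<Longrightarrow> 0 \<le> lane_cdf w u"
  by (auto simp add: lane_cdf_def intro!: add_nonneg_nonneg)

lemma isCont_lane_density: "0 < w \<Longrightarrow> isCont (lane_density w) u"
proof -
  assume "0 < w"
  then have "1 / w + exp (- u) > 0" by (simp add: add_pos_pos)
  then show ?thesis unfolding lane_density_def[abs_def] by (intro continuous_intros) auto
qed

lemma measurable_lane_density [measurable]: "lane_density w \<in> borel_measurable borel"
  unfolding lane_density_def[abs_def] by measurable

lemma measurable_lane_cdf [measurable]: "lane_cdf w \<in> borel_measurable borel"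
  unfolding lane_cdf_def[abs_def] by measurable

lemma DERIV_lane_cdf: "0 < w \<Longrightarrow> (lane_cdf w has_real_derivative lane_density w u) (at u)"
proof -
  assume "0 < w"
  then have "1 / w + exp (- u) > 0" by (simp add: add_pos_pos)
  then show ?thesis unfolding lane_cdf_def[abs_def] lane_density_def
    by (auto intro!: derivative_eq_intros simp: power2_eq_square)
qed

lemma lane_cdf_at_bot: "0 < w \<Longrightarrow> (lane_cdf w \<longlongrightarrow> 0) at_bot"
  unfolding lane_cdf_def[abs_def] by real_asymp

lemma lane_cdf_at_top: "0 < w \<Longrightarrow> (lane_cdf w \<longlongrightarrow> w) at_top"
  unfolding lane_cdf_def[abs_def] by real_asymp

lemma nn_integral_lane_density: "0 < w \<Longrightarrow> (\<integral>\<^sup>+u. ennreal (lane_density w u) \<partial>lborel) = ennreal w"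
  using nn_integral_FTC_real_line[of "lane_cdf w" "lane_density w" 0 w]
  by (simp add: DERIV_lane_cdf isCont_lane_density lane_density_nonneg lane_cdf_at_bot lane_cdf_at_top)

lemma nn_integral_lane_density_lessThan:
  "0 < w \<Longrightarrow> (\<integral>\<^sup>+u. ennreal (lane_density w u) * indicator {..<t} u \<partial>lborel) = ennreal (lane_cdf w t)"
  using nn_integral_FTC_lessThan[of "lane_cdf w" "lane_density w" t 0]
  by (simp add: DERIV_lane_cdf isCont_lane_density lane_density_nonneg lane_cdf_at_bot)

lemma nn_integral_gumbel_exp:
  assumes "0 < k"
  shows "(\<integral>\<^sup>+x. ennreal (exp (- 2 * x) * exp (- (k * exp (- x)))) \<partial>lborel) = ennreal (1 / k\<^sup>2)"
proof -
  have "(\<integral>\<^sup>+x. ennreal (exp (- 2 * x) * exp (- (k * exp (- x)))) \<partial>lborel) = ennreal (1 / k\<^sup>2 - 0)"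
  proof (rule nn_integral_FTC_real_line)
    let ?F = "\<lambda>x::real. (exp (- x) / k + 1 / k\<^sup>2) * exp (- (k * exp (- x)))"
    show "(?F \<longlongrightarrow> 0) at_bot" using assms by real_asymp
    show "(?F \<longlongrightarrow> 1 / k\<^sup>2) at_top" using assms by real_asymp
    fix x :: real
    have e2: "exp (- 2 * x) = exp (- x) * exp (- x)" by (simp add: exp_add[symmetric])
    show "(?F has_real_derivative exp (- 2 * x) * exp (- (k * exp (- x)))) (at x)"
      unfolding e2 using assms
      by (auto intro!: derivative_eq_intros simp: field_simps power2_eq_square)
  qed auto
  then show ?thesis by simp
qed

section \<open>Logit choice and the cost of the chosen lane\<close>

text \<open>
  If the shock of lane \<open>j\<close> is \<open>x\<close>, all other lanes are worse with probability
  \<open>exp (- exp (- x) * (1 / w - 1))\<close>: a product of Gumbel distribution functions is a power of one of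
  them. What remains is the convolution of two Gumbel densities, an elementary integral.
\<close>

lemma gumbel_choice_law:
  fixes V :: "'n::finite \<Rightarrow> real" and h :: "real \<Rightarrow> ennreal"
  assumes j: "j \<in> J" and [measurable]: "h \<in> borel_measurable borel"
  defines "w \<equiv> exp (V j) / (\<Sum>k\<in>J. exp (V k))"
  shows "(\<integral>\<^sup>+\<xi>. indicator {\<xi>. \<forall>k\<in>J - {j}. V k + \<xi> (Some k) < V j + \<xi> (Some j)} \<xi>
              * h (\<xi> None - \<xi> (Some j)) \<partial>(\<Pi>\<^sub>M k\<in>UNIV. gumbel))
         = (\<integral>\<^sup>+u. h u * ennreal (lane_density w u) \<partial>lborel)"
proof -
  interpret gumbel: prob_space gumbel by (rule prob_space_gumbel)
  interpret P: product_prob_space "\<lambda>_::'n option. gumbel" UNIV by standard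
  define I where "I = UNIV - {None, Some j}"
  have U1: "(UNIV :: 'n option set) = insert None (insert (Some j) I)" by (auto simp: I_def)
  have I: "finite I" "Some j \<notin> I" "None \<notin> insert (Some j) I" by (auto simp: I_def)
  define f where "f = (\<lambda>\<xi>. indicator {\<xi>. \<forall>k\<in>J - {j}. V k + \<xi> (Some k) < V j + \<xi> (Some j)} \<xi>
              * h (\<xi> None - \<xi> (Some j)))"
  have [measurable]: "f \<in> borel_measurable (PiM (insert None (insert (Some j) I)) (\<lambda>_. gumbel))"
    unfolding f_def U1[symmetric] by measurable
  define s where "s = (\<Sum>k\<in>J. exp (V k))"
  have s: "0 < s" using j unfolding s_def by (intro sum_pos) auto
  have w: "0 < w" using s by (simp add: w_def s_def[symmetric])
  define g where "g = (\<lambda>x::real. exp (- (x + exp (- x))))"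
  have [measurable]: "g \<in> borel_measurable borel" unfolding g_def by measurable
  have gd: "gumbel = density lborel (\<lambda>x. ennreal (g x))" by (simp add: gumbel_def g_def)
  let ?q = "\<lambda>x. ennreal (exp (- (exp (- x) * (1 / w - 1))))"
  have inner: "(\<integral>\<^sup>+\<xi>. f (\<xi>(Some j := x, None := y)) \<partial>PiM I (\<lambda>_. gumbel))
      = h (y - x) * ?q x" for x y
  proof -
    define B where "B = (\<lambda>k. case k of None \<Rightarrow> UNIV | Some k \<Rightarrow> if k \<in> J then {..< x + V j - V k} else (UNIV::real set))"
    have mB[measurable]: "B k \<in> sets borel" for k by (auto simp: B_def split: option.split)
    have "f (\<xi>(Some j := x, None := y)) = h (y - x) * (\<Prod>k\<in>I. indicator (B k) (\<xi> k))" for \<xi>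
    proof -
      have "(\<forall>k\<in>J - {j}. V k + \<xi> (Some k) < V j + x) \<longleftrightarrow> (\<forall>k\<in>I. \<xi> k \<in> B k)"
        unfolding B_def I_def by (auto simp: algebra_simps split: option.splits if_splits)
      moreover have "(\<Prod>k\<in>I. indicator (B k) (\<xi> k)) = (if \<forall>k\<in>I. \<xi> k \<in> B k then 1 else 0 :: ennreal)"
        using I(1) by (auto simp: prod_zero_iff indicator_eq_0_iff intro!: prod.neutral)
      ultimately show ?thesis unfolding f_def by (auto simp: indicator_def)
    qed
    then have "(\<integral>\<^sup>+\<xi>. f (\<xi>(Some j := x, None := y)) \<partial>PiM I (\<lambda>_. gumbel))
        = h (y - x) * (\<integral>\<^sup>+\<xi>. (\<Prod>k\<in>I. indicator (B k) (\<xi> k)) \<partial>PiM I (\<lambda>_. gumbel))"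
      by (simp add: nn_integral_cmult)
    also have "(\<integral>\<^sup>+\<xi>. (\<Prod>k\<in>I. indicator (B k) (\<xi> k)) \<partial>PiM I (\<lambda>_. gumbel)) = (\<Prod>k\<in>I. emeasure gumbel (B k))"
      using I(1) by (subst P.product_nn_integral_prod) auto
    also have "\<dots> = (\<Prod>k\<in>Some ` (J - {j}). emeasure gumbel (B k))"
      using gumbel.emeasure_space_1 by (intro prod.mono_neutral_right)
        (auto simp: I_def B_def split: option.splits if_splits)
    also have "\<dots> = (\<Prod>k\<in>J - {j}. ennreal (exp (- exp (- (x + V j - V k)))))"
      by (subst prod.reindex) (auto simp: B_def emeasure_gumbel_lessThan)
    also have "\<dots> = ennreal (exp (\<Sum>k\<in>J - {j}. - exp (- (x + V j - V k))))"
      by (simp add: prod_ennreal exp_sum)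
    also have "(\<Sum>k\<in>J - {j}. - exp (- (x + V j - V k))) = - (exp (- x) * (\<Sum>k\<in>J - {j}. exp (V k)) / exp (V j))"
      by (simp add: sum_negf sum_distrib_left sum_divide_distrib exp_diff exp_minus exp_add field_simps)
    also have "(\<Sum>k\<in>J - {j}. exp (V k)) = s - exp (V j)"
      using j by (simp add: s_def sum_diff1)
    also have "exp (- x) * (s - exp (V j)) / exp (V j) = exp (- x) * (1 / w - 1)"
      using s by (simp add: w_def s_def[symmetric] field_simps)
    finally show ?thesis .
  qed
  have "(\<integral>\<^sup>+\<xi>. f \<xi> \<partial>(\<Pi>\<^sub>M k\<in>UNIV. gumbel))
      = (\<integral>\<^sup>+y. \<integral>\<^sup>+x. \<integral>\<^sup>+\<xi>. f (\<xi>(Some j := x, None := y)) \<partial>PiM I (\<lambda>_. gumbel) \<partial>gumbel \<partial>gumbel)"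
    unfolding U1 using I by (simp add: P.product_nn_integral_insert_rev)
  also have "\<dots> = (\<integral>\<^sup>+y. \<integral>\<^sup>+x. ennreal (g y) * (ennreal (g x) * (h (y - x) * ?q x)) \<partial>lborel \<partial>lborel)"
    unfolding inner unfolding gd by (simp add: nn_integral_density nn_integral_cmult)
  also have "\<dots> = (\<integral>\<^sup>+x. \<integral>\<^sup>+y. ennreal (g y) * (ennreal (g x) * (h (y - x) * ?q x)) \<partial>lborel \<partial>lborel)"
    by (rule lborel_pair.Fubini') measurable
  also have "\<dots> = (\<integral>\<^sup>+x. \<integral>\<^sup>+u. ennreal (g (x + u)) * (ennreal (g x) * (h u * ?q x)) \<partial>lborel \<partial>lborel)"
  proof (rule nn_integral_cong)
    fix x :: real
    show "(\<integral>\<^sup>+y. ennreal (g y) * (ennreal (g x) * (h (y - x) * ?q x)) \<partial>lborel)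
      = (\<integral>\<^sup>+u. ennreal (g (x + u)) * (ennreal (g x) * (h u * ?q x)) \<partial>lborel)"
      by (subst nn_integral_real_affine[where c = 1 and t = x]) (auto simp: one_ennreal_def[symmetric])
  qed
  also have "\<dots> = (\<integral>\<^sup>+u. \<integral>\<^sup>+x. ennreal (g (x + u)) * (ennreal (g x) * (h u * ?q x)) \<partial>lborel \<partial>lborel)"
    by (rule lborel_pair.Fubini') measurable
  also have "\<dots> = (\<integral>\<^sup>+u. h u * ennreal (lane_density w u) \<partial>lborel)"
  proof (rule nn_integral_cong)
    fix u :: real
    define k where "k = 1 / w + exp (- u)"
    have k: "0 < k" using w by (simp add: k_def add_pos_pos)
    have "ennreal (g (x + u)) * (ennreal (g x) * (h u * ?q x))
        = h u * ennreal (exp (- u)) * ennreal (exp (- 2 * x) * exp (- (k * exp (- x))))" for x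
    proof -
      have "g (x + u) * g x * exp (- (exp (- x) * (1 / w - 1))) = exp (- u) * (exp (- 2 * x) * exp (- (k * exp (- x))))"
        unfolding g_def exp_add[symmetric] k_def
        by (rule arg_cong[where f = exp]) (simp add: algebra_simps exp_add exp_diff exp_minus divide_inverse)
      then have "ennreal (g (x + u)) * ennreal (g x) * ?q x
          = ennreal (exp (- u)) * ennreal (exp (- 2 * x) * exp (- (k * exp (- x))))"
        by (simp add: ennreal_mult[symmetric] g_def)
      then show ?thesis by (metis (no_types) mult.assoc mult.left_commute)
    qed
    then have "(\<integral>\<^sup>+x. ennreal (g (x + u)) * (ennreal (g x) * (h u * ?q x)) \<partial>lborel)
        = h u * ennreal (exp (- u)) * ennreal (1 / k\<^sup>2)"
      using nn_integral_gumbel_exp[OF k] by (simp add: nn_integral_cmult)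
    also have "\<dots> = h u * ennreal (lane_density w u)"
      by (simp add: lane_density_def k_def ennreal_mult[symmetric] mult.assoc)
    finally show "(\<integral>\<^sup>+x. ennreal (g (x + u)) * (ennreal (g x) * (h u * ?q x)) \<partial>lborel)
        = h u * ennreal (lane_density w u)" .
  qed
  finally show ?thesis unfolding f_def .
qed

definition logit_choice :: "'n set \<Rightarrow> ('n \<Rightarrow> real) \<Rightarrow> ('n option \<Rightarrow> real) \<Rightarrow> 'n" where
  "logit_choice J V \<xi> = (ARG_MAX (\<lambda>j. V j + \<xi> (Some j)) j. j \<in> J)"

definition logit_prob :: "'n set \<Rightarrow> ('n \<Rightarrow> real) \<Rightarrow> 'n \<Rightarrow> real" where
  "logit_prob J V j = exp (V j) / (\<Sum>k\<in>J. exp (V k))"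

text \<open>
  Without ties the choice does not depend on the selection among several maximizers.
\<close>

definition strictly_best :: "'n set \<Rightarrow> ('n \<Rightarrow> real) \<Rightarrow> 'n \<Rightarrow> ('n option \<Rightarrow> real) set" where
  "strictly_best J V j = {\<xi>. \<forall>k\<in>J - {j}. V k + \<xi> (Some k) < V j + \<xi> (Some j)}"

abbreviation shock_measure :: "('n::finite option \<Rightarrow> real) measure" where
  "shock_measure \<equiv> (\<Pi>\<^sub>M k\<in>UNIV. gumbel)"

lemma prob_space_shock_measure: "prob_space (shock_measure :: ('n::finite option \<Rightarrow> real) measure)"
  by (intro prob_space_PiM prob_space_gumbel)

lemma space_shock_measure: "space shock_measure = UNIV"
  by (auto simp: space_PiM)

lemma logit_prob_pos: "finite J \<Longrightarrow> j \<in> J \<Longrightarrow> 0 < logit_prob J V j"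
  unfolding logit_prob_def by (intro divide_pos_pos sum_pos) auto

lemma sum_logit_prob: "finite J \<Longrightarrow> J \<noteq> {} \<Longrightarrow> (\<Sum>j\<in>J. logit_prob J V j) = 1"
proof -
  assume "finite J" "J \<noteq> {}"
  then have "(\<Sum>k\<in>J. exp (V k)) > 0" by (intro sum_pos) auto
  then show ?thesis unfolding logit_prob_def sum_divide_distrib[symmetric] by simp
qed

lemma logit_choice_strictly_best: "j \<in> J \<Longrightarrow> \<xi> \<in> strictly_best J V j \<Longrightarrow> logit_choice J V \<xi> = j"
proof -
  assume j: "j \<in> J" and b: "\<xi> \<in> strictly_best J V j"
  have less: "V k + \<xi> (Some k) < V j + \<xi> (Some j)" if "k \<in> J" "k \<noteq> j" for k
    using b that by (auto simp: strictly_best_def)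
  show ?thesis
    unfolding logit_choice_def arg_max_def
  proof (rule some_equality)
    show "is_arg_max (\<lambda>j. V j + \<xi> (Some j)) (\<lambda>j. j \<in> J) j"
      using j less by (auto simp: is_arg_max_def) (metis less_asym less_irrefl)
  next
    fix k assume "is_arg_max (\<lambda>j. V j + \<xi> (Some j)) (\<lambda>j. j \<in> J) k"
    then show "k = j" using j less[of k] by (auto simp: is_arg_max_def)
  qed
qed

text \<open>
  The choice is a function of the set of maximizers, and this set takes finitely many values.
\<close>

lemma measurable_logit_choice:
  "logit_choice J V \<in> (shock_measure :: ('n::finite option \<Rightarrow> real) measure) \<rightarrow>\<^sub>M count_space UNIV"
proof -
  define S where "S = (\<lambda>\<xi>. {x. is_arg_max (\<lambda>j. V j + \<xi> (Some j)) (\<lambda>j. j \<in> J) x})"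
  have "S \<in> shock_measure \<rightarrow>\<^sub>M count_space UNIV"
  proof (rule iffD2[OF measurable_count_space_eq2]; (intro conjI ballI)?)
    fix T :: "'n set"
    have "S -` {T} \<inter> space shock_measure = {\<xi>\<in>space shock_measure. \<forall>x. x \<in> T \<longleftrightarrow>
        (x \<in> J \<and> (\<forall>y. \<not> (y \<in> J \<and> V x + \<xi> (Some x) < V y + \<xi> (Some y))))}"
      by (auto simp: S_def is_arg_max_def)
    also have "\<dots> \<in> sets shock_measure" by measurable
    finally show "S -` {T} \<inter> space shock_measure \<in> sets shock_measure" .
  qed auto
  then have "(\<lambda>\<xi>. SOME x. x \<in> S \<xi>) \<in> shock_measure \<rightarrow>\<^sub>M count_space UNIV"
    by (rule measurable_compose) simp
  then show ?thesis by (simp add: S_def logit_choice_def[abs_def] arg_max_def)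
qed

lemma measurable_strictly_best:
  "strictly_best J V j \<in> sets (shock_measure :: ('n::finite option \<Rightarrow> real) measure)"
proof -
  have "{\<xi>\<in>space shock_measure. \<forall>k\<in>J - {j}. V k + \<xi> (Some k) < V j + \<xi> (Some j)} \<in> sets shock_measure"
    by measurable
  then show ?thesis by (simp add: strictly_best_def space_shock_measure)
qed

text \<open>
  The events of being strictly best are disjoint and their probabilities, the logit weights, sum to
  one. So ties are null without any computation.
\<close>

lemma AE_logit_choice:
  fixes V :: "'n::finite \<Rightarrow> real"
  assumes "j \<in> J"
  shows "AE \<xi> in shock_measure. logit_choice J V \<xi> = j \<longleftrightarrow> \<xi> \<in> strictly_best J V j"
proof -
  interpret prob_space "shock_measure :: ('n option \<Rightarrow> real) measure" by (rule prob_space_shock_measure)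
  note [measurable] = measurable_strictly_best
  have fin: "finite J" by simp
  have p: "emeasure shock_measure (strictly_best J V k) = ennreal (logit_prob J V k)" if "k \<in> J" for k
    using gumbel_choice_law[OF that, of "\<lambda>_. 1" V] nn_integral_lane_density[OF logit_prob_pos[OF fin that]]
    by (simp add: strictly_best_def[symmetric] logit_prob_def[symmetric] measurable_strictly_best)
  have "emeasure shock_measure (\<Union>k\<in>J. strictly_best J V k) = (\<Sum>k\<in>J. emeasure shock_measure (strictly_best J V k))"
  proof (rule sum_emeasure[symmetric])
    show "disjoint_family_on (strictly_best J V) J"
      unfolding disjoint_family_on_def using logit_choice_strictly_best[of _ J _ V] by blast
  qed (use measurable_strictly_best in auto)
  also have "\<dots> = ennreal (\<Sum>k\<in>J. logit_prob J V k)"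
    using p logit_prob_pos[OF fin, of _ V] by (subst sum_ennreal[symmetric]) (auto simp: less_imp_le)
  also have "\<dots> = 1" using sum_logit_prob[OF fin, of V] assms by auto
  finally have "emeasure shock_measure (\<Union>k\<in>J. strictly_best J V k) = 1" .
  then have "AE \<xi> in shock_measure. \<xi> \<in> (\<Union>k\<in>J. strictly_best J V k)"
    by (subst prob_eq_1[symmetric]) (auto simp: emeasure_eq_measure)
  then show ?thesis
    by eventually_elim (use assms logit_choice_strictly_best[of _ J _ V] in blast)
qed

lemma logit_choice_law:
  fixes V :: "'n::finite \<Rightarrow> real"
  assumes j: "j \<in> J"
  shows "distr (density shock_measure (indicator {\<xi>. logit_choice J V \<xi> = j})) borel
           (\<lambda>\<xi>. \<xi> None - \<xi> (Some j)) = density lborel (lane_density (logit_prob J V j))"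
proof (rule measure_eqI)
  note [measurable] = measurable_strictly_best measurable_logit_choice
  have [measurable]: "{\<xi>. logit_choice J V \<xi> = j} \<in> sets shock_measure"
  proof -
    have "{\<xi>\<in>space shock_measure. logit_choice J V \<xi> = j} \<in> sets shock_measure" by measurable
    then show ?thesis by (simp add: space_shock_measure)
  qed
  fix B assume "B \<in> sets (distr (density shock_measure (indicator {\<xi>. logit_choice J V \<xi> = j})) borel
           (\<lambda>\<xi>. \<xi> None - \<xi> (Some j)))"
  then have [measurable]: "B \<in> sets borel" by simp
  have "emeasure (distr (density shock_measure (indicator {\<xi>. logit_choice J V \<xi> = j})) borel
           (\<lambda>\<xi>. \<xi> None - \<xi> (Some j))) B
      = (\<integral>\<^sup>+\<xi>. indicator B (\<xi> None - \<xi> (Some j)) \<partial>density shock_measure (indicator {\<xi>. logit_choice J V \<xi> = j}))"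
    by (subst nn_integral_indicator[symmetric], simp, subst nn_integral_distr) auto
  also have "\<dots> = (\<integral>\<^sup>+\<xi>. indicator {\<xi>. logit_choice J V \<xi> = j} \<xi> * indicator B (\<xi> None - \<xi> (Some j)) \<partial>shock_measure)"
    by (subst nn_integral_density) auto
  also have "\<dots> = (\<integral>\<^sup>+\<xi>. indicator (strictly_best J V j) \<xi> * indicator B (\<xi> None - \<xi> (Some j)) \<partial>shock_measure)"
    by (intro nn_integral_cong_AE) (use AE_logit_choice[OF j, of V] in eventually_elim, auto simp: indicator_def)
  also have "\<dots> = (\<integral>\<^sup>+u. indicator B u * ennreal (lane_density (logit_prob J V j) u) \<partial>lborel)"
    unfolding strictly_best_def logit_prob_def by (rule gumbel_choice_law[OF j]) simp
  also have "\<dots> = emeasure (density lborel (lane_density (logit_prob J V j))) B"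
    by (subst emeasure_density) (auto simp: mult.commute)
  finally show "emeasure (distr (density shock_measure (indicator {\<xi>. logit_choice J V \<xi> = j})) borel
           (\<lambda>\<xi>. \<xi> None - \<xi> (Some j))) B = emeasure (density lborel (lane_density (logit_prob J V j))) B" .
qed simp

lemma sets_logit_choice: "{\<xi>. logit_choice J V \<xi> = j} \<in> sets (shock_measure :: ('n::finite option \<Rightarrow> real) measure)"
proof -
  note [measurable] = measurable_logit_choice
  have "{\<xi>\<in>space shock_measure. logit_choice J V \<xi> = j} \<in> sets shock_measure" by measurable
  then show ?thesis by (simp add: space_shock_measure)
qed

lemma integral_logit_choice:
  fixes V :: "'n::finite \<Rightarrow> real" and g :: "real \<Rightarrow> real"
  assumes j: "j \<in> J" and [measurable]: "g \<in> borel_measurable borel"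
  defines "D \<equiv> {\<xi>. logit_choice J V \<xi> = j}"
  shows "integrable shock_measure (\<lambda>\<xi>. indicator D \<xi> * g (\<xi> None - \<xi> (Some j)))
           \<longleftrightarrow> integrable lborel (\<lambda>u. g u * lane_density (logit_prob J V j) u)"
    and "(\<integral>\<xi>. indicator D \<xi> * g (\<xi> None - \<xi> (Some j)) \<partial>shock_measure)
           = (\<integral>u. g u * lane_density (logit_prob J V j) u \<partial>lborel)"
proof -
  note [measurable] = sets_logit_choice
  have D: "D \<in> sets shock_measure" unfolding D_def by measurable
  note [measurable] = D
  have L: "density lborel (lane_density (logit_prob J V j)) =
      distr (density shock_measure (\<lambda>\<xi>. ennreal (indicator D \<xi>))) borel (\<lambda>\<xi>. \<xi> None - \<xi> (Some j))"
    using logit_choice_law[OF j, of V] by (simp add: D_def ennreal_indicator)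
  show "integrable shock_measure (\<lambda>\<xi>. indicator D \<xi> * g (\<xi> None - \<xi> (Some j)))
           \<longleftrightarrow> integrable lborel (\<lambda>u. g u * lane_density (logit_prob J V j) u)"
    using integrable_density[of g lborel "lane_density (logit_prob J V j)"]
    unfolding L by (simp add: integrable_distr_eq integrable_density lane_density_nonneg mult.commute)
  show "(\<integral>\<xi>. indicator D \<xi> * g (\<xi> None - \<xi> (Some j)) \<partial>shock_measure)
           = (\<integral>u. g u * lane_density (logit_prob J V j) u \<partial>lborel)"
    using integral_density[of g lborel "lane_density (logit_prob J V j)"]
    unfolding L by (simp add: integral_distr integral_density lane_density_nonneg mult.commute)
qed

section \<open>Screening a carrier with a logistic cost\<close>

lemma integrable_lane_density: "0 < w \<Longrightarrow> integrable lborel (lane_density w)"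
  by (intro integrableI_nonneg) (auto simp: lane_density_nonneg nn_integral_lane_density)

text \<open>
  The cost of a carrier has a finite mean. An antiderivative of \<open>u * lane_density w u\<close> comes from
  integration by parts.
\<close>

lemma integrable_abs_lane_density:
  assumes w: "0 < w"
  shows "integrable lborel (\<lambda>u. \<bar>u\<bar> * lane_density w u)"
proof -
  let ?f = "lane_density w" and ?G = "\<lambda>u. u * lane_cdf w u - w * ln (w + exp u)"
  have G: "(?G has_real_derivative u * ?f u) (at u)" for u
  proof -
    have pos: "0 < w + exp u" using w by (simp add: add_pos_pos)
    have cdf: "lane_cdf w u = w * (exp u / (w + exp u))"
      using w pos by (simp add: lane_cdf_def exp_minus field_simps)
    show ?thesis
      using w pos DERIV_lane_cdf[OF w, of u]
      by (auto intro!: derivative_eq_intros simp: cdf[symmetric]) (simp add: cdf)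
  qed
  have cont: "isCont (\<lambda>u. u * ?f u) u" for u
    using isCont_lane_density[OF w] by (intro continuous_intros)
  have bot: "(?G \<longlongrightarrow> - w * ln w) at_bot" using w unfolding lane_cdf_def by real_asymp
  have top: "(?G \<longlongrightarrow> 0) at_top" using w unfolding lane_cdf_def by real_asymp
  have neg: "(\<integral>\<^sup>+u. ennreal (- (u * ?f u)) * indicator {..<0} u \<partial>lborel) = ennreal (- ?G 0 - - (- w * ln w))"
  proof (rule nn_integral_FTC_lessThan)
    show "((\<lambda>u. - ?G u) has_real_derivative - (u * ?f u)) (at u)" for u by (rule DERIV_minus[OF G])
    show "((\<lambda>u. - ?G u) \<longlongrightarrow> - (- w * ln w)) at_bot" by (rule tendsto_minus[OF bot])
  qed (use cont in \<open>auto intro!: continuous_intros mult_nonpos_nonneg lane_density_nonneg\<close>)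
  have pos: "(\<integral>\<^sup>+u. ennreal (u * ?f u) * indicator {0..} u \<partial>lborel) = ennreal (0 - ?G 0)"
    by (rule nn_integral_FTC_atLeast) (use G top in \<open>auto simp: lane_density_nonneg\<close>)
  have "(\<integral>\<^sup>+u. ennreal (\<bar>u\<bar> * ?f u) \<partial>lborel)
      = (\<integral>\<^sup>+u. ennreal (- (u * ?f u)) * indicator {..<0} u + ennreal (u * ?f u) * indicator {0..} u \<partial>lborel)"
    by (intro nn_integral_cong) (auto split: split_indicator)
  also have "\<dots> < \<infinity>" by (simp add: nn_integral_add neg pos)
  finally show ?thesis by (intro integrableI_nonneg) (auto simp: lane_density_nonneg)
qed

text \<open>
  Add the two incentive constraints between \<open>x\<close> and \<open>y\<close>.
\<close>

lemma award_antimono: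
  fixes A U :: "real \<Rightarrow> real"
  assumes "\<And>x y. U x \<ge> U y + A y * (y - x)" "x \<le> y"
  shows "A y \<le> A x"
proof (cases "x = y")
  case False
  have "A y * (y - x) \<le> A x * (y - x)" using assms(1)[of x y] assms(1)[of y x] by (simp add: algebra_simps)
  then show ?thesis using False assms(2) by simp
qed simp

text \<open>
  In exact form the rent at \<open>x\<close> is at least the integral of the award probability over all higher
  costs. Along a grid of mesh \<open>h\<close> the incentive constraints bound the decrease of the rent
  from below by the lower Riemann sum of the decreasing function \<open>A\<close>, which misses the integral by
  at most \<open>h\<close>; so the rent need not be differentiated.
\<close>

lemma nn_integral_award_le_rent:
  fixes A U :: "real \<Rightarrow> real"
  assumes ic: "\<And>x y. U x \<ge> U y + A y * (y - x)" and ir: "\<And>x. 0 \<le> U x"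
    and A: "\<And>x. 0 \<le> A x" "\<And>x. A x \<le> 1" and h: "0 < h"
    and [measurable]: "A \<in> borel_measurable borel"
  shows "(\<integral>\<^sup>+z. ennreal (A z) * indicator {x..} z \<partial>lborel) \<le> ennreal (U x + h)"
proof -
  have n: "(\<integral>\<^sup>+z. ennreal (A z) * indicator {x..<x + real n * h} z \<partial>lborel)
      \<le> ennreal (U x - U (x + real n * h) + h * (A x - A (x + real n * h)))" for n
  proof (induction n)
    case (Suc n)
    define y where "y = x + real n * h"
    have y': "x + real (Suc n) * h = y + h" by (simp add: y_def algebra_simps)
    have xy: "x \<le> y" using h by (simp add: y_def)
    have "(\<integral>\<^sup>+z. ennreal (A z) * indicator {x..<y + h} z \<partial>lborel)
        = (\<integral>\<^sup>+z. ennreal (A z) * indicator {x..<y} z + ennreal (A z) * indicator {y..<y + h} z \<partial>lborel)"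
      using xy h by (intro nn_integral_cong) (auto split: split_indicator)
    also have "\<dots> = (\<integral>\<^sup>+z. ennreal (A z) * indicator {x..<y} z \<partial>lborel)
        + (\<integral>\<^sup>+z. ennreal (A z) * indicator {y..<y + h} z \<partial>lborel)"
      by (intro nn_integral_add) auto
    also have "(\<integral>\<^sup>+z. ennreal (A z) * indicator {y..<y + h} z \<partial>lborel)
        \<le> (\<integral>\<^sup>+z. ennreal (A y) * indicator {y..<y + h} z \<partial>lborel)"
      using award_antimono[OF ic] by (intro nn_integral_mono) (auto split: split_indicator intro!: ennreal_leI)
    also have "\<dots> = ennreal (h * A y)"
      using h A by (subst nn_integral_cmult_indicator) (auto simp: ennreal_mult[symmetric] mult.commute)
    also have "(\<integral>\<^sup>+z. ennreal (A z) * indicator {x..<y} z \<partial>lborel) + ennreal (h * A y)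
        \<le> ennreal (U x - U y + h * (A x - A y)) + ennreal (h * A y)"
      using Suc.IH unfolding y_def by (intro add_right_mono)
    also have "\<dots> = ennreal (U x - U y + h * (A x - A y) + h * A y)"
    proof (rule ennreal_plus[symmetric])
      have "U y \<le> U x" using ic[of y x] A(1)[of y] xy mult_nonneg_nonneg[of "A y" "y - x"] by linarith
      then show "0 \<le> U x - U y + h * (A x - A y)" using award_antimono[OF ic xy] h by simp
    qed (use h A in auto)
    also have "\<dots> \<le> ennreal (U x - U (y + h) + h * (A x - A (y + h)))"
      using ic[of "y + h" y] by (intro ennreal_leI) (simp add: algebra_simps)
    finally show ?case unfolding y' y_def[symmetric] by (simp add: add_right_mono)
  qed auto
  have "(\<integral>\<^sup>+z. ennreal (A z) * indicator {x..} z \<partial>lborel)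
      = (\<integral>\<^sup>+z. (SUP n. ennreal (A z) * indicator {x..<x + real n * h} z) \<partial>lborel)"
  proof (intro nn_integral_cong antisym)
    fix z
    show "ennreal (A z) * indicator {x..} z \<le> (SUP n. ennreal (A z) * indicator {x..<x + real n * h} z)"
    proof (cases "x \<le> z")
      case True
      obtain n where "z - x < real n * h" using reals_Archimedean3[OF h] by blast
      then have "z < x + real n * h" by simp
      then show ?thesis using True by (intro SUP_upper2[of n]) auto
    qed auto
    show "(SUP n. ennreal (A z) * indicator {x..<x + real n * h} z) \<le> ennreal (A z) * indicator {x..} z"
      by (intro SUP_least) (auto split: split_indicator)
  qed
  also have "\<dots> = (SUP n. \<integral>\<^sup>+z. ennreal (A z) * indicator {x..<x + real n * h} z \<partial>lborel)"
  proof (intro nn_integral_monotone_convergence_SUP)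
    show "incseq (\<lambda>n z. ennreal (A z) * indicator {x..<x + real n * h} z)"
    proof (intro incseq_SucI le_funI mult_left_mono)
      fix n z
      have "real n * h \<le> real (Suc n) * h" using h by (intro mult_right_mono) auto
      then show "indicator {x..<x + real n * h} z \<le> (indicator {x..<x + real (Suc n) * h} z :: ennreal)"
        by (auto split: split_indicator)
    qed auto
  qed measurable
  also have "\<dots> \<le> ennreal (U x + h)"
  proof (intro SUP_least)
    fix n
    have "h * (A x - A (x + real n * h)) \<le> h * 1" using A[of x] A(1)[of "x + real n * h"] h
      by (intro mult_left_mono) auto
    then have "U x - U (x + real n * h) + h * (A x - A (x + real n * h)) \<le> U x + h" using ir[of "x + real n * h"] by linarith
    then show "(\<integral>\<^sup>+z. ennreal (A z) * indicator {x..<x + real n * h} z \<partial>lborel) \<le> ennreal (U x + h)"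
      using n[of n] ennreal_leI order_trans by blast
  qed
  finally show ?thesis .
qed

text \<open>
  Tonelli: an award at cost \<open>z\<close> contributes to the rent of all types below \<open>z\<close>, which have mass
  \<open>lane_cdf w z\<close>.
\<close>

lemma expected_award_le_expected_rent:
  fixes A U :: "real \<Rightarrow> real"
  assumes ic: "\<And>x y. U x \<ge> U y + A y * (y - x)" and ir: "\<And>x. 0 \<le> U x"
    and A: "\<And>x. 0 \<le> A x" "\<And>x. A x \<le> 1"
    and [measurable]: "A \<in> borel_measurable borel" "U \<in> borel_measurable borel" and w: "0 < w"
  shows "(\<integral>\<^sup>+z. ennreal (A z * lane_cdf w z) \<partial>lborel) \<le> (\<integral>\<^sup>+x. ennreal (U x * lane_density w x) \<partial>lborel)"
proof -
  let ?f = "\<lambda>x. ennreal (lane_density w x)"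
  have "(\<integral>\<^sup>+z. ennreal (A z * lane_cdf w z) \<partial>lborel) \<le> (\<integral>\<^sup>+x. ennreal (U x * lane_density w x) \<partial>lborel) + ennreal (h * w)"
    if h: "0 < h" for h
  proof -
    have "(\<integral>\<^sup>+z. ennreal (A z * lane_cdf w z) \<partial>lborel)
        = (\<integral>\<^sup>+z. ennreal (A z) * (\<integral>\<^sup>+x. ?f x * indicator {..<z} x \<partial>lborel) \<partial>lborel)"
      by (simp add: nn_integral_lane_density_lessThan[OF w] ennreal_mult A lane_cdf_nonneg[OF w])
    also have "\<dots> = (\<integral>\<^sup>+z. \<integral>\<^sup>+x. ennreal (A z) * (?f x * indicator {x<..} z) \<partial>lborel \<partial>lborel)"
      by (subst nn_integral_cmult[symmetric]) (auto intro!: nn_integral_cong split: split_indicator)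
    also have "\<dots> = (\<integral>\<^sup>+x. \<integral>\<^sup>+z. ennreal (A z) * (?f x * indicator {x<..} z) \<partial>lborel \<partial>lborel)"
      by (rule lborel_pair.Fubini') (simp add: greaterThan_def)
    also have "\<dots> \<le> (\<integral>\<^sup>+x. \<integral>\<^sup>+z. ?f x * (ennreal (A z) * indicator {x..} z) \<partial>lborel \<partial>lborel)"
      by (intro nn_integral_mono) (auto split: split_indicator simp: mult.commute)
    also have "\<dots> \<le> (\<integral>\<^sup>+x. ?f x * ennreal (U x + h) \<partial>lborel)"
      using nn_integral_award_le_rent[OF ic ir A h]
      by (subst nn_integral_cmult) (auto intro!: nn_integral_mono mult_left_mono)
    also have "\<dots> = (\<integral>\<^sup>+x. ennreal (U x * lane_density w x) + ennreal h * ?f x \<partial>lborel)"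
      using ir h by (intro nn_integral_cong)
        (simp add: ennreal_mult[symmetric] ennreal_plus[symmetric] lane_density_nonneg algebra_simps del: ennreal_plus)
    also have "\<dots> = (\<integral>\<^sup>+x. ennreal (U x * lane_density w x) \<partial>lborel) + ennreal (h * w)"
      using h w by (subst nn_integral_add) (auto simp: nn_integral_cmult nn_integral_lane_density ennreal_mult)
    finally show ?thesis .
  qed
  note b = this
  show ?thesis
  proof (rule ennreal_le_epsilon)
    fix e :: real assume "0 < e"
    then show "(\<integral>\<^sup>+z. ennreal (A z * lane_cdf w z) \<partial>lborel) \<le> (\<integral>\<^sup>+x. ennreal (U x * lane_density w x) \<partial>lborel) + ennreal e"
      using b[of "e / w"] w by simp
  qed
qed

lemma DERIV_virtual_surplus:
  assumes w: "0 < w"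
  shows "((\<lambda>u. (K - u) * lane_cdf w u) has_real_derivative
    ((K - u) * lane_density w u - lane_cdf w u)) (at u)"
  using DERIV_lane_cdf[OF w] by (auto intro!: derivative_eq_intros)

lemma lane_cdf_eq: "0 < w \<Longrightarrow> lane_cdf w u = (1 + exp u / w) * lane_density w u"
proof -
  assume w: "0 < w"
  have nz: "1 / w + exp (- u) \<noteq> 0" using w add_pos_pos[of "1/w" "exp (-u)"] by auto
  have "(1 + exp u / w) * exp (- u) = 1 / w + exp (- u)"
    by (simp add: algebra_simps exp_minus)
  then have "(1 + exp u / w) * lane_density w u = (1 / w + exp (- u)) / (1 / w + exp (- u))\<^sup>2"
    unfolding lane_density_def by (metis times_divide_eq_right)
  then show ?thesis using nz by (simp add: lane_cdf_def power2_eq_square)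
qed

text \<open>
  Here \<open>U\<close> is the rent and \<open>A\<close> the award probability, so \<open>U u + A u * u\<close> is the payment net of the
  shift of the cost. Replacing the rent by its lower bound leaves the virtual surplus
  \<open>A u * (K - u - 1 - exp u / w)\<close>, which is largest if loads are awarded exactly below \<open>t\<close>; the
  constant \<open>K\<close> is the virtual cost at \<open>t\<close>.
\<close>

lemma screening_bound:
  fixes A U :: "real \<Rightarrow> real" and t w :: real
  defines "K \<equiv> t + 1 + exp t / w"
  assumes ic: "\<And>x y. U x \<ge> U y + A y * (y - x)" and ir: "\<And>x. 0 \<le> U x"
    and A: "\<And>x. 0 \<le> A x" "\<And>x. A x \<le> 1"
    and [measurable]: "A \<in> borel_measurable borel" "U \<in> borel_measurable borel" and w: "0 < w"
    and int: "integrable lborel (\<lambda>u. (U u + A u * u) * lane_density w u)"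
  shows "(\<integral>u. (U u + A u * (u - K)) * lane_density w u \<partial>lborel) \<ge> - exp t"
proof -
  let ?f = "lane_density w" and ?F = "lane_cdf w"
  note [simp] = lane_density_nonneg
  have Af: "integrable lborel (\<lambda>u. A u * ?f u)"
    by (rule Bochner_Integration.integrable_bound[OF integrable_lane_density[OF w]])
       (use A in \<open>auto simp: abs_mult intro!: mult_left_le_one_le\<close>)
  have Auf: "integrable lborel (\<lambda>u. A u * u * ?f u)"
    by (rule Bochner_Integration.integrable_bound[OF integrable_abs_lane_density[OF w]])
       (use A in \<open>auto simp: abs_mult mult.assoc intro!: mult_left_le_one_le\<close>)
  have Uf: "integrable lborel (\<lambda>u. U u * ?f u)"
    using Bochner_Integration.integrable_diff[OF int Auf] by (simp add: algebra_simps)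
  have Ap: "integrable lborel (\<lambda>u. A u * (u - K) * ?f u)"
    using Bochner_Integration.integrable_diff[OF Auf integrable_mult_right[OF Af, of K]] by (simp add: algebra_simps)
  have le: "(\<integral>\<^sup>+z. ennreal (A z * ?F z) \<partial>lborel) \<le> ennreal (\<integral>x. U x * ?f x \<partial>lborel)"
    using expected_award_le_expected_rent[OF ic ir A _ _ w] nn_integral_eq_integral[OF Uf] ir by simp
  then have AF: "integrable lborel (\<lambda>u. A u * ?F u)"
    by (intro integrableI_nonneg) (auto simp: A lane_cdf_nonneg[OF w] le_less_trans)
  have 1: "(\<integral>u. A u * ?F u \<partial>lborel) \<le> (\<integral>u. U u * ?f u \<partial>lborel)"
    using le nn_integral_eq_integral[OF AF] A lane_cdf_nonneg[OF w] ir
    by (simp add: ennreal_le_iff integral_nonneg_AE)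
  \<comment> \<open>The density times the virtual surplus; it changes sign from plus to minus at \<open>t\<close>.\<close>
  let ?psi = "\<lambda>u. (K - u) * ?f u - ?F u"
  have psi: "?psi u = ((t + exp t / w) - (u + exp u / w)) * ?f u" for u
    unfolding lane_cdf_eq[OF w] K_def by (simp add: algebra_simps)
  have mono: "x + exp x / w \<le> y + exp y / w" if "x \<le> y" for x y
    using that w by (intro add_mono divide_right_mono) auto
  have psi_pos: "u < t \<Longrightarrow> 0 \<le> ?psi u" and psi_neg: "t \<le> u \<Longrightarrow> ?psi u \<le> 0" for u
    using mono[of u t] mono[of t u] unfolding psi by (auto intro!: mult_nonneg_nonneg mult_nonpos_nonneg)
  have Kt: "(K - t) * ?F t = exp t"
  proof -
    have nz: "1 / w + exp (- t) \<noteq> 0" using w add_pos_pos[of "1/w" "exp (-t)"] by auto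
    have "(1 + exp t / w) = exp t * (1 / w + exp (- t))" by (simp add: algebra_simps exp_minus)
    then show ?thesis using nz by (simp add: K_def lane_cdf_def)
  qed
  have nn: "(\<integral>\<^sup>+u. ennreal (?psi u) * indicator {..<t} u \<partial>lborel) = ennreal (exp t)"
  proof -
    have "((\<lambda>u. (K - u) * ?F u) \<longlongrightarrow> 0) at_bot"
      using w unfolding lane_cdf_def by real_asymp
    moreover have "isCont ?psi u" for u
      using isCont_lane_density[OF w] DERIV_isCont[OF DERIV_lane_cdf[OF w]] by (intro continuous_intros)
    ultimately show ?thesis
      using nn_integral_FTC_lessThan[of "\<lambda>u. (K - u) * ?F u" ?psi t 0] DERIV_virtual_surplus[OF w] psi_pos Kt by simp
  qed
  have nn': "(\<integral>\<^sup>+u. ennreal (indicator {..<t} u * ?psi u) \<partial>lborel) = ennreal (exp t)"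
    unfolding nn[symmetric] by (intro nn_integral_cong) (auto split: split_indicator)
  have ip: "integrable lborel (\<lambda>u. indicator {..<t} u * ?psi u)"
    using nn' psi_pos by (intro integrableI_nonneg) (auto split: split_indicator intro!: AE_I2)
  have vp: "(\<integral>u. indicator {..<t} u * ?psi u \<partial>lborel) = exp t"
    using nn' psi_pos by (intro integral_eq_nn_integral[THEN trans]) (auto split: split_indicator intro!: AE_I2)
  have "(\<integral>u. indicator {..<t} u * ?psi u \<partial>lborel) \<ge> (\<integral>u. - (A u * ?F u + A u * (u - K) * ?f u) \<partial>lborel)"
  proof (intro integral_mono ip Bochner_Integration.integrable_minus Bochner_Integration.integrable_add AF Ap)
    fix u
    have "- (A u * ?F u + A u * (u - K) * ?f u) = A u * ?psi u" by (simp add: algebra_simps)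
    also have "\<dots> \<le> indicator {..<t} u * ?psi u"
      using A[of u] psi_pos[of u] psi_neg[of u]
      by (auto split: split_indicator intro!: mult_left_le_one_le mult_nonneg_nonpos simp: not_less)
    finally show "- (A u * ?F u + A u * (u - K) * ?f u) \<le> indicator {..<t} u * ?psi u" .
  qed
  then have 2: "(\<integral>u. A u * ?F u \<partial>lborel) + (\<integral>u. A u * (u - K) * ?f u \<partial>lborel) \<ge> - exp t"
    unfolding vp using AF Ap by simp
  have "(\<integral>u. (U u + A u * (u - K)) * ?f u \<partial>lborel)
      = (\<integral>u. U u * ?f u \<partial>lborel) + (\<integral>u. A u * (u - K) * ?f u \<partial>lborel)"
    using Uf Ap by (subst Bochner_Integration.integral_add[symmetric]) (auto simp: algebra_simps)
  then show "(\<integral>u. (U u + A u * (u - K)) * ?f u \<partial>lborel) \<ge> - exp t"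
    using 1 2 by linarith
qed

section \<open>Payments in one period\<close>

text \<open>
  The thresholds exist by the intermediate value theorem. For the sum, put \<open>g j = exp (t j)\<close> and
  \<open>G = (\<Sum>j\<in>J. g j)\<close>. The defining equation reads
  \<open>g j / w j - \<zeta> = ln (exp (\<kappa> j - 1) / g j)\<close>. Multiply by \<open>g j\<close> and sum: by Cauchy-Schwarz the left side
  is at least \<open>G * (G - \<zeta>)\<close>, and by \<open>ln r \<le> r - 1\<close> the right side is at most \<open>\<zeta> - G\<close>.
\<close>

lemma logit_thresholds:
  fixes w \<kappa> :: "'a \<Rightarrow> real"
  assumes J: "finite J" "J \<noteq> {}" and w: "\<And>j. j \<in> J \<Longrightarrow> 0 < w j" "(\<Sum>j\<in>J. w j) = 1"
  defines "\<zeta> \<equiv> (\<Sum>j\<in>J. exp (\<kappa> j - 1))"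
  obtains t where "\<And>j. j \<in> J \<Longrightarrow> t j + 1 + exp (t j) / w j = \<kappa> j + \<zeta>" "(\<Sum>j\<in>J. exp (t j)) \<le> \<zeta>"
proof -
  have "\<exists>t. t + 1 + exp t / w j = \<kappa> j + \<zeta>" if j: "j \<in> J" for j
  proof -
    let ?h = "\<lambda>t. t + 1 + exp t / w j"
    define y where "y = \<kappa> j + \<zeta>"
    define a where "a = min 0 (y - 1 - 1 / w j)"
    define b where "b = max 0 y"
    have "exp a / w j \<le> 1 / w j" using w(1)[OF j] by (intro divide_right_mono) (auto simp: a_def)
    then have "?h a \<le> y" by (simp add: a_def)
    moreover have "0 < exp b / w j" using w(1)[OF j] by simp
    then have "y \<le> ?h b" by (simp add: b_def)
    moreover have "a \<le> b" by (simp add: a_def b_def)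
    moreover have "continuous_on {a..b} ?h" using w(1)[OF j] by (intro continuous_intros) auto
    ultimately obtain t where "?h t = y" using IVT'[of ?h a y b] by blast
    then show ?thesis unfolding y_def by blast
  qed
  then obtain t where t: "\<And>j. j \<in> J \<Longrightarrow> t j + 1 + exp (t j) / w j = \<kappa> j + \<zeta>" by metis
  define g where "g = (\<lambda>j. exp (t j))"
  define G where "G = (\<Sum>j\<in>J. g j)"
  have G0: "0 < G" unfolding G_def g_def using J by (intro sum_pos) auto
  have "G \<le> \<zeta>"
  proof (rule ccontr)
    assume "\<not> G \<le> \<zeta>"
    then have gt: "\<zeta> < G" by simp
    \<comment> \<open>From \<open>1 + ln r \<le> r\<close> for \<open>r = exp (\<kappa> j - 1) / g j\<close>.\<close>
    have each: "g j * (g j / w j - \<zeta>) \<le> exp (\<kappa> j - 1) - g j" if j: "j \<in> J" for j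
    proof -
      define r where "r = exp (\<kappa> j - 1 - t j)"
      have "1 + (\<kappa> j - 1 - t j) \<le> r" unfolding r_def by (rule exp_ge_add_one_self)
      then have "g j / w j - \<zeta> \<le> r - 1" using t[OF j] by (simp add: g_def)
      then have "g j * (g j / w j - \<zeta>) \<le> g j * (r - 1)" by (intro mult_left_mono) (auto simp: g_def)
      also have "g j * r = exp (\<kappa> j - 1)" by (simp add: g_def r_def exp_add[symmetric])
      then have "g j * (r - 1) = exp (\<kappa> j - 1) - g j" by (simp add: algebra_simps)
      finally show ?thesis .
    qed
    \<comment> \<open>From \<open>(g j - G * w j)\<^sup>2 \<ge> 0\<close>; summed over \<open>j\<close> this is the Cauchy-Schwarz inequality with weights \<open>w\<close>.\<close>
    have sq: "2 * G * g j - G\<^sup>2 * w j \<le> g j * (g j / w j)" if j: "j \<in> J" for j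
    proof -
      have "0 \<le> (g j - G * w j)\<^sup>2 / w j" using w(1)[OF j] by simp
      also have "\<dots> = g j * (g j / w j) - 2 * G * g j + G\<^sup>2 * w j"
        using w(1)[OF j] by (simp add: power2_eq_square field_simps)
      finally show ?thesis by simp
    qed
    have "(\<Sum>j\<in>J. (2 * G * g j - G\<^sup>2 * w j) - \<zeta> * g j) \<le> (\<Sum>j\<in>J. exp (\<kappa> j - 1) - g j)"
    proof (rule sum_mono)
      fix j assume j: "j \<in> J"
      show "(2 * G * g j - G\<^sup>2 * w j) - \<zeta> * g j \<le> exp (\<kappa> j - 1) - g j"
        using each[OF j] sq[OF j] by (simp add: algebra_simps)
    qed
    then have "2 * G * G - G\<^sup>2 * 1 - \<zeta> * G \<le> \<zeta> - G"
      unfolding sum_subtractf sum_distrib_left[symmetric] w(2) G_def[symmetric] \<zeta>_def[symmetric] .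
    then have "G * (G - \<zeta>) \<le> \<zeta> - G" by (simp add: power2_eq_square algebra_simps)
    moreover have "0 < G * (G - \<zeta>)" using G0 gt by simp
    ultimately show False using gt by simp
  qed
  then show thesis using that[OF t] by (simp add: G_def g_def)
qed

lemma (in prob_space) uniform_measure_integral:
  fixes f :: "'a \<Rightarrow> real"
  assumes [measurable]: "A \<in> events" "f \<in> borel_measurable M" and A: "0 < prob A"
  shows "integrable (uniform_measure M A) f \<longleftrightarrow> integrable M (\<lambda>x. indicator A x * f x)"
    and "(\<integral>x. f x \<partial>uniform_measure M A) = (\<integral>x. indicator A x * f x \<partial>M) / prob A"
proof -
  have u: "uniform_measure M A = density M (\<lambda>x. ennreal (indicator A x / prob A))"
    unfolding uniform_measure_def
  proof (intro density_cong AE_I2)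
    fix x show "indicator A x / emeasure M A = ennreal (indicator A x / prob A)"
      using A by (auto simp: emeasure_eq_measure divide_ennreal indicator_def simp flip: ennreal_1)
  qed auto
  have eq: "indicator A x / prob A * f x = 1 / prob A * (indicator A x * f x)" for x by simp
  show "integrable (uniform_measure M A) f \<longleftrightarrow> integrable M (\<lambda>x. indicator A x * f x)"
    unfolding u using A integrable_mult_left_iff[of M "1 / prob A" "\<lambda>x. indicator A x * f x"]
    by (simp add: integrable_density eq del: integrable_mult_left_iff)
  show "(\<integral>x. f x \<partial>uniform_measure M A) = (\<integral>x. indicator A x * f x \<partial>M) / prob A"
    unfolding u using A by (simp add: integral_density eq)
qed

lemma shock_law_eq:
  "shock_law x = PiM (SIGMA i:UNIV. {..<fst x i}) (\<lambda>_. shock_measure)"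
proof -
  have "{(i, s). s < fst x i} = (SIGMA i:UNIV. {..<fst x i})" by auto
  then show ?thesis by (simp add: shock_law_def split_beta')
qed

definition destinations :: "'n market \<Rightarrow> 'n \<Rightarrow> 'n set" where
  "destinations M i = {j. (i, j) \<in> lanes M}"

locale market_period =
  fixes M :: "'n::finite market" and a :: "'n action" and x :: "'n state"
  assumes market: "valid_market M" and action: "valid_action M x a"
begin

definition carriers :: "('n \<times> nat) set" where
  "carriers = (SIGMA i:UNIV. {..<fst x i})"

definition posted_utility :: "'n \<Rightarrow> 'n \<Rightarrow> real" where
  "posted_utility i j = price_sens M * posted_price a (i, j) - cost_shift M (i, j)"

definition lane_prob :: "'n lane \<Rightarrow> real" where
  "lane_prob e = logit_prob (destinations M (fst e)) (posted_utility (fst e)) (snd e)"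

abbreviation choice :: "'n \<Rightarrow> ('n option \<Rightarrow> real) \<Rightarrow> 'n" where
  "choice i \<equiv> logit_choice (destinations M i) (posted_utility i)"

lemma finite_carriers [simp]: "finite carriers"
  by (simp add: carriers_def)

lemma shock_law_carriers: "shock_law x = PiM carriers (\<lambda>_. shock_measure)"
  by (simp add: shock_law_eq carriers_def)

sublocale shocks: prob_space "shock_law x"
  unfolding shock_law_carriers by (intro prob_space_PiM prob_space_shock_measure)

lemma destinations_nonempty: "destinations M i \<noteq> {}"
  using market by (auto simp: valid_market_def destinations_def)

lemma price_sens_pos: "0 < price_sens M"
  using market by (simp add: valid_market_def)

lemma lane_prob_pos: "e \<in> lanes M \<Longrightarrow> 0 < lane_prob e"
  unfolding lane_prob_def by (intro logit_prob_pos) (auto simp: destinations_def)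

lemma sum_lane_prob: "(\<Sum>j\<in>destinations M i. lane_prob (i, j)) = 1"
  unfolding lane_prob_def using sum_logit_prob[OF _ destinations_nonempty] by simp

lemma bidders_eq: "bidders M a x \<omega> e = {s. s < fst x (fst e) \<and> choice (fst e) (\<omega> (fst e, s)) = snd e}"
  unfolding bidders_def chosen_lane_def logit_choice_def destinations_def posted_utility_def
  by (cases e) auto

lemma bidders_subset: "bidders M a x \<omega> e \<subseteq> {..<fst x (fst e)}"
  by (auto simp: bidders_def)

text \<open>
  This is a product event: the own shocks of each carrier decide whether it belongs to \<open>N\<close>.
\<close>

definition bidding_event :: "'n lane \<Rightarrow> nat set \<Rightarrow> 'n shocks set" where
  "bidding_event e N = {\<omega> \<in> space (shock_law x). bidders M a x \<omega> e = N}"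

lemma measurable_shock_component [measurable (raw)]:
  "c \<in> carriers \<Longrightarrow> (\<lambda>\<omega>. \<omega> c) \<in> shock_law x \<rightarrow>\<^sub>M shock_measure"
  unfolding shock_law_carriers by measurable

lemma bidding_event_eq:
  "N \<subseteq> {..<fst x (fst e)} \<Longrightarrow> bidding_event e N =
     {\<omega> \<in> space (shock_law x). \<forall>s\<in>{..<fst x (fst e)}. s \<in> N \<longleftrightarrow> choice (fst e) (\<omega> (fst e, s)) = snd e}"
  unfolding bidding_event_def bidders_eq by auto

lemma sets_bidding_event [measurable]:
  assumes "N \<subseteq> {..<fst x (fst e)}"
  shows "bidding_event e N \<in> sets (shock_law x)"
proof -
  have [measurable]: "(\<lambda>\<omega>. choice (fst e) (\<omega> (fst e, s))) \<in> shock_law x \<rightarrow>\<^sub>M count_space UNIV"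
    if "s \<in> {..<fst x (fst e)}" for s
    by (rule measurable_compose[OF measurable_shock_component measurable_logit_choice])
       (use that in \<open>auto simp: carriers_def\<close>)
  show ?thesis unfolding bidding_event_eq[OF assms] by measurable
qed

lemma feasible: "e \<in> lanes M \<Longrightarrow> N \<subseteq> {..<fst x (fst e)} \<Longrightarrow> W \<in> set_pmf (award a e N c) \<Longrightarrow>
    W \<subseteq> N \<and> card W \<le> snd x e"
  using action unfolding valid_action_def feasible_award_def by blast

lemma award_prob_sum:
  assumes "e \<in> lanes M" "N \<subseteq> {..<fst x (fst e)}"
  shows "award_prob a e N c s = (\<Sum>W\<in>{W. W \<subseteq> N \<and> s \<in> W}. pmf (award a e N c) W)"
proof -
  have fN: "finite N" using assms(2) finite_subset by blast
  have "award_prob a e N c s = measure_pmf.prob (award a e N c) ({W. s \<in> W} \<inter> set_pmf (award a e N c))"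
    by (simp add: award_prob_def measure_Int_set_pmf)
  also have "{W. s \<in> W} \<inter> set_pmf (award a e N c) = {W. W \<subseteq> N \<and> s \<in> W} \<inter> set_pmf (award a e N c)"
    using feasible[OF assms] by blast
  also have "measure_pmf.prob (award a e N c) \<dots> = measure_pmf.prob (award a e N c) {W. W \<subseteq> N \<and> s \<in> W}"
    by (simp add: measure_Int_set_pmf)
  also have "\<dots> = (\<Sum>W\<in>{W. W \<subseteq> N \<and> s \<in> W}. pmf (award a e N c) W)"
    using fN by (intro measure_measure_pmf_finite) auto
  finally show ?thesis .
qed

lemma award_prob_bounds: "0 \<le> award_prob a e N c s" "award_prob a e N c s \<le> 1"
  by (simp_all add: award_prob_def)

lemma measurable_award_pmf [measurable]:
  "e \<in> lanes M \<Longrightarrow> N \<subseteq> {..<fst x (fst e)} \<Longrightarrow> (\<lambda>c. pmf (award a e N c) W) \<in> borel_measurable (\<Pi>\<^sub>M s\<in>N. borel)"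
  using action unfolding valid_action_def regular_mechanism_def by blast

lemma measurable_award_prob [measurable]:
  "e \<in> lanes M \<Longrightarrow> N \<subseteq> {..<fst x (fst e)} \<Longrightarrow> (\<lambda>c. award_prob a e N c s) \<in> borel_measurable (\<Pi>\<^sub>M s\<in>N. borel)"
  by (subst measurable_cong[OF award_prob_sum]) (auto intro!: borel_measurable_sum measurable_award_pmf)

lemma measurable_payment [measurable]:
  "e \<in> lanes M \<Longrightarrow> N \<subseteq> {..<fst x (fst e)} \<Longrightarrow> s \<in> N \<Longrightarrow> (\<lambda>c. payment a e N c s) \<in> borel_measurable (\<Pi>\<^sub>M s\<in>N. borel)"
  using action unfolding valid_action_def regular_mechanism_def by blast

lemma measurable_true_bids:
  assumes "N \<subseteq> {..<fst x (fst e)}" "(\<lambda>y. f y) \<in> K \<rightarrow>\<^sub>M PiM I (\<lambda>_. shock_measure)" "\<And>s. s \<in> N \<Longrightarrow> (fst e, s) \<in> I"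
  shows "(\<lambda>y. true_bids M (f y) e N) \<in> K \<rightarrow>\<^sub>M (\<Pi>\<^sub>M s\<in>N. borel)"
  unfolding true_bids_def
proof (rule measurable_restrict)
  fix s assume s: "s \<in> N"
  have c: "(\<lambda>y. f y (fst e, s)) \<in> K \<rightarrow>\<^sub>M shock_measure"
    by (rule measurable_compose[OF assms(2)]) (use assms(3)[OF s] in measurable)
  have [measurable]: "(\<lambda>y. f y (fst e, s) k) \<in> borel_measurable K" for k
    using measurable_compose[OF c, of "\<lambda>\<xi>. \<xi> k" borel] by simp
  show "(\<lambda>y. true_cost M (f y) e s) \<in> borel_measurable K"
    unfolding true_cost_def by measurable
qed

definition others :: "'n lane \<Rightarrow> nat \<Rightarrow> ('n \<times> nat) set" where
  "others e s = carriers - {(fst e, s)}"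

definition own_event :: "'n lane \<Rightarrow> ('n option \<Rightarrow> real) set" where
  "own_event e = {\<xi>. choice (fst e) \<xi> = snd e}"

definition others_event :: "'n lane \<Rightarrow> nat set \<Rightarrow> nat \<Rightarrow> 'n shocks set" where
  "others_event e N s = {\<omega> \<in> space (PiM (others e s) (\<lambda>_. shock_measure)).
     \<forall>r\<in>{..<fst x (fst e)} - {s}. r \<in> N \<longleftrightarrow> choice (fst e) (\<omega> (fst e, r)) = snd e}"

text \<open>
  Here \<open>u\<close> is the outside shock of the carrier minus its shock for the lane.
\<close>

definition own_cost :: "'n lane \<Rightarrow> real \<Rightarrow> real" where
  "own_cost e u = (cost_shift M e + u) / price_sens M"

lemma carriers_insert: "s < fst x (fst e) \<Longrightarrow> carriers = insert (fst e, s) (others e s)"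
  by (cases e) (auto simp: others_def carriers_def)

lemma shock_law_split:
  assumes s: "s < fst x (fst e)"
  shows "shock_law x = distr (shock_measure \<Otimes>\<^sub>M PiM (others e s) (\<lambda>_. shock_measure)) (shock_law x)
    (\<lambda>(\<xi>, \<eta>). \<eta>((fst e, s) := \<xi>))"
  unfolding shock_law_carriers carriers_insert[OF s]
  by (rule distr_pair_PiM_eq_PiM[symmetric]) (rule prob_space_shock_measure)+

lemma sets_own_event [measurable]: "own_event e \<in> sets shock_measure"
  unfolding own_event_def by (rule sets_logit_choice)

lemma sets_others_event [measurable]:
  "others_event e N s \<in> sets (PiM (others e s) (\<lambda>_. shock_measure))"
proof -
  have [measurable]: "(\<lambda>\<omega>. choice (fst e) (\<omega> (fst e, r))) \<in> PiM (others e s) (\<lambda>_. shock_measure) \<rightarrow>\<^sub>M count_space UNIV"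
    if "r \<in> {..<fst x (fst e)} - {s}" for r
  proof (rule measurable_compose[OF _ measurable_logit_choice])
    have "(fst e, r) \<in> others e s" using that by (auto simp: carriers_def others_def)
    then show "(\<lambda>\<omega>. \<omega> (fst e, r)) \<in> PiM (others e s) (\<lambda>_. shock_measure) \<rightarrow>\<^sub>M shock_measure"
      by (rule measurable_component_singleton)
  qed
  show ?thesis unfolding others_event_def by measurable
qed

lemma bidding_event_split:
  assumes "N \<subseteq> {..<fst x (fst e)}" "s \<in> N" and \<eta>: "\<eta> \<in> space (PiM (others e s) (\<lambda>_. shock_measure))"
  shows "\<eta>((fst e, s) := \<xi>) \<in> bidding_event e N \<longleftrightarrow> \<xi> \<in> own_event e \<and> \<eta> \<in> others_event e N s"
proof -
  have s: "s < fst x (fst e)" using assms by auto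
  have "\<eta>((fst e, s) := \<xi>) \<in> space (shock_law x)"
    using \<eta> unfolding shock_law_carriers carriers_insert[OF s] space_PiM
    by (auto simp: PiE_def extensional_def space_shock_measure)
  then show ?thesis
    unfolding bidding_event_eq[OF assms(1)] own_event_def others_event_def using s assms by auto
qed

lemma true_bids_split:
  assumes "s \<in> N"
  shows "true_bids M (\<eta>((fst e, s) := \<xi>)) e N
      = (true_bids M \<eta> e N)(s := own_cost e (\<xi> None - \<xi> (Some (snd e))))"
    and "(true_bids M (\<eta>((fst e, s) := \<xi>)) e N)(s := c) = (true_bids M \<eta> e N)(s := c)"
  using assms by (auto simp: true_bids_def fun_eq_iff true_cost_def own_cost_def algebra_simps)

text \<open>
  Only the bids of the others are read from the shocks, so it suffices that the shocks of the
  others are given.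
\<close>

lemma measurable_others_bids:
  assumes N: "N \<subseteq> {..<fst x (fst e)}" "s \<in> N"
    and c: "c \<in> borel_measurable K" and f: "f \<in> K \<rightarrow>\<^sub>M PiM (others e s) (\<lambda>_. shock_measure)"
  shows "(\<lambda>y. (true_bids M (f y) e N)(s := c y)) \<in> K \<rightarrow>\<^sub>M (\<Pi>\<^sub>M s\<in>N. borel)"
proof -
  have "(\<lambda>y. true_bids M (f y) e (N - {s})) \<in> K \<rightarrow>\<^sub>M (\<Pi>\<^sub>M s\<in>N - {s}. borel)"
    by (rule measurable_true_bids[OF _ f]) (use N in \<open>auto simp: others_def carriers_def\<close>)
  then have "(\<lambda>y. (true_bids M (f y) e (N - {s}))(s := c y)) \<in> K \<rightarrow>\<^sub>M (\<Pi>\<^sub>M s\<in>N. borel)"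
    by (rule measurable_fun_upd[rotated]) (use N c in auto)
  moreover have "(true_bids M (f y) e (N - {s}))(s := c y) = (true_bids M (f y) e N)(s := c y)" for y
    by (auto simp: true_bids_def fun_eq_iff)
  ultimately show ?thesis by simp
qed

lemma prob_own_event: "e \<in> lanes M \<Longrightarrow> measure shock_measure (own_event e) = lane_prob e"
proof -
  assume e: "e \<in> lanes M"
  then have d: "snd e \<in> destinations M (fst e)" by (simp add: destinations_def)
  have "(\<integral>\<xi>. indicator (own_event e) \<xi> * 1 \<partial>shock_measure) = (\<integral>u. 1 * lane_density (lane_prob e) u \<partial>lborel)"
    unfolding own_event_def lane_prob_def by (rule integral_logit_choice(2)[OF d]) simp
  also have "\<dots> = lane_prob e"
    using nn_integral_lane_density[OF lane_prob_pos[OF e]] lane_prob_pos[OF e]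
    by (intro integral_eq_nn_integral[THEN trans]) (auto simp: lane_density_nonneg)
  finally show ?thesis by simp
qed

text \<open>
  Fubini, with the shocks of one carrier integrated last.
\<close>

lemma shock_integral_split:
  fixes F :: "'n shocks \<Rightarrow> real"
  assumes s: "s < fst x (fst e)" and F: "integrable (shock_law x) F"
    and g: "\<And>\<xi> \<eta>. \<eta> \<in> space (PiM (others e s) (\<lambda>_. shock_measure)) \<Longrightarrow> F (\<eta>((fst e, s) := \<xi>)) = g \<xi> \<eta>"
  shows "integrable shock_measure (\<lambda>\<xi>. \<integral>\<eta>. g \<xi> \<eta> \<partial>PiM (others e s) (\<lambda>_. shock_measure))"
    and "(\<integral>\<omega>. F \<omega> \<partial>shock_law x) = (\<integral>\<xi>. \<integral>\<eta>. g \<xi> \<eta> \<partial>PiM (others e s) (\<lambda>_. shock_measure) \<partial>shock_measure)"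
proof -
  let ?W = "PiM (others e s) (\<lambda>_. shock_measure) :: 'n shocks measure"
  let ?Q = "shock_measure :: ('n option \<Rightarrow> real) measure"
  let ?u = "\<lambda>(\<xi>, \<eta>). \<eta>((fst e, s) := \<xi>)"
  interpret Q: prob_space ?Q by (rule prob_space_shock_measure)
  interpret W: prob_space ?W by (intro prob_space_PiM prob_space_shock_measure)
  interpret QW: pair_prob_space ?Q ?W ..
  have u: "?u \<in> (?Q \<Otimes>\<^sub>M ?W) \<rightarrow>\<^sub>M shock_law x"
    unfolding shock_law_carriers carriers_insert[OF s] by measurable
  have Fm: "F \<in> borel_measurable (shock_law x)" using F by auto
  have eq: "F (?u z) = case_prod g z" if "z \<in> space (?Q \<Otimes>\<^sub>M ?W)" for z
    using that g by (auto simp: space_pair_measure)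
  have "integrable (?Q \<Otimes>\<^sub>M ?W) (\<lambda>z. F (?u z))"
    using F by (subst (asm) shock_law_split[OF s], subst (asm) integrable_distr_eq[OF u Fm])
  then have i: "integrable (?Q \<Otimes>\<^sub>M ?W) (case_prod g)"
    by (simp only: eq cong: Bochner_Integration.integrable_cong)
  show "integrable ?Q (\<lambda>\<xi>. \<integral>\<eta>. g \<xi> \<eta> \<partial>?W)" by (rule QW.integrable_fst[OF i])
  have "(\<integral>\<omega>. F \<omega> \<partial>shock_law x) = (\<integral>z. F (?u z) \<partial>(?Q \<Otimes>\<^sub>M ?W))"
    by (subst shock_law_split[OF s], subst integral_distr[OF u Fm]) simp
  also have "\<dots> = (\<integral>z. case_prod g z \<partial>(?Q \<Otimes>\<^sub>M ?W))"
    by (rule Bochner_Integration.integral_cong[OF refl eq])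
  also have "\<dots> = (\<integral>\<xi>. \<integral>\<eta>. g \<xi> \<eta> \<partial>?W \<partial>?Q)" by (rule QW.integral_fst[symmetric, OF i])
  finally show "(\<integral>\<omega>. F \<omega> \<partial>shock_law x) = (\<integral>\<xi>. \<integral>\<eta>. g \<xi> \<eta> \<partial>?W \<partial>?Q)" .
qed

text \<open>
  The function \<open>g\<close> is the interim expectation of \<open>\<phi>\<close> as a function of the own (normalized) cost. The
  bidding event factors into an own event and an event of the others, so by Fubini the own cost may be
  integrated last, and given the own event it has the density \<open>lane_density\<close>.
\<close>

lemma bidding_integral:
  fixes \<phi> :: "(nat \<Rightarrow> real) \<Rightarrow> real"
  assumes e: "e \<in> lanes M" and N: "N \<subseteq> {..<fst x (fst e)}" "s \<in> N"
    and pos: "0 < shocks.prob (bidding_event e N)"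
    and \<phi>[measurable]: "\<phi> \<in> borel_measurable (\<Pi>\<^sub>M s\<in>N. borel)"
    and int: "integrable (shocks_given_bidders M a x e N) (\<lambda>\<omega>. \<phi> (true_bids M \<omega> e N))"
    and int': "\<And>c. integrable (shocks_given_bidders M a x e N) (\<lambda>\<omega>. \<phi> ((true_bids M \<omega> e N)(s := c)))"
  defines "g \<equiv> \<lambda>u. (\<integral>\<omega>. \<phi> ((true_bids M \<omega> e N)(s := own_cost e u)) \<partial>shocks_given_bidders M a x e N)"
  shows "g \<in> borel_measurable borel"
    and "integrable lborel (\<lambda>u. g u * lane_density (lane_prob e) u)"
    and "lane_prob e * (\<integral>\<omega>. indicator (bidding_event e N) \<omega> * \<phi> (true_bids M \<omega> e N) \<partial>shock_law x)
      = shocks.prob (bidding_event e N) * (\<integral>u. g u * lane_density (lane_prob e) u \<partial>lborel)"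
proof -
  let ?P = "shocks.prob (bidding_event e N)" and ?B = "bidding_event e N"
  let ?W = "PiM (others e s) (\<lambda>_. shock_measure) :: 'n shocks measure"
  let ?Q = "shock_measure :: ('n option \<Rightarrow> real) measure"
  have s: "s < fst x (fst e)" using N by auto
  have d: "snd e \<in> destinations M (fst e)" using e by (simp add: destinations_def)
  have w: "0 < lane_prob e" by (rule lane_prob_pos[OF e])
  interpret W: prob_space ?W by (intro prob_space_PiM prob_space_shock_measure)
  note [measurable] = sets_bidding_event[OF N(1)]
  have [measurable]: "(\<lambda>\<omega>. true_bids M \<omega> e N) \<in> shock_law x \<rightarrow>\<^sub>M (\<Pi>\<^sub>M s\<in>N. borel)"
    unfolding shock_law_carriers
    by (rule measurable_true_bids[OF N(1), where I = carriers]) (use N in \<open>auto simp: carriers_def\<close>)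
  have updN [measurable]: "(\<lambda>\<omega>. (true_bids M \<omega> e N)(s := c)) \<in> shock_law x \<rightarrow>\<^sub>M (\<Pi>\<^sub>M s\<in>N. borel)" for c
    by (rule measurable_fun_upd[where J = N]) (use N in auto)
  have [measurable]: "own_cost e \<in> borel_measurable borel" unfolding own_cost_def[abs_def] by measurable
  \<comment> \<open>The contribution of the shocks of the others when the own report is \<open>c\<close>.\<close>
  define r where "r = (\<lambda>c \<eta>. indicator (others_event e N s) \<eta> * \<phi> ((true_bids M \<eta> e N)(s := c)))"
  define m where "m = (\<lambda>c. \<integral>\<eta>. r c \<eta> \<partial>?W)"
  have [measurable]: "(\<lambda>(c, \<eta>). (true_bids M \<eta> e N)(s := c)) \<in> (borel \<Otimes>\<^sub>M ?W) \<rightarrow>\<^sub>M (\<Pi>\<^sub>M s\<in>N. borel)"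
    using measurable_others_bids[OF N, of fst "borel \<Otimes>\<^sub>M ?W" snd] by (simp add: split_beta')
  have [measurable]: "(\<lambda>(c, \<eta>). r c \<eta>) \<in> borel_measurable (borel \<Otimes>\<^sub>M ?W)"
    unfolding r_def by measurable
  have m [measurable]: "m \<in> borel_measurable borel" unfolding m_def by measurable
  have given: "shocks_given_bidders M a x e N = uniform_measure (shock_law x) ?B"
    by (simp add: shocks_given_bidders_def bidding_event_def)
  have split_ind: "indicator ?B (\<eta>((fst e, s) := \<xi>)) = (indicator (own_event e) \<xi> * indicator (others_event e N s) \<eta> :: real)"
    if "\<eta> \<in> space ?W" for \<eta> \<xi>
    using bidding_event_split[OF N that, of \<xi>] by (auto simp: indicator_def)
  \<comment> \<open>With a fixed report the integrand depends on the own shocks through the lane choice only.\<close>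
  have fixed: "g u = lane_prob e * m (own_cost e u) / ?P" for u
  proof -
    let ?c = "own_cost e u"
    let ?F = "\<lambda>\<omega>. indicator ?B \<omega> * \<phi> ((true_bids M \<omega> e N)(s := ?c))"
    have i: "integrable (shock_law x) ?F"
      using int'[of ?c] unfolding given by (subst (asm) shocks.uniform_measure_integral(1)[OF _ _ pos]) auto
    have "?F (\<eta>((fst e, s) := \<xi>)) = indicator (own_event e) \<xi> * r ?c \<eta>" if "\<eta> \<in> space ?W" for \<xi> \<eta>
      by (simp add: split_ind[OF that] true_bids_split(2)[OF N(2)] r_def)
    then have "(\<integral>\<omega>. ?F \<omega> \<partial>shock_law x) = (\<integral>\<xi>. \<integral>\<eta>. indicator (own_event e) \<xi> * r ?c \<eta> \<partial>?W \<partial>?Q)"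
      by (rule shock_integral_split(2)[OF s i])
    also have "\<dots> = lane_prob e * m ?c"
      using prob_own_event[OF e] by (simp add: m_def)
    finally show ?thesis unfolding g_def given
      by (subst shocks.uniform_measure_integral(2)[OF _ _ pos]) auto
  qed
  have g_eq: "g = (\<lambda>u. lane_prob e / ?P * m (own_cost e u))" using fixed by (auto simp: fun_eq_iff)
  show gm: "g \<in> borel_measurable borel" unfolding g_eq by measurable
  \<comment> \<open>With the true report they enter through the choice and through the cost.\<close>
  let ?u = "\<lambda>\<xi>. \<xi> None - \<xi> (Some (snd e))"
  let ?F = "\<lambda>\<omega>. indicator ?B \<omega> * \<phi> (true_bids M \<omega> e N)"
  have i: "integrable (shock_law x) ?F"
    using int unfolding given by (subst (asm) shocks.uniform_measure_integral(1)[OF _ _ pos]) auto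
  have F: "?F (\<eta>((fst e, s) := \<xi>)) = indicator (own_event e) \<xi> * r (own_cost e (?u \<xi>)) \<eta>" if "\<eta> \<in> space ?W" for \<xi> \<eta>
    by (simp add: split_ind[OF that] true_bids_split(1)[OF N(2)] r_def)
  have inner: "(\<integral>\<eta>. indicator (own_event e) \<xi> * r (own_cost e (?u \<xi>)) \<eta> \<partial>?W)
      = ?P / lane_prob e * (indicator (own_event e) \<xi> * g (?u \<xi>))" for \<xi>
    using w pos by (simp add: m_def g_eq)
  have "integrable ?Q (\<lambda>\<xi>. ?P / lane_prob e * (indicator (own_event e) \<xi> * g (?u \<xi>)))"
    using shock_integral_split(1)[OF s i F] unfolding inner .
  then have "integrable ?Q (\<lambda>\<xi>. indicator (own_event e) \<xi> * g (?u \<xi>))"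
    using w pos by (subst (asm) integrable_mult_left_iff) auto
  then show "integrable lborel (\<lambda>u. g u * lane_density (lane_prob e) u)"
    unfolding own_event_def lane_prob_def using integral_logit_choice(1)[OF d gm] by blast
  have "(\<integral>\<omega>. ?F \<omega> \<partial>shock_law x) = ?P / lane_prob e * (\<integral>\<xi>. indicator (own_event e) \<xi> * g (?u \<xi>) \<partial>?Q)"
    using shock_integral_split(2)[OF s i F] unfolding inner by simp
  also have "(\<integral>\<xi>. indicator (own_event e) \<xi> * g (?u \<xi>) \<partial>?Q) = (\<integral>u. g u * lane_density (lane_prob e) u \<partial>lborel)"
    unfolding own_event_def lane_prob_def by (rule integral_logit_choice(2)[OF d gm])
  finally show "lane_prob e * (\<integral>\<omega>. ?F \<omega> \<partial>shock_law x) = ?P * (\<integral>u. g u * lane_density (lane_prob e) u \<partial>lborel)"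
    using w by simp
qed

definition pay_on :: "'n lane \<Rightarrow> nat set \<Rightarrow> nat \<Rightarrow> 'n shocks \<Rightarrow> real" where
  "pay_on e N s \<omega> = indicator (bidding_event e N) \<omega> * payment a e N (true_bids M \<omega> e N) s"

definition award_on :: "'n lane \<Rightarrow> nat set \<Rightarrow> nat \<Rightarrow> 'n shocks \<Rightarrow> real" where
  "award_on e N s \<omega> = indicator (bidding_event e N) \<omega> * award_prob a e N (true_bids M \<omega> e N) s"

lemma measurable_own_true_bids [measurable]:
  "N \<subseteq> {..<fst x (fst e)} \<Longrightarrow> (\<lambda>\<omega>. true_bids M \<omega> e N) \<in> shock_law x \<rightarrow>\<^sub>M (\<Pi>\<^sub>M s\<in>N. borel)"
  unfolding shock_law_carriers
  by (rule measurable_true_bids[where I = carriers]) (auto simp: carriers_def)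

lemma measurable_upd_bids:
  assumes "N \<subseteq> {..<fst x (fst e)}" "s \<in> N"
  shows "(\<lambda>\<omega>. (true_bids M \<omega> e N)(s := c)) \<in> shock_law x \<rightarrow>\<^sub>M (\<Pi>\<^sub>M s\<in>N. borel)"
  by (rule measurable_fun_upd[where J = N]) (use assms in auto)

lemma measurable_pay_on [measurable]:
  assumes [measurable]: "e \<in> lanes M" "N \<subseteq> {..<fst x (fst e)}" "s \<in> N"
  shows "pay_on e N s \<in> borel_measurable (shock_law x)"
  unfolding pay_on_def[abs_def]
  by (intro borel_measurable_times borel_measurable_indicator sets_bidding_event
      measurable_compose[OF measurable_own_true_bids measurable_payment] assms)

lemma measurable_award_on [measurable]:
  assumes [measurable]: "e \<in> lanes M" "N \<subseteq> {..<fst x (fst e)}"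
  shows "award_on e N s \<in> borel_measurable (shock_law x)"
  unfolding award_on_def[abs_def]
  by (intro borel_measurable_times borel_measurable_indicator sets_bidding_event
      measurable_compose[OF measurable_own_true_bids measurable_award_prob] assms)

lemma integrable_award_on:
  assumes "e \<in> lanes M" "N \<subseteq> {..<fst x (fst e)}"
  shows "integrable (shock_law x) (award_on e N s)"
  by (rule shocks.integrable_const_bound[where B = 1])
     (use award_prob_bounds in \<open>auto simp: award_on_def indicator_def intro!: measurable_award_on assms\<close>)

text \<open>
  The screening bound for one carrier given one set of bidders. If that set has probability zero,
  the conditional law is degenerate and both integrals vanish.
\<close>

lemma carrier_payment_bound:
  assumes e: "e \<in> lanes M" and N: "N \<subseteq> {..<fst x (fst e)}" "s \<in> N"
  shows "integrable (shock_law x) (pay_on e N s)"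
    and "lane_prob e * (price_sens M * shocks.expectation (pay_on e N s)
           - (cost_shift M e + (t + 1 + exp t / lane_prob e)) * shocks.expectation (award_on e N s))
         \<ge> - exp t * shocks.prob (bidding_event e N)"
proof -
  let ?B = "bidding_event e N" and ?w = "lane_prob e" and ?U = "shocks_given_bidders M a x e N"
  note B = sets_bidding_event[OF N(1)]
  have "integrable (shock_law x) (pay_on e N s) \<and>
    ?w * (price_sens M * shocks.expectation (pay_on e N s)
           - (cost_shift M e + (t + 1 + exp t / ?w)) * shocks.expectation (award_on e N s))
         \<ge> - exp t * shocks.prob ?B"
  proof (cases "shocks.prob ?B = 0")
    case True
    then have "?B \<in> null_sets (shock_law x)" using B by (auto simp: shocks.emeasure_eq_measure)
    then have "AE \<omega> in shock_law x. \<omega> \<notin> ?B" by (rule AE_not_in)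
    then have p: "AE \<omega> in shock_law x. pay_on e N s \<omega> = 0" and q: "AE \<omega> in shock_law x. award_on e N s \<omega> = 0"
      by (auto simp: pay_on_def award_on_def)
    have "integrable (shock_law x) (pay_on e N s)"
      using integrable_cong_AE[OF measurable_pay_on[OF e N] _ p] by simp
    moreover have "shocks.expectation (pay_on e N s) = 0"
      using integral_cong_AE[OF measurable_pay_on[OF e N] _ p] by simp
    moreover have "shocks.expectation (award_on e N s) = 0"
      using integral_cong_AE[OF measurable_award_on[OF e N(1)] _ q] by simp
    ultimately show ?thesis using True by simp
  next
    case False
    then have pos: "0 < shocks.prob ?B" by (simp add: zero_less_measure_iff)
    have given: "?U = uniform_measure (shock_law x) ?B"
      by (simp add: shocks_given_bidders_def bidding_event_def)
    interpret U: prob_space ?U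
      unfolding given using pos by (intro prob_space_uniform_measure) (auto simp: shocks.emeasure_eq_measure)
    have sU[measurable_cong]: "sets ?U = sets (shock_law x)" by (simp add: given)
    have mU: "f \<in> borel_measurable (shock_law x) \<Longrightarrow> f \<in> borel_measurable ?U" for f :: "_ \<Rightarrow> real"
      by (simp add: measurable_cong_sets[OF sU refl])
    have reg: "(\<lambda>c. payment a e N c s) \<in> borel_measurable (\<Pi>\<^sub>M s\<in>N. borel)"
        "integrable ?U (\<lambda>\<omega>. payment a e N (true_bids M \<omega> e N) s)"
        "\<And>c. integrable ?U (\<lambda>\<omega>. payment a e N ((true_bids M \<omega> e N)(s := c)) s)"
      using action e N unfolding valid_action_def regular_mechanism_def by blast+
    have ia: "integrable ?U (\<lambda>\<omega>. award_prob a e N (true_bids M \<omega> e N) s)"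
      by (rule U.integrable_const_bound[where B = 1])
         (use award_prob_bounds in \<open>auto intro!: mU measurable_compose[OF measurable_own_true_bids measurable_award_prob] e N\<close>)
    have ia': "integrable ?U (\<lambda>\<omega>. award_prob a e N ((true_bids M \<omega> e N)(s := c)) s)" for c
      by (rule U.integrable_const_bound[where B = 1])
         (use award_prob_bounds in \<open>auto intro!: mU measurable_compose[OF measurable_upd_bids measurable_award_prob] e N\<close>)
    define ip where "ip = (\<lambda>u. interim_payment M a x e N s (own_cost e u))"
    define A where "A = (\<lambda>u. interim_award M a x e N s (own_cost e u))"
    define U where "U = (\<lambda>u. price_sens M * (ip u - A u * own_cost e u))"
    note b = price_sens_pos
    note pay = bidding_integral[OF e N pos reg, folded interim_payment_def, folded ip_def pay_on_def]
    note aw = bidding_integral[OF e N pos measurable_award_prob[OF e N(1)] ia ia', folded interim_award_def, folded A_def award_on_def]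
    have pay2: "integrable lborel (\<lambda>u. ip u * lane_density (lane_prob e) u)"
      and pay3: "lane_prob e * shocks.expectation (pay_on e N s)
        = shocks.prob ?B * (\<integral>u. ip u * lane_density ?w u \<partial>lborel)"
      using pay(2,3) by (simp_all add: ip_def)
    have aw2: "integrable lborel (\<lambda>u. A u * lane_density (lane_prob e) u)"
      and aw3: "lane_prob e * shocks.expectation (award_on e N s)
        = shocks.prob ?B * (\<integral>u. A u * lane_density ?w u \<partial>lborel)"
      using aw(2,3) by (simp_all add: A_def)
    have c: "price_sens M * own_cost e u = cost_shift M e + u" for u
      using b by (simp add: own_cost_def)
    have Ub: "U u + A u * (u - k) = price_sens M * ip u - (cost_shift M e + k) * A u" for u k
      unfolding U_def by (simp add: right_diff_distrib mult.left_commute[of "price_sens M"] c) (simp add: algebra_simps)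
    have ir: "0 \<le> U u" for u
      using action e N b unfolding U_def ip_def A_def valid_action_def individually_rational_def
      by (intro mult_nonneg_nonneg) auto
    have ic: "U v + A v * (v - u) \<le> U u" for u v
    proof -
      have "ip v - A v * own_cost e u \<le> ip u - A u * own_cost e u"
        using action e N unfolding ip_def A_def valid_action_def incentive_compatible_def by blast
      then have "price_sens M * (ip v - A v * own_cost e u) \<le> U u"
        unfolding U_def using b by (intro mult_left_mono) auto
      moreover have "price_sens M * (ip v - A v * own_cost e u) = U v + A v * (v - u)"
        unfolding U_def by (simp add: right_diff_distrib mult.left_commute[of "price_sens M"] c) (simp add: algebra_simps)
      ultimately show ?thesis by simp
    qed
    have A: "0 \<le> A u" "A u \<le> 1" for u
    proof -
      show "0 \<le> A u" unfolding A_def interim_award_def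
        by (rule integral_nonneg_AE[OF AE_I2]) (rule award_prob_bounds)
      show "A u \<le> 1" unfolding A_def interim_award_def
        by (rule U.integral_le_const[OF ia' AE_I2]) (rule award_prob_bounds)
    qed
    have [measurable]: "A \<in> borel_measurable borel" "ip \<in> borel_measurable borel"
      using pay(1) aw(1) by auto
    have [measurable]: "U \<in> borel_measurable borel"
      unfolding U_def own_cost_def by measurable
    have w: "0 < ?w" by (rule lane_prob_pos[OF e])
    define K where "K = t + 1 + exp t / ?w"
    have lin: "(U u + A u * (u - k)) * lane_density ?w u
        = price_sens M * (ip u * lane_density ?w u) - (cost_shift M e + k) * (A u * lane_density ?w u)" for u k
      unfolding Ub by (simp add: algebra_simps)
    have int: "integrable lborel (\<lambda>u. (U u + A u * u) * lane_density ?w u)"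
      using lin[of _ 0] pay2 aw2 by simp
    have "- exp t \<le> (\<integral>u. (U u + A u * (u - K)) * lane_density ?w u \<partial>lborel)"
      unfolding K_def by (rule screening_bound[OF ic ir A _ _ w int]) measurable
    also have "\<dots> = price_sens M * (\<integral>u. ip u * lane_density ?w u \<partial>lborel)
        - (cost_shift M e + K) * (\<integral>u. A u * lane_density ?w u \<partial>lborel)"
      unfolding lin using pay2 aw2 by simp
    finally have "- exp t * shocks.prob ?B \<le> (price_sens M * (\<integral>u. ip u * lane_density ?w u \<partial>lborel)
        - (cost_shift M e + K) * (\<integral>u. A u * lane_density ?w u \<partial>lborel)) * shocks.prob ?B"
      using pos by (intro mult_right_mono) auto
    also have "\<dots> = price_sens M * (shocks.prob ?B * (\<integral>u. ip u * lane_density ?w u \<partial>lborel))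
        - (cost_shift M e + K) * (shocks.prob ?B * (\<integral>u. A u * lane_density ?w u \<partial>lborel))"
      by (simp add: algebra_simps)
    also have "\<dots> = ?w * (price_sens M * shocks.expectation (pay_on e N s)
           - (cost_shift M e + K) * shocks.expectation (award_on e N s))"
      unfolding pay3[symmetric] aw3[symmetric] by (simp add: algebra_simps)
    moreover have "integrable (shock_law x) (pay_on e N s)"
      using reg(2) unfolding given pay_on_def
      by (subst (asm) shocks.uniform_measure_integral(1)[OF B _ pos])
         (auto intro!: measurable_compose[OF measurable_own_true_bids measurable_payment] e N)
    ultimately show ?thesis by (simp add: K_def)
  qed
  then show "integrable (shock_law x) (pay_on e N s)"
    and "lane_prob e * (price_sens M * shocks.expectation (pay_on e N s)
           - (cost_shift M e + (t + 1 + exp t / lane_prob e)) * shocks.expectation (award_on e N s))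
         \<ge> - exp t * shocks.prob (bidding_event e N)" by auto
qed

definition lane_payment :: "'n lane \<Rightarrow> 'n shocks \<Rightarrow> real" where
  "lane_payment e \<omega> = (\<Sum>s\<in>bidders M a x \<omega> e.
     payment a e (bidders M a x \<omega> e) (true_bids M \<omega> e (bidders M a x \<omega> e)) s)"

definition lane_awards :: "'n lane \<Rightarrow> 'n shocks \<Rightarrow> real" where
  "lane_awards e \<omega> = measure_pmf.expectation (awarded_set M a x \<omega> e) (\<lambda>W. real (card W))"

abbreviation bidder_pairs :: "'n lane \<Rightarrow> (nat set \<times> nat) set" where
  "bidder_pairs e \<equiv> (SIGMA N:Pow {..<fst x (fst e)}. N)"

lemma sum_over_bidders:
  fixes F :: "nat set \<Rightarrow> nat \<Rightarrow> real"
  assumes "\<omega> \<in> space (shock_law x)"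
  shows "(\<Sum>s\<in>bidders M a x \<omega> e. F (bidders M a x \<omega> e) s)
    = (\<Sum>(N, s)\<in>bidder_pairs e. indicator (bidding_event e N) \<omega> * F N s)"
proof -
  let ?P = "Pow {..<fst x (fst e)}"
  have "(\<Sum>(N, s)\<in>bidder_pairs e. indicator (bidding_event e N) \<omega> * F N s)
      = (\<Sum>N\<in>?P. \<Sum>s\<in>N. indicator (bidding_event e N) \<omega> * F N s)"
    by (rule sum.Sigma[symmetric]) (auto intro: finite_subset)
  also have "\<dots> = (\<Sum>N\<in>?P. if N = bidders M a x \<omega> e then \<Sum>s\<in>N. F N s else 0)"
    using assms by (intro sum.cong) (auto simp: bidding_event_def)
  also have "\<dots> = (\<Sum>s\<in>bidders M a x \<omega> e. F (bidders M a x \<omega> e) s)"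
    using bidders_subset by (subst sum.delta) auto
  finally show ?thesis by simp
qed

lemma lane_payment_eq:
  "\<omega> \<in> space (shock_law x) \<Longrightarrow> lane_payment e \<omega> = (\<Sum>(N, s)\<in>bidder_pairs e. pay_on e N s \<omega>)"
  unfolding lane_payment_def pay_on_def by (rule sum_over_bidders)

lemma expectation_card_award:
  assumes "e \<in> lanes M" "N \<subseteq> {..<fst x (fst e)}"
  shows "measure_pmf.expectation (award a e N c) (\<lambda>W. real (card W)) = (\<Sum>s\<in>N. award_prob a e N c s)"
proof -
  have fN: "finite N" using assms(2) finite_subset by blast
  have "measure_pmf.expectation (award a e N c) (\<lambda>W. real (card W))
      = measure_pmf.expectation (award a e N c) (\<lambda>W. \<Sum>s\<in>N. indicator {W. s \<in> W} W)"
  proof (rule integral_cong_AE)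
    show "AE W in award a e N c. real (card W) = (\<Sum>s\<in>N. indicator {W. s \<in> W} W)"
    proof (rule AE_pmfI)
      fix W assume "W \<in> set_pmf (award a e N c)"
      then have "W \<subseteq> N" using feasible[OF assms] by blast
      then have "{s \<in> N. s \<in> W} = W" by auto
      then show "real (card W) = (\<Sum>s\<in>N. indicator {W. s \<in> W} W)"
        using fN by (simp add: indicator_def sum.If_cases Int_def)
    qed
  qed auto
  also have "\<dots> = (\<Sum>s\<in>N. award_prob a e N c s)"
    unfolding award_prob_def
    by (subst Bochner_Integration.integral_sum) (auto intro!: measure_pmf.integrable_const_bound[where B = 1])
  finally show ?thesis .
qed

lemma lane_awards_eq:
  "e \<in> lanes M \<Longrightarrow> \<omega> \<in> space (shock_law x) \<Longrightarrow> lane_awards e \<omega> = (\<Sum>(N, s)\<in>bidder_pairs e. award_on e N s \<omega>)"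
  unfolding lane_awards_def awarded_set_def award_on_def
  by (subst expectation_card_award[OF _ bidders_subset]) (auto intro: sum_over_bidders)

definition expected_payment :: "'n lane \<Rightarrow> real" where
  "expected_payment e = (\<integral>\<omega>. lane_payment e \<omega> \<partial>shock_law x)"

definition expected_awards :: "'n lane \<Rightarrow> real" where
  "expected_awards e = (\<integral>\<omega>. lane_awards e \<omega> \<partial>shock_law x)"

lemma integrable_lane_payment: "e \<in> lanes M \<Longrightarrow> integrable (shock_law x) (lane_payment e)"
  by (subst Bochner_Integration.integrable_cong[OF refl lane_payment_eq])
     (auto intro!: Bochner_Integration.integrable_sum carrier_payment_bound(1))

lemma integrable_lane_awards: "e \<in> lanes M \<Longrightarrow> integrable (shock_law x) (lane_awards e)"
  by (subst Bochner_Integration.integrable_cong[OF refl lane_awards_eq])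
     (auto intro!: Bochner_Integration.integrable_sum integrable_award_on)

lemma expected_payment_eq:
  "e \<in> lanes M \<Longrightarrow> expected_payment e = (\<Sum>(N, s)\<in>bidder_pairs e. shocks.expectation (pay_on e N s))"
  unfolding expected_payment_def
  by (subst Bochner_Integration.integral_cong[OF refl lane_payment_eq], assumption,
      subst Bochner_Integration.integral_sum) (auto intro!: carrier_payment_bound(1) simp: split_beta')

lemma expected_awards_eq:
  "e \<in> lanes M \<Longrightarrow> expected_awards e = (\<Sum>(N, s)\<in>bidder_pairs e. shocks.expectation (award_on e N s))"
  unfolding expected_awards_def
  by (subst Bochner_Integration.integral_cong[OF refl lane_awards_eq], assumption, assumption,
      subst Bochner_Integration.integral_sum) (auto intro!: integrable_award_on simp: split_beta')

text \<open>
  Both sides are the expected number of carriers that choose the lane.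
\<close>

lemma expected_bidders:
  assumes e: "e \<in> lanes M"
  shows "(\<Sum>(N, s)\<in>bidder_pairs e. shocks.prob (bidding_event e N)) = fst x (fst e) * lane_prob e"
proof -
  let ?S = "fst x (fst e)"
  have "(\<Sum>(N, s)\<in>bidder_pairs e. shocks.prob (bidding_event e N))
      = (\<integral>\<omega>. (\<Sum>(N, s)\<in>bidder_pairs e. indicator (bidding_event e N) \<omega> * 1) \<partial>shock_law x)"
    by (subst Bochner_Integration.integral_sum)
       (auto simp: split_beta' shocks.emeasure_eq_measure intro!: integrable_real_indicator sets_bidding_event sum.cong)
  also have "\<dots> = (\<integral>\<omega>. (\<Sum>s\<in>{..<?S}. indicator (own_event e) (\<omega> (fst e, s))) \<partial>shock_law x)"
  proof (rule Bochner_Integration.integral_cong[OF refl])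
    fix \<omega> assume "\<omega> \<in> space (shock_law x)"
    then have "(\<Sum>(N, s)\<in>bidder_pairs e. indicator (bidding_event e N) \<omega> * 1) = (\<Sum>s\<in>bidders M a x \<omega> e. 1::real)"
      by (rule sum_over_bidders[symmetric])
    also have "\<dots> = (\<Sum>s\<in>{..<?S}. indicator (own_event e) (\<omega> (fst e, s)))"
      unfolding bidders_eq own_event_def by (simp add: indicator_def sum.If_cases Int_def)
    finally show "(\<Sum>(N, s)\<in>bidder_pairs e. indicator (bidding_event e N) \<omega> * 1)
      = (\<Sum>s\<in>{..<?S}. indicator (own_event e) (\<omega> (fst e, s)) :: real)" .
  qed
  also have "\<dots> = (\<Sum>s\<in>{..<?S}. lane_prob e)"
  proof -
    have "integrable (shock_law x) (\<lambda>\<omega>. indicator (own_event e) (\<omega> (fst e, s)) :: real)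
       \<and> (\<integral>\<omega>. indicator (own_event e) (\<omega> (fst e, s)) \<partial>shock_law x) = lane_prob e" if "s < ?S" for s
    proof -
      have c: "(fst e, s) \<in> carriers" using that by (simp add: carriers_def)
      note m = measurable_shock_component[OF c]
      have d: "distr (shock_law x) shock_measure (\<lambda>\<omega>. \<omega> (fst e, s)) = shock_measure"
        unfolding shock_law_carriers
        using distr_PiM_component[of carriers "\<lambda>_. shock_measure", OF prob_space_shock_measure c] .
      have "(\<integral>\<omega>. (indicator (own_event e) (\<omega> (fst e, s)) :: real) \<partial>shock_law x)
          = (\<integral>\<xi>. indicator (own_event e) \<xi> \<partial>distr (shock_law x) shock_measure (\<lambda>\<omega>. \<omega> (fst e, s)))"
        by (subst integral_distr[OF m]) auto
      then have "(\<integral>\<omega>. indicator (own_event e) (\<omega> (fst e, s)) \<partial>shock_law x) = lane_prob e"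
        unfolding d using prob_own_event[OF e] by simp
      moreover have "integrable (shock_law x) (\<lambda>\<omega>. indicator (own_event e) (\<omega> (fst e, s)) :: real)"
        by (rule shocks.integrable_const_bound[where B = 1])
           (auto intro!: measurable_compose[OF m])
      ultimately show ?thesis by blast
    qed
    then show ?thesis by (subst Bochner_Integration.integral_sum) auto
  qed
  finally show ?thesis by simp
qed

lemma lane_payment_bound:
  assumes e: "e \<in> lanes M"
  shows "price_sens M * expected_payment e
           - (cost_shift M e + (t + 1 + exp t / lane_prob e)) * expected_awards e \<ge> - exp t * fst x (fst e)"
proof -
  let ?w = "lane_prob e" and ?K = "cost_shift M e + (t + 1 + exp t / lane_prob e)"
  have w: "0 < ?w" by (rule lane_prob_pos[OF e])
  have "?w * (- exp t * fst x (fst e)) = (\<Sum>(N, s)\<in>bidder_pairs e. - exp t * shocks.prob (bidding_event e N))"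
    using expected_bidders[OF e] by (simp add: split_beta' sum_distrib_left[symmetric] mult_ac sum_negf)
  also have "\<dots> \<le> (\<Sum>(N, s)\<in>bidder_pairs e. ?w * (price_sens M * shocks.expectation (pay_on e N s)
           - ?K * shocks.expectation (award_on e N s)))"
    using carrier_payment_bound(2)[OF e] by (intro sum_mono) auto
  also have "\<dots> = ?w * (price_sens M * expected_payment e - ?K * expected_awards e)"
    unfolding expected_payment_eq[OF e] expected_awards_eq[OF e]
    by (simp add: split_beta' sum_distrib_left[symmetric] sum_subtractf)
  finally show ?thesis using w by (simp only: mult_le_cancel_left_pos)
qed

text \<open>
  Every carrier at the node chooses lane \<open>(i, j)\<close> with probability \<open>lane_prob (i, j)\<close>. This factor
  cancels in the lane bound, and the thresholds are those of \<open>logit_thresholds\<close>.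
\<close>

lemma node_payment_bound:
  fixes \<kappa> :: "'n lane \<Rightarrow> real"
  defines "\<zeta> \<equiv> \<lambda>i. \<Sum>j\<in>destinations M i. exp (\<kappa> (i, j) - 1)"
  shows "price_sens M * (\<Sum>j\<in>destinations M i. expected_payment (i, j))
    \<ge> (\<Sum>j\<in>destinations M i. (cost_shift M (i, j) + \<kappa> (i, j)) * expected_awards (i, j))
      - \<zeta> i * (fst x i - (\<Sum>j\<in>destinations M i. expected_awards (i, j)))"
proof -
  let ?J = "destinations M i"
  obtain t where t: "\<And>j. j \<in> ?J \<Longrightarrow> t j + 1 + exp (t j) / lane_prob (i, j) = \<kappa> (i, j) + \<zeta> i"
    and le: "(\<Sum>j\<in>?J. exp (t j)) \<le> \<zeta> i"
    using logit_thresholds[of ?J "\<lambda>j. lane_prob (i, j)" "\<lambda>j. \<kappa> (i, j)"] destinations_nonempty lane_prob_pos sum_lane_prob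
    unfolding \<zeta>_def by (auto simp: destinations_def)
  have "- \<zeta> i * fst x i \<le> - (\<Sum>j\<in>?J. exp (t j)) * fst x i"
    using le by (intro mult_right_mono) auto
  also have "\<dots> = (\<Sum>j\<in>?J. - exp (t j) * fst x i)"
    by (simp add: sum_distrib_right sum_negf)
  also have "\<dots> \<le> (\<Sum>j\<in>?J. price_sens M * expected_payment (i, j)
      - (cost_shift M (i, j) + (\<kappa> (i, j) + \<zeta> i)) * expected_awards (i, j))"
  proof (rule sum_mono)
    fix j assume j: "j \<in> ?J"
    then show "- exp (t j) * fst x i \<le> price_sens M * expected_payment (i, j)
      - (cost_shift M (i, j) + (\<kappa> (i, j) + \<zeta> i)) * expected_awards (i, j)"
      using lane_payment_bound[of "(i, j)" "t j"] t[OF j] by (simp add: destinations_def)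
  qed
  also have "\<dots> = price_sens M * (\<Sum>j\<in>?J. expected_payment (i, j))
      - (\<Sum>j\<in>?J. (cost_shift M (i, j) + \<kappa> (i, j)) * expected_awards (i, j))
      - \<zeta> i * (\<Sum>j\<in>?J. expected_awards (i, j))"
    by (simp add: sum_subtractf sum_distrib_left algebra_simps sum.distrib)
  finally show ?thesis by (simp add: algebra_simps)
qed

lemma expected_awards_nonneg: "0 \<le> expected_awards e"
  unfolding expected_awards_def lane_awards_def by (intro integral_nonneg_AE AE_I2) auto

lemma lane_awards_le_loads: "e \<in> lanes M \<Longrightarrow> lane_awards e \<omega> \<le> snd x e"
  unfolding lane_awards_def awarded_set_def
proof (rule measure_pmf.integral_le_const)
  assume e: "e \<in> lanes M"
  let ?N = "bidders M a x \<omega> e"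
  let ?p = "award a e ?N (true_bids M \<omega> e ?N)"
  have W: "W \<subseteq> ?N \<and> card W \<le> snd x e" if "W \<in> set_pmf ?p" for W
    using feasible[OF e bidders_subset that] .
  show "integrable ?p (\<lambda>W. real (card W))"
    by (rule measure_pmf.integrable_const_bound[where B = "snd x e"]) (use W in \<open>auto intro!: AE_pmfI\<close>)
  show "AE W in ?p. real (card W) \<le> snd x e" using W by (auto intro!: AE_pmfI)
qed

lemma expected_awards_le_loads: "e \<in> lanes M \<Longrightarrow> expected_awards e \<le> snd x e"
  unfolding expected_awards_def
  by (rule shocks.integral_le_const) (auto intro!: integrable_lane_awards lane_awards_le_loads AE_I2)

lemma expected_awards_le_bidders: "e \<in> lanes M \<Longrightarrow> expected_awards e \<le> fst x (fst e) * lane_prob e"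
  unfolding expected_bidders[symmetric] expected_awards_eq
proof (rule sum_mono, clarify)
  fix N s assume e: "e \<in> lanes M" and N: "N \<subseteq> {..<fst x (fst e)}" "s \<in> N"
  have "shocks.expectation (award_on e N s) \<le> (\<integral>\<omega>. indicator (bidding_event e N) \<omega> \<partial>shock_law x)"
    using award_prob_bounds sets_bidding_event[OF N(1)]
    by (intro integral_mono integrable_award_on e N integrable_real_indicator)
       (auto simp: award_on_def indicator_def shocks.emeasure_eq_measure)
  then show "shocks.expectation (award_on e N s) \<le> shocks.prob (bidding_event e N)"
    using sets_bidding_event[OF N(1)] by simp
qed

lemma node_awards_le_carriers: "(\<Sum>j\<in>destinations M i. expected_awards (i, j)) \<le> fst x i"
proof -
  have "(\<Sum>j\<in>destinations M i. expected_awards (i, j)) \<le> (\<Sum>j\<in>destinations M i. fst x i * lane_prob (i, j))"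
    using expected_awards_le_bidders by (intro sum_mono) (force simp: destinations_def)
  also have "\<dots> = fst x i" by (simp add: sum_distrib_left[symmetric] sum_lane_prob)
  finally show ?thesis .
qed

lemma period_profit_eq:
  "period_profit M a x = (\<Sum>e\<in>lanes M. shipper_price a e * demand M e (shipper_price a e)
     - penalty M e * (snd x e - expected_awards e) - expected_payment e)"
  unfolding period_profit_def lane_payment_def[symmetric] lane_awards_def[symmetric]
    expected_payment_def expected_awards_def
  using integrable_lane_payment integrable_lane_awards
  by (subst Bochner_Integration.integral_sum) (auto simp: shocks.prob_space)

end

section \<open>Transitions of the state\<close>

lemma nn_integral_binomial_pmf:
  assumes "0 \<le> p" "p \<le> 1"
  shows "(\<integral>\<^sup>+k. ennreal (real k) \<partial>binomial_pmf n p) = ennreal (real n * p)"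
proof -
  have "(\<integral>\<^sup>+k. ennreal (real k) \<partial>binomial_pmf n p) = ennreal (measure_pmf.expectation (binomial_pmf n p) real)"
    using assms by (intro nn_integral_eq_integral) auto
  also have "measure_pmf.expectation (binomial_pmf n p) real = (\<Sum>k\<le>n. real k * Bernstein n k p)"
    using assms by (subst expectation_binomial_pmf') (auto simp: Bernstein_def mult_ac)
  also have "\<dots> = real n * p" by (rule sum_k_Bernstein)
  finally show ?thesis .
qed

lemma nn_integral_poisson_law:
  assumes "0 \<le> m"
  shows "(\<integral>\<^sup>+k. ennreal (real k) \<partial>poisson_law m) = ennreal m"
proof (cases "m = 0")
  case False
  then have m: "0 < m" using assms by simp
  have "(\<lambda>n. m ^ n /\<^sub>R fact n) sums exp m" by (rule exp_converges)
  then have "(\<lambda>n. (m * exp (- m)) * (m ^ n /\<^sub>R fact n)) sums ((m * exp (- m)) * exp m)"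
    by (rule sums_mult)
  then have "(\<lambda>n. real (Suc n) * (m ^ Suc n / fact (Suc n) * exp (- m))) sums m"
    by (simp add: exp_minus field_simps del: of_nat_Suc)
  then have s: "(\<lambda>n. real n * (m ^ n / fact n * exp (- m))) sums m"
    by (subst (asm) sums_Suc_iff) simp
  have "(\<integral>\<^sup>+k. ennreal (real k) \<partial>poisson_law m)
      = (\<integral>\<^sup>+k. ennreal (real k * (m ^ k / fact k * exp (- m))) \<partial>count_space UNIV)"
    using m by (simp add: poisson_law_def nn_integral_measure_pmf ennreal_mult[symmetric] mult.commute)
  also have "\<dots> = ennreal m"
    unfolding nn_integral_count_space_nat using m by (intro suminf_ennreal_eq s) auto
  finally show ?thesis .
qed (simp add: poisson_law_def)

lemma nn_integral_Pi_pmf_component: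
  assumes "finite A" "x \<in> A"
  shows "(\<integral>\<^sup>+f. g (f x) \<partial>Pi_pmf A d p) = (\<integral>\<^sup>+y. g y \<partial>p x)"
proof -
  have "(\<integral>\<^sup>+f. g (f x) \<partial>Pi_pmf A d p) = (\<integral>\<^sup>+y. g y \<partial>map_pmf (\<lambda>f. f x) (Pi_pmf A d p))"
    by simp
  also have "map_pmf (\<lambda>f. f x) (Pi_pmf A d p) = p x" using assms by (simp add: Pi_pmf_component)
  finally show ?thesis .
qed

lemma measurable_pmf_bind:
  fixes K :: "'w \<Rightarrow> 'b::countable pmf"
  assumes "\<And>y. (\<lambda>\<omega>. pmf (K \<omega>) y) \<in> borel_measurable P"
  shows "(\<lambda>\<omega>. pmf (bind_pmf (K \<omega>) f) z) \<in> borel_measurable P"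
proof -
  have "(\<lambda>\<omega>. \<integral>\<^sup>+y. ennreal (pmf (K \<omega>) y) * ennreal (pmf (f y) z) \<partial>count_space UNIV) \<in> borel_measurable P"
  proof (intro sigma_finite_measure.borel_measurable_nn_integral sigma_finite_measure_count_space_countable)
    have "(\<lambda>z. ennreal (pmf (K (fst z)) (snd z)) * ennreal (pmf (f (snd z)) z')) \<in> borel_measurable (P \<Otimes>\<^sub>M count_space UNIV)"
      for z'
      by (rule measurable_compose_countable[where f = "\<lambda>y z. ennreal (pmf (K (fst z)) y) * ennreal (pmf (f y) z')" and g = snd])
         (use measurable_compose[OF measurable_fst assms] in measurable)
    then show "(\<lambda>(\<omega>, y). ennreal (pmf (K \<omega>) y) * ennreal (pmf (f y) z)) \<in> borel_measurable (P \<Otimes>\<^sub>M count_space UNIV)"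
      by (simp add: split_beta')
  qed simp
  then have "(\<lambda>\<omega>. enn2real (\<integral>\<^sup>+y. ennreal (pmf (K \<omega>) y) * ennreal (pmf (f y) z) \<partial>count_space UNIV)) \<in> borel_measurable P"
    by measurable
  moreover have "enn2real (\<integral>\<^sup>+y. ennreal (pmf (K \<omega>) y) * ennreal (pmf (f y) z) \<partial>count_space UNIV)
     = pmf (bind_pmf (K \<omega>) f) z" for \<omega>
    unfolding nn_integral_measure_pmf[symmetric] ennreal_pmf_bind[symmetric] by simp
  ultimately show ?thesis by simp
qed

text \<open>
  The transition law is a mixture that is defined pointwise on states. On a countable type the
  pointwise mixture is again a probability mass function, and its integrals are mixtures of
  integrals.
\<close>

lemma nn_integral_mixture_pmf:
  fixes K :: "'w \<Rightarrow> 'b::countable pmf"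
  assumes "prob_space P" and [measurable]: "\<And>y. (\<lambda>\<omega>. pmf (K \<omega>) y) \<in> borel_measurable P"
  shows "(\<integral>\<^sup>+y. g y \<partial>embed_pmf (\<lambda>y. \<integral>\<omega>. pmf (K \<omega>) y \<partial>P)) = (\<integral>\<^sup>+\<omega>. \<integral>\<^sup>+y. g y \<partial>K \<omega> \<partial>P)"
proof -
  interpret prob_space P by fact
  let ?m = "\<lambda>y. \<integral>\<omega>. pmf (K \<omega>) y \<partial>P"
  have m0: "0 \<le> ?m y" for y by (intro integral_nonneg_AE) auto
  have m: "ennreal (?m y) = (\<integral>\<^sup>+\<omega>. ennreal (pmf (K \<omega>) y) \<partial>P)" for y
    by (intro nn_integral_eq_integral[symmetric] integrable_const_bound[where B = 1]) (auto simp: pmf_le_1)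
  have sw: "(\<integral>\<^sup>+y. ennreal (?m y) * g y \<partial>count_space UNIV)
     = (\<integral>\<^sup>+\<omega>. \<integral>\<^sup>+y. ennreal (pmf (K \<omega>) y) * g y \<partial>count_space UNIV \<partial>P)" for g
    unfolding m
    by (subst nn_integral_count_space_nn_integral) (auto simp: nn_integral_multc)
  have "(\<integral>\<^sup>+y. ennreal (?m y) \<partial>count_space UNIV) = 1"
    using sw[of "\<lambda>_. 1"] by (simp add: nn_integral_pmf emeasure_space_1)
  then have p: "pmf (embed_pmf ?m) y = ?m y" for y
    by (intro pmf_embed_pmf m0)
  show ?thesis unfolding nn_integral_measure_pmf p by (rule sw)
qed

context market_period
begin

lemma stay_prob_bounds: "e \<in> lanes M \<Longrightarrow> 0 < stay_prob M e \<and> stay_prob M e < 1"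
  using market by (simp add: valid_market_def)

lemma demand_nonneg: "e \<in> lanes M \<Longrightarrow> 0 \<le> demand M e (shipper_price a e)"
  using market action by (auto simp: valid_market_def valid_action_def)

lemma awarded_subset: "e \<in> lanes M \<Longrightarrow> W \<in> set_pmf (awarded_set M a x \<omega> e) \<Longrightarrow> W \<subseteq> {..<fst x (fst e)}"
  using feasible[OF _ bidders_subset] bidders_subset unfolding awarded_set_def by blast

lemma measurable_awarded_set:
  assumes e: "e \<in> lanes M"
  shows "(\<lambda>\<omega>. pmf (awarded_set M a x \<omega> e) W) \<in> borel_measurable (shock_law x)"
proof -
  let ?P = "Pow {..<fst x (fst e)}"
  have "pmf (awarded_set M a x \<omega> e) W
      = (\<Sum>N\<in>?P. indicator (bidding_event e N) \<omega> * pmf (award a e N (true_bids M \<omega> e N)) W)"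
    if \<omega>: "\<omega> \<in> space (shock_law x)" for \<omega>
  proof -
    have "(\<Sum>N\<in>?P. indicator (bidding_event e N) \<omega> * pmf (award a e N (true_bids M \<omega> e N)) W)
        = (\<Sum>N\<in>?P. if N = bidders M a x \<omega> e then pmf (award a e N (true_bids M \<omega> e N)) W else 0)"
      using \<omega> by (intro sum.cong) (auto simp: bidding_event_def)
    also have "\<dots> = pmf (awarded_set M a x \<omega> e) W"
      unfolding awarded_set_def using bidders_subset by (subst sum.delta) auto
    finally show ?thesis by simp
  qed
  moreover have "(\<lambda>\<omega>. \<Sum>N\<in>?P. indicator (bidding_event e N) \<omega> * pmf (award a e N (true_bids M \<omega> e N)) W)
      \<in> borel_measurable (shock_law x)"
    using e by (intro borel_measurable_sum borel_measurable_times borel_measurable_indicator sets_bidding_event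
      measurable_compose[OF measurable_own_true_bids measurable_award_pmf]) auto
  ultimately show ?thesis by (subst measurable_cong) auto
qed

lemma measurable_staying_law:
  assumes e: "e \<in> lanes M"
  shows "(\<lambda>\<omega>. pmf (staying_law M a x \<omega> e) z) \<in> borel_measurable (shock_law x)"
proof -
  have "pmf (staying_law M a x \<omega> e) z
     = (\<Sum>W\<in>Pow {..<fst x (fst e)}. pmf (binomial_pmf (card W) (stay_prob M e)) z * pmf (awarded_set M a x \<omega> e) W)" for \<omega>
    unfolding staying_law_def pmf_bind
    by (rule integral_measure_pmf_real) (use awarded_subset[OF e] in auto)
  then show ?thesis
    by (simp add: measurable_awarded_set[OF e] borel_measurable_sum borel_measurable_times)
qed

lemma measurable_next_state: "(\<lambda>\<omega>. pmf (next_state_given M a x \<omega>) x') \<in> borel_measurable (shock_law x)"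
  unfolding next_state_given_def
proof (rule measurable_pmf_bind)
  fix Z :: "'n lane \<Rightarrow> nat"
  have f: "finite (lanes M)" by simp
  show "(\<lambda>\<omega>. pmf (Pi_pmf (lanes M) 0 (staying_law M a x \<omega>)) Z) \<in> borel_measurable (shock_law x)"
    unfolding pmf_Pi[OF f] using measurable_staying_law
    by (cases "\<forall>e. e \<notin> lanes M \<longrightarrow> Z e = 0") (auto intro!: borel_measurable_prod)
qed

lemma nn_integral_transition:
  "(\<integral>\<^sup>+x'. g x' \<partial>transition M a x) = (\<integral>\<^sup>+\<omega>. \<integral>\<^sup>+x'. g x' \<partial>next_state_given M a x \<omega> \<partial>shock_law x)"
  unfolding transition_def
  by (rule nn_integral_mixture_pmf[OF shocks.prob_space_axioms measurable_next_state])

lemma nn_integral_staying_law: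
  assumes e: "e \<in> lanes M"
  shows "(\<integral>\<^sup>+z. ennreal (real z) \<partial>staying_law M a x \<omega> e) = ennreal (stay_prob M e * lane_awards e \<omega>)"
proof -
  have fin: "finite (set_pmf (awarded_set M a x \<omega> e))"
    by (rule finite_subset[of _ "Pow {..<fst x (fst e)}"]) (use awarded_subset[OF e] in auto)
  have q: "0 \<le> stay_prob M e" "stay_prob M e \<le> 1" using stay_prob_bounds[OF e] by auto
  have "(\<integral>\<^sup>+z. ennreal (real z) \<partial>staying_law M a x \<omega> e)
      = (\<integral>\<^sup>+W. ennreal (real (card W) * stay_prob M e) \<partial>awarded_set M a x \<omega> e)"
    unfolding staying_law_def nn_integral_bind_pmf by (simp add: nn_integral_binomial_pmf q)
  also have "\<dots> = ennreal (measure_pmf.expectation (awarded_set M a x \<omega> e) (\<lambda>W. real (card W) * stay_prob M e))"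
    using q by (intro nn_integral_eq_integral integrable_measure_pmf_finite fin) auto
  finally show ?thesis by (simp add: lane_awards_def mult.commute)
qed

lemma lane_awards_nonneg: "0 \<le> lane_awards e \<omega>"
  unfolding lane_awards_def by (intro integral_nonneg_AE AE_I2) auto

lemma arrival_rate_pos: "0 < arrival_rate M j"
  using market by (simp add: valid_market_def)

lemma next_loads:
  assumes e: "e \<in> lanes M"
  shows "(\<integral>\<^sup>+x'. ennreal (real (snd x' e)) \<partial>transition M a x) = ennreal (demand M e (shipper_price a e))"
proof -
  have "(\<integral>\<^sup>+D. ennreal (real (D e)) \<partial>Pi_pmf (lanes M) 0 (\<lambda>e. poisson_law (demand M e (shipper_price a e))))
      = ennreal (demand M e (shipper_price a e))"
    using nn_integral_Pi_pmf_component[where A = "lanes M" and x = e and g = "\<lambda>k. ennreal (real k)"] e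
    by (simp add: nn_integral_poisson_law demand_nonneg)
  then have "(\<integral>\<^sup>+x'. ennreal (real (snd x' e)) \<partial>next_state_given M a x \<omega>) = ennreal (demand M e (shipper_price a e))" for \<omega>
    unfolding next_state_given_def by (simp add: nn_integral_bind_pmf)
  then show ?thesis by (simp add: nn_integral_transition shocks.emeasure_space_1)
qed

lemma next_carriers:
  "(\<integral>\<^sup>+x'. ennreal (real (fst x' j)) \<partial>transition M a x)
     = ennreal ((\<Sum>i | (i, j) \<in> lanes M. stay_prob M (i, j) * expected_awards (i, j)) + arrival_rate M j)"
proof -
  let ?I = "{i. (i, j) \<in> lanes M}"
  have q: "0 \<le> stay_prob M (i, j) * lane_awards (i, j) \<omega>" if "i \<in> ?I" for i \<omega>
    using that stay_prob_bounds[of "(i, j)"] lane_awards_nonneg by auto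
  have "(\<integral>\<^sup>+x'. ennreal (real (fst x' j)) \<partial>next_state_given M a x \<omega>)
      = ennreal ((\<Sum>i\<in>?I. stay_prob M (i, j) * lane_awards (i, j) \<omega>) + arrival_rate M j)" for \<omega>
  proof -
    have "(\<integral>\<^sup>+x'. ennreal (real (fst x' j)) \<partial>next_state_given M a x \<omega>)
      = (\<integral>\<^sup>+Z. \<integral>\<^sup>+L. (\<Sum>i\<in>?I. ennreal (real (Z (i, j)))) + ennreal (real (L j))
           \<partial>Pi_pmf UNIV 0 (\<lambda>j. poisson_law (arrival_rate M j)) \<partial>Pi_pmf (lanes M) 0 (staying_law M a x \<omega>))"
      unfolding next_state_given_def nn_integral_bind_pmf nn_integral_return_pmf fst_conv
      by (simp add: ennreal_plus sum_nonneg)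
    also have "\<dots> = (\<Sum>i\<in>?I. \<integral>\<^sup>+Z. ennreal (real (Z (i, j))) \<partial>Pi_pmf (lanes M) 0 (staying_law M a x \<omega>))
        + (\<integral>\<^sup>+L. ennreal (real (L j)) \<partial>Pi_pmf UNIV 0 (\<lambda>j. poisson_law (arrival_rate M j)))"
      by (simp add: nn_integral_add nn_integral_sum del: sum_ennreal)
    also have "(\<Sum>i\<in>?I. \<integral>\<^sup>+Z. ennreal (real (Z (i, j))) \<partial>Pi_pmf (lanes M) 0 (staying_law M a x \<omega>))
        = (\<Sum>i\<in>?I. ennreal (stay_prob M (i, j) * lane_awards (i, j) \<omega>))"
      using nn_integral_Pi_pmf_component[where A = "lanes M" and g = "\<lambda>k. ennreal (real k)"]
      by (intro sum.cong refl) (simp add: nn_integral_staying_law)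
    also have "(\<integral>\<^sup>+L. ennreal (real (L j)) \<partial>Pi_pmf UNIV 0 (\<lambda>j. poisson_law (arrival_rate M j)))
        = ennreal (arrival_rate M j)"
      using arrival_rate_pos[of j] nn_integral_Pi_pmf_component[where A = UNIV and x = j and g = "\<lambda>k. ennreal (real k)"]
      by (simp add: nn_integral_poisson_law)
    also have "(\<Sum>i\<in>?I. ennreal (stay_prob M (i, j) * lane_awards (i, j) \<omega>)) + ennreal (arrival_rate M j)
        = ennreal ((\<Sum>i\<in>?I. stay_prob M (i, j) * lane_awards (i, j) \<omega>) + arrival_rate M j)"
    proof -
      have "0 \<le> (\<Sum>i\<in>?I. stay_prob M (i, j) * lane_awards (i, j) \<omega>)" by (intro sum_nonneg q)
      moreover have "(\<Sum>i\<in>?I. ennreal (stay_prob M (i, j) * lane_awards (i, j) \<omega>))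
          = ennreal (\<Sum>i\<in>?I. stay_prob M (i, j) * lane_awards (i, j) \<omega>)"
        by (intro sum_ennreal q)
      ultimately show ?thesis using arrival_rate_pos[of j] by (simp only: ennreal_plus less_imp_le)
    qed
    finally show ?thesis .
  qed
  then have "(\<integral>\<^sup>+x'. ennreal (real (fst x' j)) \<partial>transition M a x)
     = (\<integral>\<^sup>+\<omega>. ennreal ((\<Sum>i\<in>?I. stay_prob M (i, j) * lane_awards (i, j) \<omega>) + arrival_rate M j) \<partial>shock_law x)"
    by (simp add: nn_integral_transition)
  also have "\<dots> = ennreal (\<integral>\<omega>. ((\<Sum>i\<in>?I. stay_prob M (i, j) * lane_awards (i, j) \<omega>) + arrival_rate M j) \<partial>shock_law x)"
    using integrable_lane_awards q arrival_rate_pos[of j]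
    by (intro nn_integral_eq_integral) (auto intro!: add_nonneg_nonneg sum_nonneg Bochner_Integration.integrable_sum)
  also have "(\<integral>\<omega>. ((\<Sum>i\<in>?I. stay_prob M (i, j) * lane_awards (i, j) \<omega>) + arrival_rate M j) \<partial>shock_law x)
      = (\<Sum>i\<in>?I. stay_prob M (i, j) * expected_awards (i, j)) + arrival_rate M j"
    unfolding expected_awards_def using integrable_lane_awards
    by (subst Bochner_Integration.integral_add) (auto simp: shocks.prob_space intro!: Bochner_Integration.integral_sum[THEN trans] sum.cong)
  finally show ?thesis .
qed

end

section \<open>Jensen for revenue\<close>

text \<open>
  The set \<open>S\<close> may be any convex set of reals. If the mean is an interior point, there is a supporting
  line; otherwise all values of \<open>X\<close> lie on one side of the mean and \<open>X\<close> is constant.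
\<close>

lemma jensen_concave_pmf:
  fixes X :: "'a \<Rightarrow> real" and f :: "real \<Rightarrow> real"
  assumes X: "integrable (measure_pmf p) X" and fX: "integrable (measure_pmf p) (\<lambda>x. f (X x))"
    and S: "\<And>x. X x \<in> S" and conc: "concave_on S f"
  shows "measure_pmf.expectation p X \<in> S"
    and "measure_pmf.expectation p (\<lambda>x. f (X x)) \<le> f (measure_pmf.expectation p X)"
proof -
  let ?m = "measure_pmf.expectation p X"
  have conv: "convex_on S (\<lambda>z. - f z)" using conc by (simp add: concave_on_def)
  then have cS: "convex S" by (rule convex_on_imp_convex)
  have "?m \<in> S \<and> measure_pmf.expectation p (\<lambda>x. f (X x)) \<le> f ?m"
  proof (cases "(\<exists>a\<in>S. a < ?m) \<and> (\<exists>b\<in>S. ?m < b)")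
    case True
    then obtain a b where ab: "a \<in> S" "b \<in> S" "a < ?m" "?m < b" by auto
    then have "closed_segment a b \<subseteq> S" using cS by (intro closed_segment_subset)
    then have sub: "{a..b} \<subseteq> S" using ab by (simp add: closed_segment_eq_real_ivl)
    have int: "?m \<in> interior S"
      by (rule interiorI[of "{a<..<b}"]) (use ab sub in auto)
    define k where "k = Inf ((\<lambda>t. (- f ?m - - f t) / (?m - t)) ` ({?m<..} \<inter> S))"
    have le: "f (X x) \<le> f ?m - k * (X x - ?m)" for x
      using convex_le_Inf_differential[OF conv int S[of x]] by (simp add: k_def)
    have "measure_pmf.expectation p (\<lambda>x. f (X x)) \<le> measure_pmf.expectation p (\<lambda>x. f ?m - k * (X x - ?m))"
      using X fX le by (intro integral_mono) auto
    also have "\<dots> = f ?m" using X by simp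
    finally show ?thesis using int interior_subset by blast
  next
    case False
    have "AE x in p. X x = ?m"
    proof (cases "\<exists>a\<in>S. a < ?m")
      case True
      then have "X x \<le> ?m" for x using False S(1)[of x] by (meson not_le)
      then have "AE x in p. ?m - X x = 0"
        using X by (subst integral_nonneg_eq_0_iff_AE[symmetric]) auto
      then show ?thesis by auto
    next
      case no: False
      then have "?m \<le> X x" for x using S(1)[of x] by (meson not_le)
      then have "AE x in p. X x - ?m = 0"
        using X by (subst integral_nonneg_eq_0_iff_AE[symmetric]) auto
      then show ?thesis by auto
    qed
    then have eq: "x \<in> set_pmf p \<Longrightarrow> X x = ?m" for x by (simp add: AE_measure_pmf_iff)
    then have "?m \<in> S" using S set_pmf_not_empty[of p] by (metis equals0I)
    moreover have "measure_pmf.expectation p (\<lambda>x. f (X x)) = measure_pmf.expectation p (\<lambda>x. f ?m)"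
      by (intro integral_cong_AE) (auto intro!: AE_pmfI simp: eq)
    ultimately show ?thesis by simp
  qed
  then show "?m \<in> S" "measure_pmf.expectation p (\<lambda>x. f (X x)) \<le> f ?m" by auto
qed

text \<open>
  If a concave function decreased between two points, it would decrease at least linearly from
  there on, and integrability of \<open>f \<circ> X\<close> would carry over to \<open>X\<close>.
\<close>

lemma concave_mono_if_heavy_tail:
  fixes X :: "'a \<Rightarrow> real" and f :: "real \<Rightarrow> real"
  assumes X: "\<not> integrable (measure_pmf p) X" and fX: "integrable (measure_pmf p) (\<lambda>x. f (X x))"
    and S: "\<And>x. X x \<in> S" "\<And>z. z \<in> S \<Longrightarrow> 0 \<le> z" and conc: "concave_on S f"
  shows "\<And>y z. y \<in> S \<Longrightarrow> z \<in> S \<Longrightarrow> y \<le> z \<Longrightarrow> f y \<le> f z" and "\<exists>z\<in>S. u \<le> z"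
proof -
  show "\<exists>z\<in>S. u \<le> z"
  proof (rule ccontr)
    assume "\<not> ?thesis"
    then have "norm (X x) \<le> u" for x using S(1)[of x] S(2)[of "X x"] by (auto simp: not_le intro: less_imp_le)
    then have "AE x in p. norm (X x) \<le> u" by simp
    then have "integrable (measure_pmf p) X" by (intro measure_pmf.integrable_const_bound[where B = u]) auto
    then show False using X by simp
  qed
next
  fix y z assume y: "y \<in> S" and z: "z \<in> S" and yz: "y \<le> z"
  show "f y \<le> f z"
  proof (rule ccontr)
    assume "\<not> f y \<le> f z"
    then have lt: "f z < f y" and yz': "y < z" using yz by (auto simp: not_le dest: order_le_imp_less_or_eq)
    define k where "k = (f y - f z) / (z - y)"
    have k: "0 < k" using lt yz' by (simp add: k_def)
    have "X x \<le> z + \<bar>f z - f (X x)\<bar> / k" for x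
    proof (cases "X x \<le> z")
      case True
      have "0 \<le> \<bar>f z - f (X x)\<bar> / k" using k by simp
      then show ?thesis using True by linarith
    next
      case False
      define c where "c = X x"
      have c: "z < c" "c \<in> S" using False S by (auto simp: c_def)
      define t where "t = (z - y) / (c - y)"
      have t: "0 \<le> t" "t \<le> 1" using c yz' by (auto simp: t_def)
      have cy: "c - y > 0" using c yz' by simp
      have "(1 - t) *\<^sub>R y + t *\<^sub>R c = y + t * (c - y)" by (simp add: algebra_simps)
      also have "\<dots> = z" using cy by (simp add: t_def)
      finally have zz: "(1 - t) *\<^sub>R y + t *\<^sub>R c = z" .
      have "(1 - t) * f y + t * f c \<le> f ((1 - t) *\<^sub>R y + t *\<^sub>R c)"
        using concave_onD[OF conc t y c(2)] by simp
      then have "f y + t * (f c - f y) \<le> f z" unfolding zz by (simp add: algebra_simps)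
      then have "(f y - f z) \<le> t * (f y - f c)" by (simp add: algebra_simps)
      then have "(f y - f z) * (c - y) \<le> (z - y) * (f y - f c)"
        using cy by (simp add: t_def field_simps)
      then have "(f y - f z) * (c - z) \<le> (z - y) * (f z - f c)" by (simp add: algebra_simps)
      then have "k * (c - z) \<le> f z - f c" using yz' by (simp add: k_def field_simps)
      then have "c - z \<le> (f z - f c) / k" using k by (simp add: field_simps)
      also have "\<dots> \<le> \<bar>f z - f c\<bar> / k" using k by (intro divide_right_mono) auto
      finally show ?thesis by (simp add: c_def)
    qed
    then have bound: "norm (X x) \<le> norm (z + \<bar>f z - f (X x)\<bar> / k)" for x
      using S(2)[OF S(1)[of x]] by (simp add: order_trans[OF _ abs_ge_self])
    have "integrable (measure_pmf p) (\<lambda>x. z + \<bar>f z - f (X x)\<bar> / k)"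
      using fX by (intro Bochner_Integration.integrable_add integrable_const integrable_divide integrable_abs
        Bochner_Integration.integrable_diff measure_pmf.finite_measure_axioms) auto
    then have "integrable (measure_pmf p) X"
      by (rule Bochner_Integration.integrable_bound) (use bound in auto)
    then show False using X by simp
  qed
qed

text \<open>
  The number \<open>d\<close> stands for the time average of the demand rates and \<open>low\<close> for that of the
  awards. If some mean is infinite, no average exists and \<open>f\<close> is nondecreasing, so \<open>d\<close> is taken
  large enough to come within \<open>\<epsilon>\<close> of the supremum of \<open>f\<close>.
\<close>

lemma average_revenue_attained:
  fixes X :: "'a \<Rightarrow> real" and f :: "real \<Rightarrow> real" and p :: "nat \<Rightarrow> 'a pmf"
  assumes n: "0 < n" and fX: "\<And>t. t < n \<Longrightarrow> integrable (measure_pmf (p t)) (\<lambda>x. f (X x))"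
    and S: "\<And>x. X x \<in> S" "\<And>z. z \<in> S \<Longrightarrow> 0 \<le> z" and conc: "concave_on S f" and bdd: "bdd_above (f ` S)"
    and b: "b \<noteq> 0 \<Longrightarrow> (\<forall>t<n. integrable (measure_pmf (p t)) X)"
    and low: "(\<forall>t<n. integrable (measure_pmf (p t)) X) \<Longrightarrow> real n * low \<le> (\<Sum>t<n. measure_pmf.expectation (p t) X)"
    and eps: "0 < \<epsilon>"
  obtains d where "d \<in> S" "low \<le> d"
    "(\<Sum>t<n. measure_pmf.expectation (p t) (\<lambda>x. f (X x))) \<le> real n * (f d + \<epsilon>)"
    "b * (real n * d) = b * (\<Sum>t<n. measure_pmf.expectation (p t) X)"
proof (cases "\<forall>t<n. integrable (measure_pmf (p t)) X")
  case True
  define m where "m = (\<lambda>t. measure_pmf.expectation (p t) X)"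
  define d where "d = (\<Sum>t<n. (1 / real n) *\<^sub>R m t)"
  have nz: "real n \<noteq> 0" using n by simp
  have m: "m t \<in> S" "measure_pmf.expectation (p t) (\<lambda>x. f (X x)) \<le> f (m t)" if "t < n" for t
    unfolding m_def using jensen_concave_pmf[OF _ fX[OF that] S(1) conc] True that by auto
  have cS: "convex S" using conc convex_on_imp_convex unfolding concave_on_def by blast
  have d: "real n * d = (\<Sum>t<n. m t)" using nz by (simp add: d_def sum_divide_distrib[symmetric])
  show ?thesis
  proof (rule that)
    show "d \<in> S" unfolding d_def using n m(1) by (intro convex_sum[OF _ cS]) auto
    show "low \<le> d" using low[OF True] n unfolding m_def[symmetric] d[symmetric] by simp
    have "(\<Sum>t<n. (1 / real n) * f (m t)) \<le> f d"
      unfolding d_def using n m(1) by (intro concave_on_sum[OF _ _ conc]) auto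
    then have "(\<Sum>t<n. f (m t)) \<le> real n * f d" using n by (simp add: sum_divide_distrib[symmetric] field_simps)
    moreover have "(\<Sum>t<n. measure_pmf.expectation (p t) (\<lambda>x. f (X x))) \<le> (\<Sum>t<n. f (m t))"
      using m(2) by (intro sum_mono) auto
    moreover have "real n * f d \<le> real n * (f d + \<epsilon>)" using eps by (intro mult_left_mono) auto
    ultimately show "(\<Sum>t<n. measure_pmf.expectation (p t) (\<lambda>x. f (X x))) \<le> real n * (f d + \<epsilon>)" by linarith
    show "b * (real n * d) = b * (\<Sum>t<n. measure_pmf.expectation (p t) X)" unfolding d m_def ..
  qed
next
  case False
  then obtain s where s: "s < n" "\<not> integrable (measure_pmf (p s)) X" by auto
  have mono: "f y \<le> f z" if "y \<in> S" "z \<in> S" "y \<le> z" for y z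
    by (rule concave_mono_if_heavy_tail(1)[OF s(2) fX[OF s(1)] S(1) _ conc that]) (rule S(2))
  have unbounded: "\<exists>z\<in>S. u \<le> z" for u
    by (rule concave_mono_if_heavy_tail(2)[OF s(2) fX[OF s(1)] S(1) _ conc]) (rule S(2))
  have ne: "f ` S \<noteq> {}" using S(1) by auto
  obtain d1 where d1: "d1 \<in> S" "Sup (f ` S) - \<epsilon> < f d1"
    using less_cSup_iff[OF ne bdd, of "Sup (f ` S) - \<epsilon>"] eps by auto
  obtain d where d: "d \<in> S" "max d1 low \<le> d" using unbounded by blast
  have fd: "f d1 \<le> f d" using mono[OF d1(1) d(1)] d(2) by simp
  have "measure_pmf.expectation (p t) (\<lambda>x. f (X x)) \<le> f d + \<epsilon>" if "t < n" for t
  proof (rule measure_pmf.integral_le_const[OF fX[OF that]])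
    have "f (X x) \<le> Sup (f ` S)" for x using S bdd by (intro cSup_upper) auto
    then have "f (X x) \<le> f d + \<epsilon>" for x using d1(2) fd by (smt (verit))
    then show "AE x in p t. f (X x) \<le> f d + \<epsilon>" by simp
  qed
  then have "(\<Sum>t<n. measure_pmf.expectation (p t) (\<lambda>x. f (X x))) \<le> (\<Sum>t<n. f d + \<epsilon>)"
    by (intro sum_mono) auto
  moreover have "b = 0" using b False by blast
  ultimately show ?thesis using that[of d] d by simp
qed

section \<open>Trajectories under a policy\<close>

lemma sum_lanes_by_origin:
  fixes f :: "'n::finite \<times> 'n \<Rightarrow> real"
  shows "(\<Sum>e\<in>lanes M. f e) = (\<Sum>i\<in>UNIV. \<Sum>j\<in>destinations M i. f (i, j))"
proof -
  have "(\<Sum>i\<in>UNIV. \<Sum>j\<in>{j. (i, j) \<in> lanes M}. f (i, j)) = (\<Sum>(i, j)\<in>(SIGMA i:UNIV. {j. (i, j) \<in> lanes M}). f (i, j))"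
    by (rule sum.Sigma) auto
  moreover have "(SIGMA i:UNIV. {j. (i, j) \<in> lanes M}) = lanes M" by auto
  ultimately show ?thesis by (simp add: destinations_def split_beta')
qed

lemma sum_lanes_by_destination:
  fixes f :: "'n::finite \<times> 'n \<Rightarrow> real"
  shows "(\<Sum>e\<in>lanes M. f e) = (\<Sum>j\<in>UNIV. \<Sum>i | (i, j) \<in> lanes M. f (i, j))"
proof -
  have "(\<Sum>j\<in>UNIV. \<Sum>i\<in>{i. (i, j) \<in> lanes M}. f (i, j)) = (\<Sum>(j, i)\<in>(SIGMA j:UNIV. {i. (i, j) \<in> lanes M}). f (i, j))"
    by (rule sum.Sigma) auto
  also have "\<dots> = (\<Sum>e\<in>lanes M. f e)"
    by (rule sum.reindex_bij_witness[of _ "\<lambda>(i, j). (j, i)" "\<lambda>(j, i). (i, j)"]) auto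
  finally show ?thesis by simp
qed

locale market_policy =
  fixes M :: "'n::finite market" and \<pi> :: "'n policy" and x\<^sub>1 :: "'n state"
  assumes market: "valid_market M" and policy: "\<pi> \<in> policies M"
begin

lemma period: "market_period M (\<pi> x) x"
  using market policy unfolding policies_def mem_Collect_eq by unfold_locales blast+

abbreviation awards :: "'n state \<Rightarrow> 'n lane \<Rightarrow> real" where
  "awards x \<equiv> market_period.expected_awards M (\<pi> x) x"

abbreviation award_flow :: "'n lane \<Rightarrow> 'n state \<Rightarrow> real" where
  "award_flow e \<equiv> \<lambda>x. awards x e"

abbreviation loads :: "'n lane \<Rightarrow> 'n state \<Rightarrow> real" where
  "loads e \<equiv> \<lambda>x. real (snd x e)"

abbreviation pay :: "'n state \<Rightarrow> 'n lane \<Rightarrow> real" where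
  "pay x \<equiv> market_period.expected_payment M (\<pi> x) x"

abbreviation demand_rate :: "'n state \<Rightarrow> 'n lane \<Rightarrow> real" where
  "demand_rate x e \<equiv> demand M e (shipper_price (\<pi> x) e)"

abbreviation dests :: "'n \<Rightarrow> 'n set" where
  "dests \<equiv> destinations M"

definition carrier_count :: "'n state \<Rightarrow> real" where
  "carrier_count x = (\<Sum>i\<in>UNIV. real (fst x i))"

text \<open>
  Index \<open>t\<close> belongs to period \<open>t + 1\<close>; the law at index \<open>0\<close> is concentrated on the initial state.
\<close>

definition state_law :: "nat \<Rightarrow> 'n state pmf" where
  "state_law t = map_pmf hd (history M \<pi> x\<^sub>1 t)"

abbreviation mean :: "nat \<Rightarrow> ('n state \<Rightarrow> real) \<Rightarrow> real" where
  "mean t f \<equiv> measure_pmf.expectation (state_law t) f"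

lemma state_law_0: "state_law 0 = return_pmf x\<^sub>1"
  by (simp add: state_law_def)

lemma state_law_Suc: "state_law (Suc t) = bind_pmf (state_law t) (\<lambda>x. transition M (\<pi> x) x)"
  by (simp add: state_law_def map_bind_pmf bind_map_pmf bind_return_pmf')

lemma carrier_count_nonneg: "0 \<le> carrier_count x"
  by (simp add: carrier_count_def sum_nonneg)

lemma awards_nonneg: "0 \<le> awards x e"
  by (rule market_period.expected_awards_nonneg[OF period])

lemma awards_le_loads: "e \<in> lanes M \<Longrightarrow> awards x e \<le> real (snd x e)"
  by (rule market_period.expected_awards_le_loads[OF period])

lemma sum_awards_le: "(\<Sum>e\<in>lanes M. awards x e) \<le> carrier_count x"
  unfolding sum_lanes_by_origin carrier_count_def
  by (intro sum_mono market_period.node_awards_le_carriers[OF period])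

lemma awards_le_count: "e \<in> lanes M \<Longrightarrow> awards x e \<le> carrier_count x"
  using member_le_sum[of e "lanes M" "awards x"] awards_nonneg sum_awards_le[of x] by fastforce

lemma lane_exists: "lanes M \<noteq> {}"
  using market by (auto simp: valid_market_def)

lemma stay_prob: "e \<in> lanes M \<Longrightarrow> 0 < stay_prob M e \<and> stay_prob M e < 1"
  using market by (simp add: valid_market_def)

lemma arrival_rate: "0 < arrival_rate M j"
  using market by (simp add: valid_market_def)

lemma next_carrier_count:
  "(\<integral>\<^sup>+x'. ennreal (carrier_count x') \<partial>transition M (\<pi> x) x)
    = ennreal ((\<Sum>e\<in>lanes M. stay_prob M e * awards x e) + (\<Sum>j\<in>UNIV. arrival_rate M j))"
proof -
  have nn: "0 \<le> (\<Sum>i | (i, j) \<in> lanes M. stay_prob M (i, j) * awards x (i, j)) + arrival_rate M j" for j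
    using stay_prob arrival_rate[of j] awards_nonneg
    by (intro add_nonneg_nonneg sum_nonneg mult_nonneg_nonneg) (auto intro: less_imp_le)
  have "(\<integral>\<^sup>+x'. ennreal (carrier_count x') \<partial>transition M (\<pi> x) x)
      = (\<integral>\<^sup>+x'. (\<Sum>j\<in>UNIV. ennreal (real (fst x' j))) \<partial>transition M (\<pi> x) x)"
    by (simp add: carrier_count_def)
  also have "\<dots> = (\<Sum>j\<in>UNIV. \<integral>\<^sup>+x'. ennreal (real (fst x' j)) \<partial>transition M (\<pi> x) x)"
    by (rule nn_integral_sum) simp
  also have "\<dots> = (\<Sum>j\<in>UNIV. ennreal ((\<Sum>i | (i, j) \<in> lanes M. stay_prob M (i, j) * awards x (i, j)) + arrival_rate M j))"
    by (simp only: market_period.next_carriers[OF period])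
  also have "\<dots> = ennreal (\<Sum>j\<in>UNIV. (\<Sum>i | (i, j) \<in> lanes M. stay_prob M (i, j) * awards x (i, j)) + arrival_rate M j)"
    by (rule sum_ennreal[OF nn])
  finally show ?thesis unfolding sum_lanes_by_destination by (simp add: sum.distrib)
qed

text \<open>
  Each carrier is still present one period later with probability at most \<open>q\<close>, the largest of the
  staying probabilities, and \<open>q < 1\<close>. So the mean obeys an affine recursion with factor \<open>q\<close>.
\<close>

lemma carrier_count_bounded:
  obtains C where "0 \<le> C" "\<And>t. (\<integral>\<^sup>+x. ennreal (carrier_count x) \<partial>state_law t) \<le> ennreal C"
proof -
  define q where "q = Max (stay_prob M ` lanes M)"
  define L where "L = (\<Sum>j\<in>UNIV. arrival_rate M j)"
  have "q \<in> stay_prob M ` lanes M" unfolding q_def using lane_exists by (intro Max_in) auto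
  then have q: "0 < q" "q < 1" using stay_prob by auto
  have qe: "stay_prob M e \<le> q" if "e \<in> lanes M" for e using that by (simp add: q_def)
  have L: "0 < L" unfolding L_def using arrival_rate by (intro sum_pos) auto
  \<comment> \<open>At least the initial number of carriers and at least the fixed point of the recursion.\<close>
  define C where "C = carrier_count x\<^sub>1 + L / (1 - q)"
  define r where "r = L / (1 - q)"
  have r: "q * r + L = r" using q by (simp add: r_def field_simps)
  have C: "q * C + L \<le> C"
  proof -
    have "q * carrier_count x\<^sub>1 \<le> 1 * carrier_count x\<^sub>1"
      using q carrier_count_nonneg by (intro mult_right_mono) auto
    then show ?thesis using r by (simp add: C_def r_def[symmetric] distrib_left)
  qed
  have C0: "0 \<le> C" using carrier_count_nonneg[of "x\<^sub>1"] q L by (simp add: C_def)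
  have "(\<integral>\<^sup>+x. ennreal (carrier_count x) \<partial>state_law t) \<le> ennreal C" for t
  proof (induction t)
    case 0
    then show ?case using q L by (auto simp add: state_law_0 C_def intro!: ennreal_leI)
  next
    case (Suc t)
    have "(\<integral>\<^sup>+x. ennreal (carrier_count x) \<partial>state_law (Suc t))
        = (\<integral>\<^sup>+x. ennreal ((\<Sum>e\<in>lanes M. stay_prob M e * awards x e) + L) \<partial>state_law t)"
      by (simp add: state_law_Suc nn_integral_bind_pmf next_carrier_count L_def)
    also have "\<dots> \<le> (\<integral>\<^sup>+x. ennreal q * ennreal (carrier_count x) + ennreal L \<partial>state_law t)"
    proof (rule nn_integral_mono)
      fix x
      have "(\<Sum>e\<in>lanes M. stay_prob M e * awards x e) \<le> (\<Sum>e\<in>lanes M. q * awards x e)"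
        using qe awards_nonneg by (intro sum_mono mult_right_mono) auto
      also have "\<dots> \<le> q * carrier_count x"
        unfolding sum_distrib_left[symmetric] using q sum_awards_le by (intro mult_left_mono) auto
      finally have "ennreal ((\<Sum>e\<in>lanes M. stay_prob M e * awards x e) + L) \<le> ennreal (q * carrier_count x + L)"
        by (intro ennreal_leI) simp
      then show "ennreal ((\<Sum>e\<in>lanes M. stay_prob M e * awards x e) + L) \<le> ennreal q * ennreal (carrier_count x) + ennreal L"
        using q L carrier_count_nonneg[of x] by (simp add: ennreal_mult)
    qed
    also have "\<dots> = ennreal q * (\<integral>\<^sup>+x. ennreal (carrier_count x) \<partial>state_law t) + ennreal L"
      by (simp add: nn_integral_add nn_integral_cmult)
    also have "\<dots> \<le> ennreal q * ennreal C + ennreal L"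
      using Suc.IH by (intro add_right_mono mult_left_mono) auto
    also have "\<dots> = ennreal (q * C + L)"
      using q L C0 by (simp add: ennreal_mult)
    also have "\<dots> \<le> ennreal C" using C by (rule ennreal_leI)
    finally show ?case .
  qed
  then show thesis using that C0 by blast
qed

lemma integrable_carrier_count: "integrable (state_law t) carrier_count"
proof -
  obtain C where "\<And>t. (\<integral>\<^sup>+x. ennreal (carrier_count x) \<partial>state_law t) \<le> ennreal C"
    using carrier_count_bounded by blast
  then show ?thesis
    by (intro integrableI_nonneg) (auto simp: carrier_count_nonneg intro: le_less_trans[OF _ ennreal_less_top])
qed

lemma mean_carrier_count_bounded: obtains C where "0 \<le> C" "\<And>t. mean t carrier_count \<le> C"
proof -
  obtain C where C: "0 \<le> C" "\<And>t. (\<integral>\<^sup>+x. ennreal (carrier_count x) \<partial>state_law t) \<le> ennreal C"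
    using carrier_count_bounded by blast
  have "mean t carrier_count \<le> C" for t
    using C(2)[of t] nn_integral_eq_integral[OF integrable_carrier_count] C(1) carrier_count_nonneg
    by (simp add: ennreal_le_iff)
  then show thesis using that C(1) by blast
qed

lemma integrable_node_carriers: "integrable (state_law t) (\<lambda>x. real (fst x j))"
proof (rule Bochner_Integration.integrable_bound[OF integrable_carrier_count])
  have "real (fst x j) \<le> carrier_count x" for x
    unfolding carrier_count_def by (rule member_le_sum) auto
  then show "AE x in state_law t. norm (real (fst x j)) \<le> norm (carrier_count x)"
    by (simp add: carrier_count_nonneg)
qed simp

lemma integrable_awards: "e \<in> lanes M \<Longrightarrow> integrable (state_law t) (award_flow e)"
  by (rule Bochner_Integration.integrable_bound[OF integrable_carrier_count])
     (auto simp: awards_nonneg awards_le_count carrier_count_nonneg)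

lemma mean_node_carriers_Suc:
  "mean (Suc t) (\<lambda>x. real (fst x j))
     = (\<Sum>i | (i, j) \<in> lanes M. stay_prob M (i, j) * mean t (award_flow (i, j))) + arrival_rate M j"
proof -
  let ?f = "\<lambda>x. (\<Sum>i | (i, j) \<in> lanes M. stay_prob M (i, j) * awards x (i, j)) + arrival_rate M j"
  have int: "integrable (state_law t) ?f"
    using integrable_awards by (intro Bochner_Integration.integrable_add Bochner_Integration.integrable_sum) auto
  have nn: "0 \<le> ?f x" for x
    using stay_prob arrival_rate[of j] awards_nonneg
    by (intro add_nonneg_nonneg sum_nonneg mult_nonneg_nonneg) (auto intro: less_imp_le)
  have "ennreal (mean (Suc t) (\<lambda>x. real (fst x j))) = (\<integral>\<^sup>+x. ennreal (real (fst x j)) \<partial>state_law (Suc t))"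
    by (rule nn_integral_eq_integral[OF integrable_node_carriers, symmetric]) simp
  also have "\<dots> = (\<integral>\<^sup>+x. ennreal (?f x) \<partial>state_law t)"
    by (simp only: state_law_Suc nn_integral_bind_pmf market_period.next_carriers[OF period])
  also have "\<dots> = ennreal (mean t ?f)" by (rule nn_integral_eq_integral[OF int]) (simp add: nn)
  finally have "mean (Suc t) (\<lambda>x. real (fst x j)) = mean t ?f"
    using nn by (subst (asm) ennreal_inj) (auto intro!: integral_nonneg_AE)
  also have "\<dots> = (\<Sum>i | (i, j) \<in> lanes M. stay_prob M (i, j) * mean t (award_flow (i, j))) + arrival_rate M j"
    using integrable_awards
    by (subst Bochner_Integration.integral_add) (auto intro!: Bochner_Integration.integral_sum[THEN trans] sum.cong)
  finally show ?thesis .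
qed

lemma demand_rate_nonneg: "e \<in> lanes M \<Longrightarrow> 0 \<le> demand_rate x e"
  by (rule market_period.demand_nonneg[OF period])

text \<open>
  Demand rates may have infinite mean, so integrability is transferred in both directions.
\<close>

lemma mean_loads_Suc:
  assumes e: "e \<in> lanes M"
  shows "integrable (state_law (Suc t)) (loads e) \<longleftrightarrow> integrable (state_law t) (\<lambda>x. demand_rate x e)"
    and "mean (Suc t) (loads e) = mean t (\<lambda>x. demand_rate x e)"
proof -
  have nn: "(\<integral>\<^sup>+x. ennreal (real (snd x e)) \<partial>state_law (Suc t)) = (\<integral>\<^sup>+x. ennreal (demand_rate x e) \<partial>state_law t)"
    by (simp only: state_law_Suc nn_integral_bind_pmf market_period.next_loads[OF period e])
  show "integrable (state_law (Suc t)) (loads e) \<longleftrightarrow> integrable (state_law t) (\<lambda>x. demand_rate x e)"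
    using nn demand_rate_nonneg[OF e] by (simp add: integrable_iff_bounded)
  show "mean (Suc t) (loads e) = mean t (\<lambda>x. demand_rate x e)"
    using nn demand_rate_nonneg[OF e] by (simp add: integral_eq_nn_integral)
qed

lemma payment_bound:
  fixes \<kappa> :: "'n lane \<Rightarrow> real"
  defines "\<zeta> \<equiv> \<lambda>i. \<Sum>j\<in>dests i. exp (\<kappa> (i, j) - 1)"
  shows "price_sens M * (\<Sum>e\<in>lanes M. pay x e)
    \<ge> (\<Sum>e\<in>lanes M. (cost_shift M e + \<kappa> e) * awards x e)
      - (\<Sum>i\<in>UNIV. \<zeta> i * (real (fst x i) - (\<Sum>j\<in>dests i. awards x (i, j))))"
proof -
  have "(\<Sum>i\<in>UNIV. (\<Sum>j\<in>dests i. (cost_shift M (i, j) + \<kappa> (i, j)) * awards x (i, j))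
      - \<zeta> i * (real (fst x i) - (\<Sum>j\<in>dests i. awards x (i, j))))
    \<le> (\<Sum>i\<in>UNIV. price_sens M * (\<Sum>j\<in>dests i. pay x (i, j)))"
    unfolding \<zeta>_def by (intro sum_mono market_period.node_payment_bound[OF period])
  then show ?thesis
    unfolding sum_lanes_by_origin by (simp add: sum_subtractf sum_distrib_left)
qed

lemma profit_eq:
  "period_profit M (\<pi> x) x = (\<Sum>e\<in>lanes M. shipper_price (\<pi> x) e * demand_rate x e
     - penalty M e * (real (snd x e) - awards x e) - pay x e)"
  by (rule market_period.period_profit_eq[OF period])

text \<open>
  A history extends the one before it, so the profit of the last period is a difference of two
  integrable total profits.
\<close>

lemma total_profit_mean:
  assumes int: "\<And>t. integrable (history M \<pi> x\<^sub>1 t) (total_profit M \<pi>)"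
  defines "G \<equiv> \<lambda>x. period_profit M (\<pi> x) x"
  shows "integrable (state_law t) G"
    and "measure_pmf.expectation (history M \<pi> x\<^sub>1 t) (total_profit M \<pi>) = (\<Sum>s\<le>t. mean s G)"
proof -
  let ?H = "history M \<pi> x\<^sub>1"
  have tl: "map_pmf tl (?H (Suc t)) = ?H t" for t
    by (simp add: map_bind_pmf bind_return_pmf')
  have ne: "h \<in> set_pmf (?H t) \<Longrightarrow> h \<noteq> []" for t h
    by (cases t) auto
  have split: "h \<noteq> [] \<Longrightarrow> total_profit M \<pi> h = G (hd h) + total_profit M \<pi> (tl h)" for h
    by (cases h) (auto simp: total_profit_def G_def)
  have itl: "integrable (?H (Suc t)) (\<lambda>h. total_profit M \<pi> (tl h))" for t
    using int[of t] unfolding tl[of t, symmetric] by simp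
  have ae: "AE h in ?H t. G (hd h) = total_profit M \<pi> h - total_profit M \<pi> (tl h)" for t
    using ne[of _ t] split by (intro AE_pmfI) auto
  have ihd: "integrable (?H t) (\<lambda>h. G (hd h))" for t
  proof (cases t)
    case 0
    then show ?thesis by (simp add: integrable_measure_pmf_finite)
  next
    case (Suc s)
    have "integrable (?H t) (\<lambda>h. total_profit M \<pi> h - total_profit M \<pi> (tl h))"
      using int itl unfolding Suc by (intro Bochner_Integration.integrable_diff)
    then show ?thesis using integrable_cong_AE[OF _ _ ae[of t]] by simp
  qed
  have hd: "mean t G = measure_pmf.expectation (?H t) (\<lambda>h. G (hd h))" for t
    by (simp add: state_law_def)
  show "integrable (state_law t) G"
    using ihd[of t] by (simp add: state_law_def)
  show "measure_pmf.expectation (?H t) (total_profit M \<pi>) = (\<Sum>s\<le>t. mean s G)"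
  proof (induction t)
    case 0
    show ?case by (simp add: state_law_0 total_profit_def G_def)
  next
    case (Suc t)
    have "measure_pmf.expectation (?H (Suc t)) (total_profit M \<pi>)
        = measure_pmf.expectation (?H (Suc t)) (\<lambda>h. G (hd h) + total_profit M \<pi> (tl h))"
      using ne[of _ "Suc t"] split by (intro integral_cong_AE) (auto intro!: AE_pmfI)
    also have "\<dots> = mean (Suc t) G + measure_pmf.expectation (map_pmf tl (?H (Suc t))) (total_profit M \<pi>)"
      unfolding hd integral_map_pmf
      using ihd[of "Suc t"] itl[of t] by (rule Bochner_Integration.integral_add)
    finally show ?case unfolding tl using Suc.IH by simp
  qed
qed

end

section \<open>Comparison with the fluid problem\<close>

text \<open>
  The inequality holds for all \<open>\<kappa>\<close>, and \<open>\<kappa> = 1 + ln (y / v)\<close> is the best choice where \<open>y > 0\<close>. Where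
  \<open>y = 0\<close> the best choice would be \<open>- \<infinity>\<close>; a large negative \<open>\<kappa>\<close> costs an arbitrarily small error.
\<close>

lemma fluid_payment_from_dual:
  fixes y :: "'n::finite \<times> 'n \<Rightarrow> real" and v :: "'n \<Rightarrow> real" and L :: "('n \<times> 'n) set"
  assumes \<beta>: "0 < \<beta>" and y: "\<And>e. e \<in> L \<Longrightarrow> 0 \<le> y e" and v: "\<And>i. 0 < v i"
    and dual: "\<And>\<kappa>. (\<Sum>e\<in>L. (\<alpha> e + \<kappa> e) * y e) - (\<Sum>i\<in>UNIV. (\<Sum>j | (i, j) \<in> L. exp (\<kappa> (i, j) - 1)) * v i) \<le> \<beta> * P"
  shows "(\<Sum>e\<in>L. 1 / \<beta> * (ln (y e / v (fst e)) + \<alpha> e) * y e) \<le> P"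
proof -
  have swap: "(\<Sum>i\<in>UNIV. (\<Sum>j | (i, j) \<in> L. g (i, j)) * v i) = (\<Sum>e\<in>L. g e * v (fst e))" for g :: "'n \<times> 'n \<Rightarrow> real"
  proof -
    have "(\<Sum>i\<in>UNIV. \<Sum>j\<in>{j. (i, j) \<in> L}. g (i, j) * v i) = (\<Sum>(i, j)\<in>(SIGMA i:UNIV. {j. (i, j) \<in> L}). g (i, j) * v i)"
      by (rule sum.Sigma) auto
    moreover have "(SIGMA i:UNIV. {j. (i, j) \<in> L}) = L" by auto
    ultimately show ?thesis by (simp add: sum_distrib_right split_beta')
  qed
  have "(\<Sum>e\<in>L. (ln (y e / v (fst e)) + \<alpha> e) * y e) \<le> \<beta> * P"
  proof (rule field_le_epsilon)
    fix \<epsilon> :: real assume \<epsilon>: "0 < \<epsilon>"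
    define W where "W = 1 + (\<Sum>e\<in>L. v (fst e))"
    have W: "1 \<le> W" using v by (simp add: W_def sum_nonneg less_imp_le)
    define \<kappa> where "\<kappa> = (\<lambda>e. if y e = 0 then 1 + ln (\<epsilon> / W) else 1 + ln (y e / v (fst e)))"
    have "(ln (y e / v (fst e)) + \<alpha> e) * y e \<le> (\<alpha> e + \<kappa> e) * y e - exp (\<kappa> e - 1) * v (fst e) + \<epsilon> / W * v (fst e)"
      if e: "e \<in> L" for e
    proof (cases "y e = 0")
      case True
      then show ?thesis using \<epsilon> W by (simp add: \<kappa>_def exp_ln)
    next
      case False
      then have "0 < y e" using y[OF e] by simp
      then have "exp (\<kappa> e - 1) * v (fst e) = y e" using v[of "fst e"] False by (simp add: \<kappa>_def exp_ln)
      then show ?thesis using \<epsilon> W v[of "fst e"] False by (simp add: \<kappa>_def algebra_simps)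
    qed
    then have "(\<Sum>e\<in>L. (ln (y e / v (fst e)) + \<alpha> e) * y e)
        \<le> (\<Sum>e\<in>L. (\<alpha> e + \<kappa> e) * y e - exp (\<kappa> e - 1) * v (fst e) + \<epsilon> / W * v (fst e))"
      by (rule sum_mono)
    also have "\<dots> = (\<Sum>e\<in>L. (\<alpha> e + \<kappa> e) * y e) - (\<Sum>e\<in>L. exp (\<kappa> e - 1) * v (fst e)) + \<epsilon> / W * (\<Sum>e\<in>L. v (fst e))"
      by (simp add: sum.distrib sum_subtractf sum_distrib_left)
    also have "\<dots> \<le> \<beta> * P + \<epsilon> / W * (\<Sum>e\<in>L. v (fst e))"
      using dual[of \<kappa>] swap[of "\<lambda>e. exp (\<kappa> e - 1)"] by simp
    also have "\<epsilon> / W * (\<Sum>e\<in>L. v (fst e)) \<le> \<epsilon> / W * W"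
      using \<epsilon> W by (intro mult_left_mono) (auto simp: W_def)
    then have "\<beta> * P + \<epsilon> / W * (\<Sum>e\<in>L. v (fst e)) \<le> \<beta> * P + \<epsilon>" using W by simp
    finally show "(\<Sum>e\<in>L. (ln (y e / v (fst e)) + \<alpha> e) * y e) \<le> \<beta> * P + \<epsilon>" .
  qed
  then have "1 / \<beta> * (\<Sum>e\<in>L. (ln (y e / v (fst e)) + \<alpha> e) * y e) \<le> P" using \<beta> by (simp add: field_simps)
  then show ?thesis by (simp add: sum_distrib_left mult.assoc)
qed

context market_policy
begin

definition revenue_rate :: "'n lane \<Rightarrow> real \<Rightarrow> real" where
  "revenue_rate e z = inv_demand M e z * z"

abbreviation revenue :: "'n lane \<Rightarrow> 'n state \<Rightarrow> real" where
  "revenue e \<equiv> \<lambda>x. revenue_rate e (demand_rate x e)"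

definition profit :: "'n state \<Rightarrow> real" where
  "profit x = period_profit M (\<pi> x) x"

definition total_revenue :: "'n state \<Rightarrow> real" where
  "total_revenue x = (\<Sum>e\<in>lanes M. revenue_rate e (demand_rate x e))"

definition total_penalty :: "'n state \<Rightarrow> real" where
  "total_penalty x = (\<Sum>e\<in>lanes M. penalty M e * (real (snd x e) - awards x e))"

definition total_pay :: "'n state \<Rightarrow> real" where
  "total_pay x = (\<Sum>e\<in>lanes M. pay x e)"

lemma penalty_nonneg: "e \<in> lanes M \<Longrightarrow> 0 \<le> penalty M e"
  using market by (simp add: valid_market_def)

lemma price_in: "e \<in> lanes M \<Longrightarrow> shipper_price (\<pi> x) e \<in> price_set M e"
  using policy unfolding policies_def valid_action_def by blast

lemma demand_rate_in: "e \<in> lanes M \<Longrightarrow> demand_rate x e \<in> demand_set M e"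
  using price_in by (auto simp: demand_set_def)

lemma demand_set_nonneg: "e \<in> lanes M \<Longrightarrow> z \<in> demand_set M e \<Longrightarrow> 0 \<le> z"
  using market by (auto simp: demand_set_def valid_market_def)

lemma revenue_rate_demand:
  assumes e: "e \<in> lanes M"
  shows "revenue_rate e (demand_rate x e) = shipper_price (\<pi> x) e * demand_rate x e"
proof -
  have "strict_antimono_on (price_set M e) (demand M e)" using market e by (simp add: valid_market_def)
  then have "inj_on (demand M e) (price_set M e)"
    by (auto simp: inj_on_def monotone_on_def) (metis less_irrefl linorder_neqE_linordered_idom)
  then show ?thesis using price_in[OF e] by (simp add: revenue_rate_def inv_demand_def)
qed

lemma concave_revenue: "e \<in> lanes M \<Longrightarrow> concave_on (demand_set M e) (revenue_rate e)"
  using market by (simp add: valid_market_def revenue_rate_def[abs_def])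

lemma bdd_above_revenue: "e \<in> lanes M \<Longrightarrow> bdd_above (revenue_rate e ` demand_set M e)"
  using market by (simp add: valid_market_def revenue_rate_def[abs_def])

lemma profit_split: "profit x = total_revenue x - total_penalty x - total_pay x"
proof -
  have "total_revenue x = (\<Sum>e\<in>lanes M. shipper_price (\<pi> x) e * demand_rate x e)"
    unfolding total_revenue_def by (rule sum.cong[OF refl revenue_rate_demand])
  then show ?thesis
    unfolding profit_def profit_eq total_penalty_def total_pay_def by (simp add: sum_subtractf)
qed

lemma revenue_bounded:
  obtains R where "0 \<le> R" "\<And>e x. e \<in> lanes M \<Longrightarrow> revenue_rate e (demand_rate x e) \<le> R"
proof -
  have "\<forall>e\<in>lanes M. \<exists>r. \<forall>z\<in>demand_set M e. revenue_rate e z \<le> r"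
    using bdd_above_revenue by (fastforce simp: bdd_above_def)
  then obtain r where r: "\<And>e z. e \<in> lanes M \<Longrightarrow> z \<in> demand_set M e \<Longrightarrow> revenue_rate e z \<le> r e"
    by metis
  have "revenue_rate e (demand_rate x e) \<le> (\<Sum>e\<in>lanes M. \<bar>r e\<bar>)" if "e \<in> lanes M" for e x
  proof -
    have "revenue_rate e (demand_rate x e) \<le> \<bar>r e\<bar>" using r[OF that demand_rate_in[OF that]] by (rule order_trans) simp
    also have "\<dots> \<le> (\<Sum>e\<in>lanes M. \<bar>r e\<bar>)" by (rule member_le_sum) (use that in auto)
    finally show ?thesis .
  qed
  then show thesis by (intro that[of "\<Sum>e\<in>lanes M. \<bar>r e\<bar>"]) (auto simp: sum_nonneg)
qed

lemma price_sens_pos: "0 < price_sens M"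
  using market by (simp add: valid_market_def)

text \<open>
  The dual bound at \<open>\<kappa> = 0\<close>, where the cost shifts are positive.
\<close>

lemma total_pay_bounded_below:
  obtains c where "0 \<le> c" "\<And>x. - c * carrier_count x \<le> total_pay x"
proof -
  define \<zeta> where "\<zeta> = (\<lambda>i. \<Sum>j\<in>dests i. exp (0 - 1 :: real))"
  define Z where "Z = (\<Sum>i\<in>UNIV. \<zeta> i)"
  have \<zeta>: "0 \<le> \<zeta> i" for i by (simp add: \<zeta>_def)
  have "- (Z / price_sens M) * carrier_count x \<le> total_pay x" for x
  proof -
    have "(\<Sum>i\<in>UNIV. \<zeta> i * (real (fst x i) - (\<Sum>j\<in>dests i. awards x (i, j)))) \<le> (\<Sum>i\<in>UNIV. \<zeta> i * carrier_count x)"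
    proof (intro sum_mono mult_left_mono \<zeta>)
      fix i
      have "real (fst x i) \<le> carrier_count x" unfolding carrier_count_def by (rule member_le_sum) auto
      then show "real (fst x i) - (\<Sum>j\<in>dests i. awards x (i, j)) \<le> carrier_count x"
        using sum_nonneg[of "dests i" "\<lambda>j. awards x (i, j)"] awards_nonneg by (simp add: add_increasing2 diff_le_eq)
    qed
    moreover have "0 \<le> (\<Sum>e\<in>lanes M. (cost_shift M e + 0) * awards x e)"
      using market awards_nonneg by (intro sum_nonneg mult_nonneg_nonneg) (auto simp: valid_market_def less_imp_le)
    moreover have "(\<Sum>e\<in>lanes M. (cost_shift M e + 0) * awards x e)
        - (\<Sum>i\<in>UNIV. \<zeta> i * (real (fst x i) - (\<Sum>j\<in>dests i. awards x (i, j)))) \<le> price_sens M * total_pay x"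
      using payment_bound[of "\<lambda>_. 0" x] unfolding total_pay_def \<zeta>_def .
    moreover have "(\<Sum>i\<in>UNIV. \<zeta> i * carrier_count x) = Z * carrier_count x"
      by (simp add: Z_def sum_distrib_right)
    ultimately have "- (Z * carrier_count x) \<le> price_sens M * total_pay x" by linarith
    then show ?thesis using price_sens_pos by (simp add: field_simps)
  qed
  moreover have "0 \<le> Z / price_sens M" using price_sens_pos \<zeta> by (simp add: Z_def sum_nonneg)
  ultimately show thesis using that by blast
qed

lemma total_revenue_bounded: obtains R where "0 \<le> R" "\<And>x. total_revenue x \<le> R"
proof -
  obtain R where R: "0 \<le> R" "\<And>e x. e \<in> lanes M \<Longrightarrow> revenue_rate e (demand_rate x e) \<le> R"
    using revenue_bounded by blast
  have "total_revenue x \<le> real (card (lanes M)) * R" for x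
    unfolding total_revenue_def using sum_mono[of "lanes M" "\<lambda>e. revenue_rate e (demand_rate x e)" "\<lambda>_. R"] R by simp
  then show thesis using that[of "real (card (lanes M)) * R"] R by simp
qed

text \<open>
  Revenue is bounded above and payments are bounded below by the number of carriers, so a penalized
  lane with infinite expected load would make the expected profit \<open>- \<infinity>\<close>.
\<close>

lemma integrable_loads:
  assumes ip: "integrable (state_law t) profit" and e: "e \<in> lanes M" and pen: "penalty M e \<noteq> 0"
  shows "integrable (state_law t) (loads e)"
proof -
  obtain R where R: "\<And>x. total_revenue x \<le> R" using total_revenue_bounded by blast
  obtain c where c: "\<And>x. - c * carrier_count x \<le> total_pay x" using total_pay_bounded_below by blast
  define B where "B = penalty M e"
  have B: "0 < B" using pen penalty_nonneg[OF e] by (simp add: B_def)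
  have le: "real (snd x e) \<le> (R + c * carrier_count x - profit x) / B + carrier_count x" for x
  proof -
    have "B * (real (snd x e) - awards x e) \<le> total_penalty x"
      unfolding total_penalty_def B_def
      by (rule member_le_sum[of e "lanes M" "\<lambda>e. penalty M e * (real (snd x e) - awards x e)"])
         (use e penalty_nonneg awards_le_loads in auto)
    also have "\<dots> \<le> R + c * carrier_count x - profit x" using profit_split[of x] R[of x] c[of x] by simp
    finally have "real (snd x e) - awards x e \<le> (R + c * carrier_count x - profit x) / B"
      using B by (simp add: field_simps)
    then show ?thesis using awards_le_count[OF e, of x] by linarith
  qed
  have "integrable (state_law t) (\<lambda>x. (R + c * carrier_count x - profit x) / B + carrier_count x)"
    using ip integrable_carrier_count by auto
  then show ?thesis
    by (rule Bochner_Integration.integrable_bound) (use le in \<open>auto intro!: order_trans[OF _ abs_ge_self]\<close>)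
qed

lemma integrable_penalty_term:
  assumes ip: "integrable (state_law t) profit" and e: "e \<in> lanes M"
  shows "integrable (state_law t) (\<lambda>x. penalty M e * (real (snd x e) - awards x e))"
    and "mean t (\<lambda>x. penalty M e * (real (snd x e) - awards x e))
       = penalty M e * mean t (loads e) - penalty M e * mean t (award_flow e)"
proof -
  have "integrable (state_law t) (\<lambda>x. penalty M e * (real (snd x e) - awards x e)) \<and>
     mean t (\<lambda>x. penalty M e * (real (snd x e) - awards x e))
       = penalty M e * mean t (loads e) - penalty M e * mean t (award_flow e)"
  proof (cases "penalty M e = 0")
    case False
    then show ?thesis using integrable_loads[OF ip e] integrable_awards[OF e, of t] by (simp add: right_diff_distrib)
  qed simp
  then show "integrable (state_law t) (\<lambda>x. penalty M e * (real (snd x e) - awards x e))"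
    "mean t (\<lambda>x. penalty M e * (real (snd x e) - awards x e))
       = penalty M e * mean t (loads e) - penalty M e * mean t (award_flow e)" by auto
qed

text \<open>
  Profit is integrable and each of its parts is bounded above by an integrable function.
\<close>

lemma integrable_profit_parts:
  assumes ip: "integrable (state_law t) profit"
  shows "integrable (state_law t) total_penalty" "integrable (state_law t) total_revenue"
    "integrable (state_law t) total_pay"
    "e \<in> lanes M \<Longrightarrow> integrable (state_law t) (revenue e)"
proof -
  obtain R where R: "0 \<le> R" "\<And>x. total_revenue x \<le> R" using total_revenue_bounded by blast
  obtain c where c: "0 \<le> c" "\<And>x. - c * carrier_count x \<le> total_pay x" using total_pay_bounded_below by blast
  show pen: "integrable (state_law t) total_penalty"
    unfolding total_penalty_def[abs_def] using integrable_penalty_term(1)[OF ip]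
    by (rule Bochner_Integration.integrable_sum)
  have bound: "integrable (state_law t) (\<lambda>x. R + \<bar>profit x + total_penalty x\<bar> + c * carrier_count x)"
    using ip pen integrable_carrier_count by auto
  have "norm (total_revenue x) \<le> norm (R + \<bar>profit x + total_penalty x\<bar> + c * carrier_count x)" for x
  proof -
    have "0 \<le> c * carrier_count x" using c(1) carrier_count_nonneg by simp
    then show ?thesis using R(1) R(2)[of x] c(2)[of x] profit_split[of x] by (simp add: abs_le_iff) linarith
  qed
  then show rev: "integrable (state_law t) total_revenue"
    by (intro Bochner_Integration.integrable_bound[OF bound]) auto
  have "total_pay = (\<lambda>x. total_revenue x - total_penalty x - profit x)"
    using profit_split by auto
  then show "integrable (state_law t) total_pay" using rev pen ip by simp
  show "integrable (state_law t) (revenue e)" if e: "e \<in> lanes M"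
  proof -
    obtain r where r: "0 \<le> r" "\<And>e x. e \<in> lanes M \<Longrightarrow> revenue_rate e (demand_rate x e) \<le> r"
      using revenue_bounded by blast
    define k where "k = real (card (lanes M)) * r"
    have k: "0 \<le> k" using r by (simp add: k_def)
    have "norm (revenue_rate e (demand_rate x e)) \<le> norm (r + k + \<bar>total_revenue x\<bar>)" for x
    proof -
      have "total_revenue x = revenue_rate e (demand_rate x e) + (\<Sum>e\<in>lanes M - {e}. revenue_rate e (demand_rate x e))"
        unfolding total_revenue_def by (rule sum.remove) (use e in auto)
      moreover have "(\<Sum>e\<in>lanes M - {e}. revenue_rate e (demand_rate x e)) \<le> real (card (lanes M - {e})) * r"
        using sum_bounded_above[of "lanes M - {e}" "\<lambda>e. revenue_rate e (demand_rate x e)" r] r(2) by simp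
      moreover have "real (card (lanes M - {e})) * r \<le> k"
        unfolding k_def using r by (intro mult_right_mono) (auto intro!: card_mono)
      ultimately show ?thesis using r(1) r(2)[OF e, of x] k by (simp add: abs_le_iff) linarith
    qed
    then have le: "AE x in state_law t. norm (revenue_rate e (demand_rate x e)) \<le> norm (r + k + \<bar>total_revenue x\<bar>)" by simp
    have "integrable (state_law t) (\<lambda>x. r + k + \<bar>total_revenue x\<bar>)" using rev by auto
    then show ?thesis by (rule Bochner_Integration.integrable_bound[OF _ _ le]) simp
  qed
qed

text \<open>
  The average over the periods \<open>2, \<dots>, n + 1\<close>, whose loads and carriers are the outcome of a
  transition.
\<close>

definition average :: "nat \<Rightarrow> ('n state \<Rightarrow> real) \<Rightarrow> real" where
  "average n f = (\<Sum>t<n. mean (Suc t) f) / real n"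

lemma average_mono:
  assumes "\<And>t. integrable (state_law t) f" "\<And>t. integrable (state_law t) g" "\<And>x. f x \<le> g x"
  shows "average n f \<le> average n g"
  unfolding average_def using assms by (intro divide_right_mono sum_mono integral_mono) auto

lemma average_sum:
  assumes "\<And>i t. i \<in> A \<Longrightarrow> integrable (state_law t) (f i)"
  shows "average n (\<lambda>x. \<Sum>i\<in>A. f i x) = (\<Sum>i\<in>A. average n (f i))"
proof -
  have "mean t (\<lambda>x. \<Sum>i\<in>A. f i x) = (\<Sum>i\<in>A. mean t (f i))" for t
    using assms by (intro Bochner_Integration.integral_sum) auto
  then show ?thesis unfolding average_def by (simp add: sum.swap[of _ A] sum_divide_distrib)
qed

lemma average_diff:
  "(\<And>t. integrable (state_law t) f) \<Longrightarrow> (\<And>t. integrable (state_law t) g) \<Longrightarrow>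
   average n (\<lambda>x. f x - g x) = average n f - average n g"
  unfolding average_def by (simp add: sum_subtractf diff_divide_distrib)

lemma average_cmult: "average n (\<lambda>x. c * f x) = c * average n f"
  unfolding average_def by (simp add: sum_distrib_left)

lemma average_nonneg: "(\<And>x. 0 \<le> f x) \<Longrightarrow> 0 \<le> average n f"
  unfolding average_def by (intro divide_nonneg_nonneg sum_nonneg integral_nonneg_AE) auto

definition average_leaving :: "nat \<Rightarrow> 'n \<Rightarrow> real" where
  "average_leaving n i = average n (\<lambda>x. real (fst x i)) - (\<Sum>j\<in>dests i. average n (award_flow (i, j)))"

lemma in_dests: "j \<in> dests i \<longleftrightarrow> (i, j) \<in> lanes M"
  by (simp add: destinations_def)

lemma average_leaving_eq:
  "average_leaving n i = average n (\<lambda>x. real (fst x i) - (\<Sum>j\<in>dests i. awards x (i, j)))"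
proof -
  have i: "integrable (state_law t) (award_flow (i, j))" if "j \<in> dests i" for j t
    using that by (intro integrable_awards) (simp add: in_dests)
  have "average n (\<lambda>x. \<Sum>j\<in>dests i. awards x (i, j)) = (\<Sum>j\<in>dests i. average n (award_flow (i, j)))"
    by (rule average_sum) (rule i)
  moreover have "integrable (state_law t) (\<lambda>x. \<Sum>j\<in>dests i. awards x (i, j))" for t
    by (rule Bochner_Integration.integrable_sum) (rule i)
  ultimately show ?thesis
    unfolding average_leaving_def by (simp add: average_diff[OF integrable_node_carriers])
qed

lemma average_leaving_nonneg: "0 \<le> average_leaving n i"
  unfolding average_leaving_eq
  using market_period.node_awards_le_carriers[OF period] by (intro average_nonneg) auto

lemma average_payment_bound:
  fixes \<kappa> :: "'n lane \<Rightarrow> real"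
  assumes ip: "\<And>t. integrable (state_law t) profit"
  shows "(\<Sum>e\<in>lanes M. (cost_shift M e + \<kappa> e) * average n (award_flow e))
      - (\<Sum>i\<in>UNIV. (\<Sum>j\<in>dests i. exp (\<kappa> (i, j) - 1)) * average_leaving n i)
    \<le> price_sens M * average n total_pay"
proof -
  let ?z = "\<lambda>i. \<Sum>j\<in>dests i. exp (\<kappa> (i, j) - 1)"
  let ?g = "\<lambda>i x. real (fst x i) - (\<Sum>j\<in>dests i. awards x (i, j))"
  have ig: "integrable (state_law t) (?g i)" for i t
    by (auto simp: in_dests intro!: Bochner_Integration.integrable_diff integrable_node_carriers
        Bochner_Integration.integrable_sum integrable_awards)
  have i1: "integrable (state_law t) (\<lambda>x. \<Sum>e\<in>lanes M. (cost_shift M e + \<kappa> e) * awards x e)" for t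
    by (auto intro!: Bochner_Integration.integrable_sum integrable_awards integrable_mult_right)
  have i2: "integrable (state_law t) (\<lambda>x. \<Sum>i\<in>UNIV. ?z i * ?g i x)" for t
    using ig by (intro Bochner_Integration.integrable_sum integrable_mult_right)
  have "average n (\<lambda>x. (\<Sum>e\<in>lanes M. (cost_shift M e + \<kappa> e) * awards x e) - (\<Sum>i\<in>UNIV. ?z i * ?g i x))
      \<le> average n (\<lambda>x. price_sens M * total_pay x)"
  proof (rule average_mono)
    show "integrable (state_law t) (\<lambda>x. (\<Sum>e\<in>lanes M. (cost_shift M e + \<kappa> e) * awards x e) - (\<Sum>i\<in>UNIV. ?z i * ?g i x))" for t
      by (rule Bochner_Integration.integrable_diff[OF i1 i2])
    show "integrable (state_law t) (\<lambda>x. price_sens M * total_pay x)" for t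
      using integrable_profit_parts(3)[OF ip] by (rule integrable_mult_right)
    show "(\<Sum>e\<in>lanes M. (cost_shift M e + \<kappa> e) * awards x e) - (\<Sum>i\<in>UNIV. ?z i * ?g i x) \<le> price_sens M * total_pay x" for x
      unfolding total_pay_def by (rule payment_bound)
  qed
  also have "average n (\<lambda>x. (\<Sum>e\<in>lanes M. (cost_shift M e + \<kappa> e) * awards x e) - (\<Sum>i\<in>UNIV. ?z i * ?g i x))
      = average n (\<lambda>x. \<Sum>e\<in>lanes M. (cost_shift M e + \<kappa> e) * awards x e) - average n (\<lambda>x. \<Sum>i\<in>UNIV. ?z i * ?g i x)"
    by (rule average_diff[OF i1 i2])
  also have "average n (\<lambda>x. \<Sum>e\<in>lanes M. (cost_shift M e + \<kappa> e) * awards x e)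
      = (\<Sum>e\<in>lanes M. (cost_shift M e + \<kappa> e) * average n (award_flow e))"
    by (subst average_sum) (auto simp: average_cmult intro: integrable_awards integrable_mult_right)
  also have "average n (\<lambda>x. \<Sum>i\<in>UNIV. ?z i * ?g i x) = (\<Sum>i\<in>UNIV. ?z i * average_leaving n i)"
    unfolding average_leaving_eq by (subst average_sum) (use ig in \<open>auto simp: average_cmult\<close>)
  finally show ?thesis by (simp only: average_cmult)
qed

text \<open>
  Arrivals in the periods \<open>2, \<dots>, n + 1\<close> come from awards in the periods \<open>1, \<dots>, n\<close>. Shifting
  the sum by one period leaves the difference of the first and the last term.
\<close>

lemma average_flow:
  assumes n: "0 < n"
  shows "average_leaving n j = (\<Sum>i | (i, j) \<in> lanes M. stay_prob M (i, j) * average n (award_flow (i, j)))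
    + arrival_rate M j - (\<Sum>k\<in>dests j. average n (award_flow (j, k)))
    + (\<Sum>i | (i, j) \<in> lanes M. stay_prob M (i, j) *
         (mean 0 (award_flow (i, j)) - mean n (award_flow (i, j)))) / real n"
proof -
  let ?I = "{i. (i, j) \<in> lanes M}"
  have sh: "(\<Sum>t<n. mean t f) = (\<Sum>t<n. mean (Suc t) f) + mean 0 f - mean n f" for f
    by (induction n) auto
  have "(\<Sum>t<n. mean (Suc t) (\<lambda>x. real (fst x j)))
      = (\<Sum>i\<in>?I. stay_prob M (i, j) * (\<Sum>t<n. mean t (award_flow (i, j)))) + real n * arrival_rate M j"
    by (simp add: mean_node_carriers_Suc sum.distrib sum_distrib_left sum.swap[of _ ?I])
  also have "\<dots> = (\<Sum>i\<in>?I. stay_prob M (i, j) * (\<Sum>t<n. mean (Suc t) (award_flow (i, j))))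
      + (\<Sum>i\<in>?I. stay_prob M (i, j) * (mean 0 (award_flow (i, j)) - mean n (award_flow (i, j))))
      + real n * arrival_rate M j"
    unfolding sh sum.distrib[symmetric] by (simp add: algebra_simps)
  finally have "average n (\<lambda>x. real (fst x j))
     = (\<Sum>i\<in>?I. stay_prob M (i, j) * average n (award_flow (i, j)))
      + (\<Sum>i\<in>?I. stay_prob M (i, j) * (mean 0 (award_flow (i, j)) - mean n (award_flow (i, j)))) / real n
      + arrival_rate M j"
    unfolding average_def using n by (simp add: add_divide_distrib sum_divide_distrib[where A = ?I])
  then show ?thesis unfolding average_leaving_def by simp
qed

text \<open>
  The revenue of a period is kept with the penalties and payments of the following period. The
  revenue of the last period and the costs of the first one are left over.
\<close>

lemma cumulative_profit_split:
  assumes ip: "\<And>t. integrable (state_law t) profit"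
  shows "(\<Sum>s\<le>n. mean s profit) = (\<Sum>t<n. mean t total_revenue) + mean n total_revenue
    - (total_penalty x\<^sub>1 + total_pay x\<^sub>1) - (\<Sum>t<n. mean (Suc t) total_penalty) - (\<Sum>t<n. mean (Suc t) total_pay)"
proof -
  note int = integrable_profit_parts[OF ip]
  have "mean s profit = mean s total_revenue - (mean s total_penalty + mean s total_pay)" for s
  proof -
    have "profit = (\<lambda>x. total_revenue x - total_penalty x - total_pay x)" using profit_split by auto
    then show ?thesis using int(1-3)[of s] by simp
  qed
  then have "(\<Sum>s\<le>n. mean s profit) = (\<Sum>s\<le>n. mean s total_revenue) - (\<Sum>s\<le>n. mean s total_penalty + mean s total_pay)"
    by (simp add: sum_subtractf)
  moreover have "(\<Sum>s\<le>n. mean s total_revenue) = (\<Sum>t<n. mean t total_revenue) + mean n total_revenue"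
    by (simp add: lessThan_Suc_atMost[symmetric])
  moreover have "(\<Sum>s\<le>n. mean s total_penalty + mean s total_pay)
      = total_penalty x\<^sub>1 + total_pay x\<^sub>1 + (\<Sum>t<n. mean (Suc t) total_penalty + mean (Suc t) total_pay)"
    unfolding sum.atMost_shift by (simp add: state_law_0)
  ultimately show ?thesis by (simp add: sum.distrib)
qed

text \<open>
  The awards of a period are at most its loads, and their mean is the mean demand rate of the period
  before.
\<close>

lemma average_demand_point:
  assumes ip: "\<And>t. integrable (state_law t) profit" and n: "0 < n" and e: "e \<in> lanes M"
  shows "\<exists>d\<in>demand_set M e. average n (award_flow e) \<le> d \<and>
    (\<Sum>t<n. mean t (revenue e)) \<le> real n * revenue_rate e d + 1 \<and>
    penalty M e * (real n * d) = penalty M e * (\<Sum>t<n. mean (Suc t) (loads e))"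
proof -
  let ?X = "\<lambda>x. demand_rate x e"
  obtain d where "d \<in> demand_set M e" "average n (award_flow e) \<le> d"
    "(\<Sum>t<n. mean t (\<lambda>x. revenue_rate e (?X x))) \<le> real n * (revenue_rate e d + 1 / real n)"
    "penalty M e * (real n * d) = penalty M e * (\<Sum>t<n. mean t ?X)"
  proof (rule average_revenue_attained[OF n, where p = state_law and X = ?X and f = "revenue_rate e"
        and S = "demand_set M e" and b = "penalty M e" and low = "average n (award_flow e)" and \<epsilon> = "1 / real n"])
    show "penalty M e \<noteq> 0 \<Longrightarrow> \<forall>t<n. integrable (state_law t) ?X"
      using integrable_loads[OF ip e] mean_loads_Suc(1)[OF e] by blast
    assume int: "\<forall>t<n. integrable (state_law t) ?X"
    have "real n * average n (award_flow e) = (\<Sum>t<n. mean (Suc t) (award_flow e))"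
      using n by (simp add: average_def)
    also have "\<dots> \<le> (\<Sum>t<n. mean (Suc t) (loads e))"
      using int mean_loads_Suc(1)[OF e] awards_le_loads[OF e]
      by (intro sum_mono integral_mono integrable_awards e) auto
    finally show "real n * average n (award_flow e) \<le> (\<Sum>t<n. mean t ?X)"
      by (simp add: mean_loads_Suc(2)[OF e])
  qed (use e n demand_rate_in demand_set_nonneg concave_revenue bdd_above_revenue integrable_profit_parts(4)[OF ip] in auto)
  then show ?thesis using n by (auto simp: mean_loads_Suc(2)[OF e] distrib_left)
qed

lemma initial_flow_defect:
  assumes C: "\<And>t. mean t carrier_count \<le> C"
  shows "(\<Sum>i | (i, j) \<in> lanes M. stay_prob M (i, j) *
         (mean 0 (award_flow (i, j)) - mean n (award_flow (i, j)))) \<le> C"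
proof -
  have nn: "0 \<le> mean t (award_flow e)" for t e by (intro integral_nonneg_AE AE_I2 awards_nonneg)
  have "(\<Sum>i | (i, j) \<in> lanes M. stay_prob M (i, j) *
         (mean 0 (award_flow (i, j)) - mean n (award_flow (i, j))))
      \<le> (\<Sum>i | (i, j) \<in> lanes M. mean 0 (award_flow (i, j)))"
  proof (rule sum_mono)
    fix i assume "i \<in> {i. (i, j) \<in> lanes M}"
    then have q: "0 < stay_prob M (i, j)" "stay_prob M (i, j) < 1" using stay_prob by auto
    have "stay_prob M (i, j) * (mean 0 (award_flow (i, j)) - mean n (award_flow (i, j)))
        \<le> stay_prob M (i, j) * mean 0 (award_flow (i, j))"
      using q nn[of n "(i, j)"] by (intro mult_left_mono) auto
    also have "\<dots> \<le> mean 0 (award_flow (i, j))" using q nn by (intro mult_left_le_one_le) auto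
    finally show "stay_prob M (i, j) * (mean 0 (award_flow (i, j)) - mean n (award_flow (i, j)))
        \<le> mean 0 (award_flow (i, j))" .
  qed
  also have "\<dots> \<le> (\<Sum>j\<in>UNIV. \<Sum>i | (i, j) \<in> lanes M. mean 0 (award_flow (i, j)))"
    by (rule member_le_sum[of j UNIV "\<lambda>j. \<Sum>i | (i, j) \<in> lanes M. mean 0 (award_flow (i, j))"])
       (auto intro: sum_nonneg nn)
  also have "\<dots> = (\<Sum>e\<in>lanes M. awards x\<^sub>1 e)"
    unfolding sum_lanes_by_destination by (simp add: state_law_0)
  also have "\<dots> \<le> mean 0 carrier_count" using sum_awards_le[of "x\<^sub>1"] by (simp add: state_law_0)
  also have "\<dots> \<le> C" by (rule C)
  finally show ?thesis .
qed

lemma fluid_point_from_averages: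
  fixes C K :: real and n :: nat and d :: "'n lane \<Rightarrow> real"
  assumes ip: "\<And>t. integrable (state_law t) profit"
    and C: "0 \<le> C" "\<And>t. mean t carrier_count \<le> C"
    and K: "0 < K" "\<And>j. C < K * arrival_rate M j" and nK: "K < real n"
    and d: "\<And>e. e \<in> lanes M \<Longrightarrow> d e \<in> demand_set M e" "\<And>e. e \<in> lanes M \<Longrightarrow> average n (award_flow e) \<le> d e"
  defines "y \<equiv> \<lambda>e. average n (award_flow e)" and "P \<equiv> average n total_pay"
  shows "\<exists>F. ereal F \<le> fluid_value M \<and>
    (\<Sum>e\<in>lanes M. revenue_rate e (d e)) - (\<Sum>e\<in>lanes M. penalty M e * (d e - y e)) - P
      \<le> F + K / real n * ((\<Sum>e\<in>lanes M. penalty M e * y e) - P)"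
proof -
  have n: "0 < n" using nK K(1) by (cases n) auto
  have y0: "0 \<le> y e" for e unfolding y_def by (intro average_nonneg awards_nonneg)
  have yd: "y e \<le> d e" if "e \<in> lanes M" for e
    using d(2)[OF that] by (simp add: y_def)
  let ?E = "(\<Sum>e\<in>lanes M. revenue_rate e (d e)) - (\<Sum>e\<in>lanes M. penalty M e * (d e - y e)) - P"
  \<comment> \<open>With \<open>v\<close> the average departures, \<open>(y, v)\<close> violates flow balance by at most \<open>C / n\<close>. Moving it
    by \<open>\<theta>\<close> towards the point without transports, where carriers leave at rate \<open>\<lambda>\<close>, restores balance
    and keeps \<open>v'\<close> above \<open>(1 - \<theta>) v\<close>; the payment is homogeneous of degree one and decreasing in \<open>v\<close>.\<close>
  define \<theta> where "\<theta> = K / real n"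
  have \<theta>: "0 < \<theta>" "\<theta> < 1" using K(1) nK n by (auto simp: \<theta>_def)
  define y' where "y' = (\<lambda>e. (1 - \<theta>) * y e)"
  define v' where "v' = (\<lambda>j. (\<Sum>i | (i, j) \<in> lanes M. stay_prob M (i, j) * y' (i, j)) + arrival_rate M j
      - (\<Sum>k\<in>dests j. y' (j, k)))"
  have v': "(1 - \<theta>) * average_leaving n j < v' j" for j
  proof -
    define \<delta> where "\<delta> = (\<Sum>i | (i, j) \<in> lanes M. stay_prob M (i, j) *
       (mean 0 (award_flow (i, j)) - mean n (award_flow (i, j)))) / real n"
    have dC: "\<delta> \<le> C / real n" unfolding \<delta>_def using initial_flow_defect[OF C(2)] by (intro divide_right_mono) auto
    define X where "X = (\<Sum>i | (i, j) \<in> lanes M. stay_prob M (i, j) * y (i, j))"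
    define Y where "Y = (\<Sum>k\<in>dests j. y (j, k))"
    have v'_eq: "v' j = (1 - \<theta>) * X + arrival_rate M j - (1 - \<theta>) * Y"
      by (simp add: v'_def y'_def X_def Y_def sum_distrib_left mult.left_commute)
    have leaving_eq: "average_leaving n j = X + arrival_rate M j - Y + \<delta>"
      using average_flow[OF n, of j] by (simp add: y_def X_def Y_def \<delta>_def)
    have "v' j - (1 - \<theta>) * average_leaving n j = \<theta> * arrival_rate M j - (1 - \<theta>) * \<delta>"
      unfolding v'_eq leaving_eq by (simp add: algebra_simps)
    moreover have "(1 - \<theta>) * \<delta> \<le> C / real n"
    proof -
      have "(1 - \<theta>) * \<delta> \<le> (1 - \<theta>) * (C / real n)" using \<theta> dC by (intro mult_left_mono) auto
      also have "\<dots> \<le> C / real n" using \<theta> C n by (intro mult_left_le_one_le) auto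
      finally show ?thesis .
    qed
    moreover have "C / real n < \<theta> * arrival_rate M j"
      using K(2)[of j] n by (simp add: \<theta>_def field_simps)
    ultimately show ?thesis by linarith
  qed
  have v'0: "0 < v' j" for j
  proof -
    have "0 \<le> (1 - \<theta>) * average_leaving n j" using \<theta> average_leaving_nonneg by simp
    then show ?thesis using v'[of j] by linarith
  qed
  have y'0: "0 \<le> y' e" and y'y: "y' e \<le> y e" for e
    using \<theta> y0[of e] by (auto simp: y'_def intro!: mult_left_le_one_le)
  have feas: "fluid_feasible M d y' v'"
    unfolding fluid_feasible_def
  proof (intro conjI allI ballI)
    fix j
    show "(\<Sum>i | (i, j) \<in> lanes M. stay_prob M (i, j) * y' (i, j)) + arrival_rate M j
          = (\<Sum>k | (j, k) \<in> lanes M. y' (j, k)) + v' j"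
      by (simp add: v'_def destinations_def)
    show "0 \<le> v' j" using v'0[of j] by simp
  next
    fix e assume e: "e \<in> lanes M"
    show "d e \<in> demand_set M e" "0 \<le> y' e" "y' e \<le> d e"
      using d(1)[OF e] y'0 order_trans[OF y'y yd[OF e]] by auto
  qed
  define p where "p = (\<lambda>e. 1 / price_sens M * (ln (y' e / v' (fst e)) + cost_shift M e) * y' e)"
  define F where "F = (\<Sum>e\<in>lanes M. revenue_rate e (d e) - p e - penalty M e * (d e - y' e))"
  have "fluid_payment (price_sens M) (cost_shift M e) (y' e) (v' (fst e)) = ereal (p e)" for e
    using v'0[of "fst e"] by (simp add: fluid_payment_def p_def)
  then have "fluid_objective M d y' v' = ereal F"
    unfolding fluid_objective_def F_def revenue_rate_def by simp
  then have FV: "ereal F \<le> fluid_value M"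
    unfolding fluid_value_def using feas by (intro Sup_upper) force
  have pay: "(\<Sum>e\<in>lanes M. p e) \<le> (1 - \<theta>) * P"
    unfolding p_def
  proof (rule fluid_payment_from_dual[OF price_sens_pos y'0 v'0])
    fix \<kappa> :: "'n lane \<Rightarrow> real"
    let ?z = "\<lambda>i. \<Sum>j\<in>dests i. exp (\<kappa> (i, j) - 1)"
    have "(\<Sum>e\<in>lanes M. (cost_shift M e + \<kappa> e) * y' e) - (\<Sum>i\<in>UNIV. ?z i * v' i)
        \<le> (\<Sum>e\<in>lanes M. (cost_shift M e + \<kappa> e) * y' e) - (\<Sum>i\<in>UNIV. ?z i * ((1 - \<theta>) * average_leaving n i))"
      using v' by (intro diff_left_mono sum_mono mult_left_mono sum_nonneg) (auto intro: less_imp_le)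
    also have "\<dots> = (1 - \<theta>) * ((\<Sum>e\<in>lanes M. (cost_shift M e + \<kappa> e) * y e) - (\<Sum>i\<in>UNIV. ?z i * average_leaving n i))"
      by (simp add: y'_def right_diff_distrib[of "1 - \<theta>"] sum_distrib_left mult_ac)
    also have "\<dots> \<le> (1 - \<theta>) * (price_sens M * P)"
      unfolding y_def P_def using \<theta> average_payment_bound[OF ip] by (intro mult_left_mono) auto
    finally show "(\<Sum>e\<in>lanes M. (cost_shift M e + \<kappa> e) * y' e)
        - (\<Sum>i\<in>UNIV. (\<Sum>j | (i, j) \<in> lanes M. exp (\<kappa> (i, j) - 1)) * v' i) \<le> price_sens M * ((1 - \<theta>) * P)"
      by (simp add: destinations_def mult_ac)
  qed
  have "(\<Sum>e\<in>lanes M. penalty M e * (d e - y' e)) = (\<Sum>e\<in>lanes M. penalty M e * (d e - y e)) + \<theta> * (\<Sum>e\<in>lanes M. penalty M e * y e)"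
    by (simp add: y'_def sum_distrib_left sum.distrib[symmetric] algebra_simps)
  moreover have "F = (\<Sum>e\<in>lanes M. revenue_rate e (d e)) - (\<Sum>e\<in>lanes M. p e) - (\<Sum>e\<in>lanes M. penalty M e * (d e - y' e))"
    by (simp only: F_def sum_subtractf)
  ultimately have "?E \<le> F + \<theta> * (\<Sum>e\<in>lanes M. penalty M e * y e) - (P - (1 - \<theta>) * P)"
    using pay by linarith
  then have "?E \<le> F + \<theta> * ((\<Sum>e\<in>lanes M. penalty M e * y e) - P)"
    by (simp add: left_diff_distrib right_diff_distrib)
  with FV show ?thesis unfolding \<theta>_def by blast
qed

text \<open>
  The averages of awards and demand rates are turned into a feasible point of the fluid problem whose
  objective is at least the average profit up to a constant divided by \<open>n\<close>.
\<close>

lemma finite_horizon_bound: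
  assumes ip: "\<And>t. integrable (state_law t) profit"
  shows "\<exists>c N. \<forall>n\<ge>N. \<exists>F. ereal F \<le> fluid_value M \<and> (\<Sum>s\<le>n. mean s profit) \<le> real n * F + c"
proof -
  obtain C where C: "0 \<le> C" "\<And>t. mean t carrier_count \<le> C" using mean_carrier_count_bounded by blast
  obtain R where R: "0 \<le> R" "\<And>x. total_revenue x \<le> R" using total_revenue_bounded by blast
  obtain c\<^sub>0 where c0: "0 \<le> c\<^sub>0" "\<And>x. - c\<^sub>0 * carrier_count x \<le> total_pay x" using total_pay_bounded_below by blast
  \<comment> \<open>This makes \<open>\<theta> = K / n\<close> satisfy \<open>\<theta> * \<lambda> > C / n\<close> at every node, where \<open>C / n\<close> bounds the flow defect.\<close>
  define K where "K = 1 + (\<Sum>j\<in>UNIV. C / arrival_rate M j)"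
  define B where "B = (\<Sum>e\<in>lanes M. penalty M e * C)"
  define c where "c = real (card (lanes M)) + R + (\<bar>total_penalty x\<^sub>1\<bar> + \<bar>total_pay x\<^sub>1\<bar>) + K * (B + c\<^sub>0 * C)"
  have K1: "1 \<le> K" using C arrival_rate by (simp add: K_def sum_nonneg less_imp_le)
  have K: "C < K * arrival_rate M j" for j
  proof -
    have "C / arrival_rate M j \<le> (\<Sum>j\<in>UNIV. C / arrival_rate M j)"
      using C arrival_rate by (intro member_le_sum) (auto simp: less_imp_le)
    then have "(1 + C / arrival_rate M j) * arrival_rate M j \<le> K * arrival_rate M j"
      unfolding K_def using arrival_rate[of j] by (intro mult_right_mono) auto
    moreover have "(1 + C / arrival_rate M j) * arrival_rate M j = arrival_rate M j + C"
      using arrival_rate[of j] by (simp add: field_simps)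
    ultimately show ?thesis using arrival_rate[of j] by linarith
  qed
  have "\<exists>F. ereal F \<le> fluid_value M \<and> (\<Sum>s\<le>n. mean s profit) \<le> real n * F + c" if nK: "K < real n" for n
  proof -
    have n: "0 < n" using nK K1 by (cases n) auto
    define y where "y = (\<lambda>e. average n (award_flow e))"
    define P where "P = average n total_pay"
    have "\<forall>e\<in>lanes M. \<exists>d. d \<in> demand_set M e \<and> y e \<le> d \<and>
       (\<Sum>t<n. mean t (revenue e)) \<le> real n * revenue_rate e d + 1 \<and>
       penalty M e * (real n * d) = penalty M e * (\<Sum>t<n. mean (Suc t) (loads e))"
      unfolding y_def using average_demand_point[OF ip n] by blast
    then obtain d where d: "\<And>e. e \<in> lanes M \<Longrightarrow> d e \<in> demand_set M e" "\<And>e. e \<in> lanes M \<Longrightarrow> y e \<le> d e"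
        and drev: "\<And>e. e \<in> lanes M \<Longrightarrow> (\<Sum>t<n. mean t (revenue e)) \<le> real n * revenue_rate e (d e) + 1"
        and dpen: "\<And>e. e \<in> lanes M \<Longrightarrow> penalty M e * (real n * d e) = penalty M e * (\<Sum>t<n. mean (Suc t) (loads e))"
      by metis
    have avg_cc: "average n carrier_count \<le> C"
      unfolding average_def using sum_mono[of "{..<n}" "\<lambda>t. mean (Suc t) carrier_count" "\<lambda>_. C"] C(2) n
      by (simp add: field_simps)
    have yC: "y e \<le> C" if "e \<in> lanes M" for e
    proof -
      have "y e \<le> average n carrier_count"
        unfolding y_def using awards_le_count[OF that]
        by (intro average_mono integrable_awards integrable_carrier_count that)
      then show ?thesis using avg_cc by simp
    qed
    have PC: "- c\<^sub>0 * C \<le> P"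
    proof -
      have "- c\<^sub>0 * C \<le> - c\<^sub>0 * average n carrier_count" using avg_cc c0(1) by (intro mult_left_mono_neg) auto
      also have "\<dots> = average n (\<lambda>x. - c\<^sub>0 * carrier_count x)" by (rule average_cmult[symmetric])
      also have "\<dots> \<le> P" unfolding P_def
        by (intro average_mono integrable_profit_parts(3)[OF ip] c0(2) integrable_mult_right integrable_carrier_count)
      finally show ?thesis .
    qed
    \<comment> \<open>The fluid objective at the averages, but with the payments that are actually made.\<close>
    define E where "E = (\<Sum>e\<in>lanes M. revenue_rate e (d e)) - (\<Sum>e\<in>lanes M. penalty M e * (d e - y e)) - P"
    obtain F where FV: "ereal F \<le> fluid_value M" and EF0: "E \<le> F + K / real n * ((\<Sum>e\<in>lanes M. penalty M e * y e) - P)"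
      using fluid_point_from_averages[OF ip C _ K nK d(1) d(2)[unfolded y_def]] K1 unfolding E_def y_def P_def by auto
    have EF: "real n * E \<le> real n * F + K * (B + c\<^sub>0 * C)"
    proof -
      have "(\<Sum>e\<in>lanes M. penalty M e * y e) \<le> B"
        unfolding B_def using penalty_nonneg yC by (intro sum_mono mult_left_mono) auto
      then have "(\<Sum>e\<in>lanes M. penalty M e * y e) - P \<le> B + c\<^sub>0 * C" using PC by simp
      then have "K / real n * ((\<Sum>e\<in>lanes M. penalty M e * y e) - P) \<le> K / real n * (B + c\<^sub>0 * C)"
        using K1 by (intro mult_left_mono) auto
      then have "real n * E \<le> real n * (F + K / real n * (B + c\<^sub>0 * C))"
        using EF0 by (intro mult_left_mono) auto
      then show ?thesis using n by (simp add: distrib_left)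
    qed
    have rev: "(\<Sum>t<n. mean t total_revenue) \<le> real n * (\<Sum>e\<in>lanes M. revenue_rate e (d e)) + real (card (lanes M))"
    proof -
      have "mean t total_revenue = (\<Sum>e\<in>lanes M. mean t (revenue e))" for t
        unfolding total_revenue_def using integrable_profit_parts(4)[OF ip]
        by (intro Bochner_Integration.integral_sum) auto
      then have "(\<Sum>t<n. mean t total_revenue) = (\<Sum>e\<in>lanes M. \<Sum>t<n. mean t (revenue e))"
        by (simp add: sum.swap[of _ "lanes M"])
      also have "\<dots> \<le> (\<Sum>e\<in>lanes M. real n * revenue_rate e (d e) + 1)" using drev by (rule sum_mono)
      also have "\<dots> = real n * (\<Sum>e\<in>lanes M. revenue_rate e (d e)) + real (card (lanes M))"
        by (simp add: sum.distrib sum_distrib_left)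
      finally show ?thesis .
    qed
    have pen: "(\<Sum>t<n. mean (Suc t) total_penalty) = real n * (\<Sum>e\<in>lanes M. penalty M e * (d e - y e))"
    proof -
      have "mean t total_penalty = (\<Sum>e\<in>lanes M. penalty M e * mean t (loads e) - penalty M e * mean t (award_flow e))" for t
        unfolding total_penalty_def using integrable_penalty_term[OF ip]
        by (subst Bochner_Integration.integral_sum) auto
      then have "(\<Sum>t<n. mean (Suc t) total_penalty)
          = (\<Sum>e\<in>lanes M. penalty M e * (\<Sum>t<n. mean (Suc t) (loads e)) - penalty M e * (\<Sum>t<n. mean (Suc t) (award_flow e)))"
        by (simp add: sum.swap[of _ "lanes M"] sum_subtractf sum_distrib_left)
      also have "\<dots> = (\<Sum>e\<in>lanes M. real n * (penalty M e * (d e - y e)))"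
      proof (rule sum.cong[OF refl])
        fix e assume e: "e \<in> lanes M"
        have "(\<Sum>t<n. mean (Suc t) (award_flow e)) = real n * y e" using n by (simp add: y_def average_def)
        then show "penalty M e * (\<Sum>t<n. mean (Suc t) (loads e)) - penalty M e * (\<Sum>t<n. mean (Suc t) (award_flow e))
            = real n * (penalty M e * (d e - y e))"
          unfolding dpen[OF e, symmetric] by (simp add: algebra_simps)
      qed
      finally show ?thesis by (simp add: sum_distrib_left)
    qed
    have pp: "(\<Sum>t<n. mean (Suc t) total_pay) = real n * P" using n by (simp add: P_def average_def)
    have revn: "mean n total_revenue \<le> R"
      by (rule measure_pmf.integral_le_const) (use integrable_profit_parts(2)[OF ip] R(2) in auto)
    have "(\<Sum>s\<le>n. mean s profit) \<le> real n * E + real (card (lanes M)) + R + (\<bar>total_penalty x\<^sub>1\<bar> + \<bar>total_pay x\<^sub>1\<bar>)"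
      unfolding cumulative_profit_split[OF ip] pen pp E_def using rev revn by (simp add: right_diff_distrib)
    then have "(\<Sum>s\<le>n. mean s profit) \<le> real n * F + c" using EF by (simp add: c_def)
    then show ?thesis using FV by blast
  qed
  moreover obtain N :: nat where "K < real N" using reals_Archimedean2 by blast
  ultimately have "\<forall>n\<ge>N. \<exists>F. ereal F \<le> fluid_value M \<and> (\<Sum>s\<le>n. mean s profit) \<le> real n * F + c"
    by (meson less_le_trans of_nat_le_iff)
  then show ?thesis by blast
qed

end

theorem theorem1:
  fixes M :: "'n::finite market" and \<pi> :: "'n policy" and x\<^sub>1 :: "'n state" and \<gamma> :: ereal
  assumes "valid_market M"
    and "\<pi> \<in> policies M"
    and "has_average_profit M \<pi> x\<^sub>1 \<gamma>"
  shows "\<gamma> \<le> fluid_value M"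
proof -
  interpret market_policy M \<pi> "x\<^sub>1" using assms(1,2) by unfold_locales
  let ?E = "\<lambda>T. measure_pmf.expectation (history M \<pi> x\<^sub>1 T) (total_profit M \<pi>)"
  have int: "integrable (history M \<pi> x\<^sub>1 T) (total_profit M \<pi>)" for T
    using assms(3) by (simp add: has_average_profit_def)
  have lim: "(\<lambda>T. ereal (?E T / real (T + 1))) \<longlonglongrightarrow> \<gamma>"
    using assms(3) by (simp add: has_average_profit_def)
  have p: "profit = (\<lambda>x. period_profit M (\<pi> x) x)" by (auto simp: profit_def)
  have ip: "integrable (state_law t) profit" and E: "?E t = (\<Sum>s\<le>t. mean s profit)" for t
    unfolding p using total_profit_mean[OF int] by auto
  obtain c N where b: "\<And>n. n \<ge> N \<Longrightarrow> \<exists>F. ereal F \<le> fluid_value M \<and> ?E n \<le> real n * F + c"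
    using finite_horizon_bound[OF ip] unfolding E by blast
  show ?thesis
  proof (cases "fluid_value M")
    case (real F\<^sub>0)
    have "eventually (\<lambda>n. ereal (?E n / real (n + 1)) \<le> ereal ((real n * F\<^sub>0 + c) / real (n + 1))) sequentially"
      using eventually_ge_at_top[of N]
    proof eventually_elim
      case (elim n)
      obtain F where F: "ereal F \<le> fluid_value M" "?E n \<le> real n * F + c" using b[OF elim] by blast
      have "real n * F \<le> real n * F\<^sub>0" using F(1) real by (intro mult_left_mono) auto
      then have "?E n \<le> real n * F\<^sub>0 + c" using F(2) by simp
      then show ?case by (simp add: divide_right_mono)
    qed
    moreover have "(\<lambda>n. ereal ((real n * F\<^sub>0 + c) / real (n + 1))) \<longlonglongrightarrow> ereal F\<^sub>0"
    proof -
      have "(\<lambda>n. (real n * F\<^sub>0 + c) / real (n + 1)) \<longlonglongrightarrow> F\<^sub>0" by real_asymp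
      then show ?thesis by simp
    qed
    ultimately have "\<gamma> \<le> ereal F\<^sub>0"
      using tendsto_le[OF sequentially_bot _ lim] by blast
    then show ?thesis using real by simp
  next
    case MInf
    then show ?thesis using b[of N] by auto
  qed simp
qed

end
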